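(* Let $\mathfrak{g}$ be a finite-dimensional complex simple Lie algebra, let $\lambda\in\mathfrak{h}^*$, $l,k,c\in\mathbb{C}$, $0\neq\mu\in\Lambda^+$, and $a,b\in\mathbb{C}$ with $0\le\mathrm{Re}\,a<1$. Then the $\mathfrak{L(g)}$-module $L_{\lambda,l,k,c}^{\mu,a,b}$ is irreducible if and only if $$\varphi_n\big(\mathrm{Ann}_{U(\mathfrak{L(g)}_-)}(\bar u)\otimes L(\mu)\big)=L(\lambda,l,k,c)_0\otimes L(\mu)\quad\text{for all } n\in\mathbb{Z}.$$
   Context: All vector spaces are over $\mathbb{C}$; $\mathbb{N}$ denotes the positive integers, $\mathbb{Z}_+$ the nonnegative integers. $\mathfrak{g}$ is a finite-dimensional complex simple Lie algebra with Cartan subalgebra $\mathfrak{h}$, positive roots $\Delta_+$, triangular decomposition $\mathfrak{g}=\mathfrak{n}_-\oplus\mathfrak{h}\oplus\mathfrak{n}_+$, and invariant form $(\cdot\mid\cdot)$ (Killing form normalized so that $(\theta\mid\theta)=2$ for the highest root $\theta$). $\Lambda^+$ is the set of dominant integral weights of $\mathfrak{g}$. The affine-Virasoro algebra $\mathfrak{L(g)}=\bigoplus_{n\in\mathbb{Z}}\mathfrak{g}(n)\oplus\bigoplus_{n\in\mathbb{Z}}\mathbb{C}d_n\oplus\mathbb{C}\mathbf{k}\oplus\mathbb{C}\mathbf{c}$, where $\mathfrak{g}(n)=\{x(n):x\in\mathfrak{g}\}$ is a copy of $\mathfrak{g}$ ($x(n)=x\otimes t^n$, $x(0)$ identified with $x$),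 has brackets $[x(m),y(n)]=[x,y](m+n)+m(x\mid y)\delta_{m+n,0}\mathbf{k}$, $[d_m,d_n]=(n-m)d_{m+n}+\delta_{m+n,0}\frac{m^3-m}{12}\mathbf{c}$, $[d_n,x(m)]=m\,x(m+n)$, with $\mathbf{k},\mathbf{c}$ central. Put $\mathcal{H}=\mathfrak{h}+\mathbb{C}d_0+\mathbb{C}\mathbf{k}+\mathbb{C}\mathbf{c}$, $\mathfrak{L(g)}_+=\mathfrak{n}_+\oplus\bigoplus_{n\in\mathbb{N}}(\mathfrak{g}(n)\oplus\mathbb{C}d_n)$, $\mathfrak{L(g)}_-=\mathfrak{n}_-\oplus\bigoplus_{n\in\mathbb{N}}(\mathfrak{g}(-n)\oplus\mathbb{C}d_{-n})$, $\mathcal{V}_-=\bigoplus_{n\in\mathbb{N}}\mathbb{C}d_{-n}$. An element $P\in U(\mathfrak{L(g)})$ is homogeneous of degree $\deg(P)=m$ if $[d_0,P]=mP$. For $\lambda\in\mathfrak{h}^*$, $l,k,c\in\mathbb{C}$, the Verma module $M(\lambda,l,k,c)$ is induced from the one-dimensional $\mathcal{H}\oplus\mathfrak{L(g)}_+$-module $\mathbb{C}u$ with $hu=\lambda(h)u$ ($h\in\mathfrak{h}$), $d_0u=lu$, $\mathbf{k}u=ku$, $\mathbf{c}u=cu$, $\mathfrak{L(g)}_+u=0$. $L(\lambda,l,k,c)$ is its unique irreducible quotient, with highest weight vector $\bar u$ (the image of $u$). $L(\mu)$ is the finite-dimensional irreducible $\mathfrak{g}$-module with highest weight $\mu\in\Lambda^+$.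 $L(\lambda,l,k,c)_0=\{v\in L(\lambda,l,k,c)\mid d_0v=lv\}$, and $\mathrm{Ann}_{U(\mathfrak{L(g)}_-)}(\bar u)=\{P\in U(\mathfrak{L(g)}_-)\mid P\bar u=0\}$. For $a,b\in\mathbb{C}$, $L_{\lambda,l,k,c}^{\mu,a,b}$ is the vector space $L(\lambda,l,k,c)\otimes L(\mu)\otimes\mathbb{C}[t^{\pm1}]$ with $\mathfrak{L(g)}$-action $d_m(P\bar u\otimes v\otimes t^n)=\big((d_m+a+n-\deg(P)+bm)P\bar u\big)\otimes v\otimes t^{m+n}$, $x(m)(P\bar u\otimes v\otimes t^n)=\big(x(m)P\bar u\otimes v+P\bar u\otimes xv\big)\otimes t^{m+n}$, with $\mathbf{k},\mathbf{c}$ acting as the scalars $k,c$, for $x\in\mathfrak{g}$, $v\in L(\mu)$, $m,n\in\mathbb{Z}$ and homogeneous $P\in U(\mathfrak{L(g)}_-)$. This is an $\mathfrak{L(g)}$-module, isomorphic via $P\bar u\otimes v\otimes t^n\mapsto P\bar u\otimes v\otimes t^{n+\deg(P)}$ to the tensor product of $L(\lambda,l,k,c)$ with the loop module $L_{a,b}(\mu)=L(\mu)\otimes\mathbb{C}[t^{\pm1}]$, on which $d_m(v\otimes t^n)=(a+bm+n)v\otimes t^{m+n}$, $x(m)(v\otimes t^n)=(xv)\otimes t^{m+n}$, $\mathbf{k}=\mathbf{c}=0$. Maps $\psi_n$ and $\varphi_n$ (for fixed $a,b$): for $n\in\mathbb{Z}$, $\psi_n:U(\mathcal{V}_-)\to\mathbb{C}$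 is the (well-defined) linear map with $\psi_n(d_{-k_r}\cdots d_{-k_1})=\prod_{j=1}^r\big(k_jb-a-n-\sum_{i=1}^jk_i\big)$ for all $r\in\mathbb{Z}_+$, $k_1,\dots,k_r\in\mathbb{N}$ (so $\psi_n(1)=1$). For $x\in U(\mathfrak{g}\otimes t^{-1}\mathbb{C}[t^{-1}])$, $\tilde x\in U(\mathfrak{g})$ is obtained by omitting the $t$-degrees, i.e. $x\mapsto\tilde x$ is the algebra homomorphism with $x_{j_s}(-i_s)\cdots x_{j_1}(-i_1)\mapsto x_{j_s}\cdots x_{j_1}$. For $v\in L(\mu)$ define, linearly in the first argument, $1\circ v=v$ and $(g_1g_2\cdots g_s)\circ v=(-1)^sg_s\cdots g_2g_1v$ for $g_i\in\mathfrak{g}$. By PBW, $U(\mathfrak{L(g)}_-)=U(\mathfrak{g}\otimes t^{-1}\mathbb{C}[t^{-1}])\otimes U(\mathcal{V}_-)\otimes U(\mathfrak{n}_-)$ (via multiplication), and $\varphi_n:U(\mathfrak{L(g)}_-)\otimes L(\mu)\to L(\lambda,l,k,c)_0\otimes L(\mu)$ is the linear map with $\varphi_n(xyz\otimes v)=\psi_n(y)\,z\bar u\otimes(\tilde x\circ v)$ for $x\in U(\mathfrak{g}\otimes t^{-1}\mathbb{C}[t^{-1}])$, $y\in U(\mathcal{V}_-)$, $z\in U(\mathfrak{n}_-)$, $v\in L(\mu)$. *)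

theory Defs
  imports Complex_Main "HOL-Library.Poly_Mapping"
begin

section \<open>Complex vector spaces\<close>

class complex_vector = ab_group_add +
  fixes scaleC :: "complex \<Rightarrow> 'a \<Rightarrow> 'a" (infixr "*\<^sub>C" 75)
  assumes scaleC_add_right: "c *\<^sub>C (x + y) = c *\<^sub>C x + c *\<^sub>C y"
    and scaleC_add_left: "(c + d) *\<^sub>C x = c *\<^sub>C x + d *\<^sub>C x"
    and scaleC_scaleC: "c *\<^sub>C d *\<^sub>C x = (c * d) *\<^sub>C x"
    and scaleC_one: "1 *\<^sub>C x = x"

context complex_vector
begin

definition csubspace :: "'a set \<Rightarrow> bool"
  where "csubspace S \<longleftrightarrow> 0 \<in> S \<and> (\<forall>x\<in>S. \<forall>y\<in>S. x + y \<in> S) \<and> (\<forall>c. \<forall>x\<in>S. c *\<^sub>C x \<in> S)"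

definition cspan :: "'a set \<Rightarrow> 'a set"
  where "cspan X = \<Inter>{S. csubspace S \<and> X \<subseteq> S}"

end

global_interpretation cvec: vector_space "scaleC :: complex \<Rightarrow> 'a \<Rightarrow> 'a::complex_vector"
  by unfold_locales (rule scaleC_add_right scaleC_add_left scaleC_scaleC scaleC_one)+

text \<open>Inside a class specification the library notions are not available for the type of the
  class; \<open>csubspace\<close> and \<open>cspan\<close> are copies of them for use there.\<close>

lemma csubspace_eq: "csubspace = cvec.subspace"
  by (rule ext) (auto simp: csubspace_def cvec.subspace_def)

lemma cspan_eq: "cspan = cvec.span"
  by (rule ext) (simp add: cspan_def cvec.span_def hull_def csubspace_eq)

abbreviation clinear :: "('a::complex_vector \<Rightarrow> 'b::complex_vector) \<Rightarrow> bool"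
  where "clinear \<equiv> Vector_Spaces.linear scaleC scaleC"

instantiation complex :: complex_vector
begin
definition scaleC_complex_def: "c *\<^sub>C (z::complex) = c * z"
instance by standard (simp_all add: scaleC_complex_def algebra_simps)
end

instantiation poly_mapping :: (type, complex_vector) complex_vector
begin
definition scaleC_poly_mapping_def: "c *\<^sub>C p = Poly_Mapping.map (scaleC c) p"

lemma lookup_scaleC: "Poly_Mapping.lookup (c *\<^sub>C p) i = c *\<^sub>C Poly_Mapping.lookup p i"
  by (simp add: scaleC_poly_mapping_def Poly_Mapping.map.rep_eq when_def)

instance
  by standard (auto intro!: poly_mapping_eqI
      simp: lookup_scaleC lookup_add scaleC_add_right scaleC_add_left scaleC_scaleC scaleC_one)
end

text \<open>The sum of \<open>f i (p\<^sub>i)\<close> over the support of \<open>p\<close>.\<close>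

definition pm_sum :: "('i \<Rightarrow> 'b::zero \<Rightarrow> 'c::comm_monoid_add) \<Rightarrow> ('i \<Rightarrow>\<^sub>0 'b) \<Rightarrow> 'c"
  where "pm_sum f p = (\<Sum>i\<in>Poly_Mapping.keys p. f i (Poly_Mapping.lookup p i))"

lemma pm_sum_zero [simp]: "pm_sum f 0 = 0"
  by (simp add: pm_sum_def)

lemma pm_sum_single: "f i 0 = 0 \<Longrightarrow> pm_sum f (Poly_Mapping.single i x) = f i x"
  by (simp add: pm_sum_def)

lemma pm_sum_add:
  assumes "\<And>i. f i 0 = 0" "\<And>i x y. f i (x + y) = f i x + f i y"
  shows "pm_sum f (p + q) = pm_sum f p + pm_sum f q"
  unfolding pm_sum_def by (rule setsum_keys_plus_distrib) (use assms in auto)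

lemma pm_sum_fun_add: "pm_sum (\<lambda>i x. f i x + g i x) p = pm_sum f p + pm_sum g p"
  by (simp add: pm_sum_def sum.distrib)

lemma pm_sum_fun_zero [simp]: "pm_sum (\<lambda>i x. 0) p = 0"
  by (simp add: pm_sum_def)

lemma pm_sum_scale:
  fixes f :: "'i \<Rightarrow> 'b::complex_vector \<Rightarrow> 'c::complex_vector"
  assumes "\<And>i. f i 0 = 0" "\<And>i x. f i (c *\<^sub>C x) = c *\<^sub>C f i x"
  shows "pm_sum f (c *\<^sub>C p) = c *\<^sub>C pm_sum f p"
proof (cases "c = 0")
  case True
  then show ?thesis by simp
next
  case False
  then have "Poly_Mapping.keys (c *\<^sub>C p) = Poly_Mapping.keys p"
    by (auto simp: in_keys_iff lookup_scaleC)
  then show ?thesis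
    by (simp add: pm_sum_def lookup_scaleC assms cvec.scale_sum_right)
qed

lemma pm_sum_fun_scale:
  fixes f :: "'i \<Rightarrow> 'b::zero \<Rightarrow> 'c::complex_vector"
  shows "pm_sum (\<lambda>i x. c *\<^sub>C f i x) p = c *\<^sub>C pm_sum f p"
  by (simp add: pm_sum_def cvec.scale_sum_right)

lemma scaleC_single: "c *\<^sub>C Poly_Mapping.single i x = Poly_Mapping.single i (c *\<^sub>C x)"
  by (rule poly_mapping_eqI) (simp add: lookup_scaleC lookup_single when_def)

subsection \<open>Tensor products\<close>

inductive_set tensor_null ::
  "('a::complex_vector \<times> 'b::complex_vector \<Rightarrow>\<^sub>0 complex) set" where
  zero: "0 \<in> tensor_null"
| add: "p \<in> tensor_null \<Longrightarrow> q \<in> tensor_null \<Longrightarrow> p + q \<in> tensor_null"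
| scale: "p \<in> tensor_null \<Longrightarrow> c *\<^sub>C p \<in> tensor_null"
| add_left: "Poly_Mapping.single (x + x', y) 1 - Poly_Mapping.single (x, y) 1
    - Poly_Mapping.single (x', y) 1 \<in> tensor_null"
| add_right: "Poly_Mapping.single (x, y + y') 1 - Poly_Mapping.single (x, y) 1
    - Poly_Mapping.single (x, y') 1 \<in> tensor_null"
| scale_left: "Poly_Mapping.single (c *\<^sub>C x, y) 1 - Poly_Mapping.single (x, y) c \<in> tensor_null"
| scale_right: "Poly_Mapping.single (x, c *\<^sub>C y) 1 - Poly_Mapping.single (x, y) c \<in> tensor_null"

lemma tensor_null_uminus: "p \<in> tensor_null \<Longrightarrow> - p \<in> tensor_null"
  using tensor_null.scale[of p "-1"] by (simp add: cvec.scale_minus_left)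

definition tensor_rel ::
  "('a::complex_vector \<times> 'b::complex_vector \<Rightarrow>\<^sub>0 complex) \<Rightarrow> ('a \<times> 'b \<Rightarrow>\<^sub>0 complex) \<Rightarrow> bool"
  where "tensor_rel p q \<longleftrightarrow> p - q \<in> tensor_null"

quotient_type (overloaded) ('a, 'b) tensor =
  "'a::complex_vector \<times> 'b::complex_vector \<Rightarrow>\<^sub>0 complex" / tensor_rel
proof (rule equivpI)
  show "reflp tensor_rel"
    by (auto simp: reflp_def tensor_rel_def tensor_null.zero)
  show "symp tensor_rel"
    unfolding symp_def tensor_rel_def using tensor_null_uminus by fastforce
  show "transp tensor_rel"
    unfolding transp_def tensor_rel_def using tensor_null.add by fastforce
qed

instantiation tensor :: (complex_vector, complex_vector) complex_vector
begin

lift_definition zero_tensor :: "('a, 'b) tensor" is 0 .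
lift_definition plus_tensor :: "('a, 'b) tensor \<Rightarrow> ('a, 'b) tensor \<Rightarrow> ('a, 'b) tensor" is "(+)"
  unfolding tensor_rel_def add_diff_add by (rule tensor_null.add)
lift_definition uminus_tensor :: "('a, 'b) tensor \<Rightarrow> ('a, 'b) tensor" is "uminus"
  unfolding tensor_rel_def minus_diff_minus by (rule tensor_null_uminus)
lift_definition minus_tensor :: "('a, 'b) tensor \<Rightarrow> ('a, 'b) tensor \<Rightarrow> ('a, 'b) tensor" is "(-)"
proof -
  fix p p' q q' :: "'a \<times> 'b \<Rightarrow>\<^sub>0 complex"
  assume "tensor_rel p p'" "tensor_rel q q'"
  then have "(p - p') + - (q - q') \<in> tensor_null"
    unfolding tensor_rel_def by (intro tensor_null.add tensor_null_uminus)
  then show "tensor_rel (p - q) (p' - q')"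
    by (simp add: tensor_rel_def algebra_simps)
qed
lift_definition scaleC_tensor :: "complex \<Rightarrow> ('a, 'b) tensor \<Rightarrow> ('a, 'b) tensor" is "scaleC"
  unfolding tensor_rel_def cvec.scale_right_diff_distrib[symmetric] by (rule tensor_null.scale)

instance
  by standard
    (transfer, simp add: tensor_rel_def algebra_simps scaleC_add_right scaleC_add_left
      scaleC_scaleC scaleC_one tensor_null.zero)+

end

lift_definition tensor_of :: "'a::complex_vector \<Rightarrow> 'b::complex_vector \<Rightarrow> ('a, 'b) tensor"
  (infixl "\<otimes>" 70) is "\<lambda>x y. Poly_Mapping.single (x, y) 1" .

definition tensor_sub :: "'a::complex_vector set \<Rightarrow> 'b::complex_vector set \<Rightarrow> ('a, 'b) tensor set"
  where "tensor_sub A B = cvec.span {x \<otimes> y | x y. x \<in> A \<and> y \<in> B}"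

section \<open>Lie algebras and simple Lie algebras\<close>

class lie_algebra = complex_vector +
  fixes lie :: "'a \<Rightarrow> 'a \<Rightarrow> 'a"
  assumes lie_add_left: "lie (x + y) z = lie x z + lie y z"
    and lie_add_right: "lie x (y + z) = lie x y + lie x z"
    and lie_scale_left: "lie (c *\<^sub>C x) y = c *\<^sub>C lie x y"
    and lie_scale_right: "lie x (c *\<^sub>C y) = c *\<^sub>C lie x y"
    and lie_self: "lie x x = 0"
    and lie_jacobi: "lie x (lie y z) + lie y (lie z x) + lie z (lie x y) = 0"

context lie_algebra
begin

definition lie_ideal :: "'a set \<Rightarrow> bool"
  where "lie_ideal I \<longleftrightarrow> csubspace I \<and> (\<forall>x. \<forall>y\<in>I. lie x y \<in> I)"

text \<open>Cartan subalgebras of semisimple Lie algebras: abelian, self-centralizing and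
  consisting of ad-diagonalizable elements.\<close>

definition cartan_subalgebra :: "'a set \<Rightarrow> bool"
  where "cartan_subalgebra H \<longleftrightarrow> csubspace H \<and>
    (\<forall>x\<in>H. \<forall>y\<in>H. lie x y = 0) \<and>
    (\<forall>x. (\<forall>h\<in>H. lie h x = 0) \<longrightarrow> x \<in> H) \<and>
    (\<forall>h\<in>H. cspan {x. \<exists>e. lie h x = e *\<^sub>C x} = UNIV)"

text \<open>The dual space of a subspace \<open>H\<close>; functionals on \<open>H\<close> are represented by functions that
  vanish outside \<open>H\<close>.\<close>

definition dual_of :: "'a set \<Rightarrow> ('a \<Rightarrow> complex) set"
  where "dual_of H = {\<alpha>. (\<forall>x\<in>H. \<forall>y\<in>H. \<alpha> (x + y) = \<alpha> x + \<alpha> y) \<and>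
    (\<forall>c. \<forall>x\<in>H. \<alpha> (c *\<^sub>C x) = c * \<alpha> x) \<and> (\<forall>x. x \<notin> H \<longrightarrow> \<alpha> x = 0)}"

definition root_space :: "'a set \<Rightarrow> ('a \<Rightarrow> complex) \<Rightarrow> 'a set"
  where "root_space H \<alpha> = {x. \<forall>h\<in>H. lie h x = \<alpha> h *\<^sub>C x}"

definition roots :: "'a set \<Rightarrow> ('a \<Rightarrow> complex) set"
  where "roots H = {\<alpha> \<in> dual_of H. \<alpha> \<noteq> (\<lambda>_. 0) \<and> (\<exists>x\<in>root_space H \<alpha>. x \<noteq> 0)}"

text \<open>A base of the root system; as the roots of a semisimple Lie algebra span the dual of the
  Cartan subalgebra, the linearly independent set \<open>\<Pi>\<close> is then a basis of it.\<close>

definition root_base :: "'a set \<Rightarrow> ('a \<Rightarrow> complex) set \<Rightarrow> bool"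
  where "root_base H \<Pi> \<longleftrightarrow> finite \<Pi> \<and> \<Pi> \<subseteq> roots H \<and>
    (\<forall>c. (\<forall>x. (\<Sum>\<alpha>\<in>\<Pi>. c \<alpha> * \<alpha> x) = 0) \<longrightarrow> (\<forall>\<alpha>\<in>\<Pi>. c \<alpha> = 0)) \<and>
    (\<forall>\<beta>\<in>roots H. \<exists>m :: ('a \<Rightarrow> complex) \<Rightarrow> nat.
      (\<forall>x. \<beta> x = (\<Sum>\<alpha>\<in>\<Pi>. of_nat (m \<alpha>) * \<alpha> x)) \<or>
      (\<forall>x. \<beta> x = - (\<Sum>\<alpha>\<in>\<Pi>. of_nat (m \<alpha>) * \<alpha> x)))"

definition positive_system :: "'a set \<Rightarrow> ('a \<Rightarrow> complex) set \<Rightarrow> bool"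
  where "positive_system H P \<longleftrightarrow> (\<exists>\<Pi>. root_base H \<Pi> \<and>
    P = {\<beta> \<in> roots H. \<exists>m :: ('a \<Rightarrow> complex) \<Rightarrow> nat.
          \<forall>x. \<beta> x = (\<Sum>\<alpha>\<in>\<Pi>. of_nat (m \<alpha>) * \<alpha> x)})"

end

text \<open>A finite-dimensional complex simple Lie algebra together with a chosen Cartan subalgebra
  and a chosen system of positive roots.\<close>

class simple_lie_algebra = lie_algebra +
  fixes cartan :: "'a set" and pos_roots :: "('a \<Rightarrow> complex) set"
  assumes finite_dimensional: "\<exists>B. finite B \<and> cspan B = UNIV"
    and non_abelian: "\<exists>x y. lie x y \<noteq> 0"
    and ideal_trivial: "lie_ideal I \<Longrightarrow> I = {0} \<or> I = UNIV"
    and cartan: "cartan_subalgebra cartan"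
    and pos_roots: "positive_system cartan pos_roots"

definition n_plus :: "'g::simple_lie_algebra set"
  where "n_plus = cvec.span (\<Union>\<alpha>\<in>pos_roots. root_space cartan \<alpha>)"

definition n_minus :: "'g::simple_lie_algebra set"
  where "n_minus = cvec.span (\<Union>\<alpha>\<in>pos_roots. root_space cartan (\<lambda>h. - \<alpha> h))"

subsection \<open>The normalized invariant form\<close>

definition some_basis :: "'a::complex_vector set"
  where "some_basis = (SOME B. cvec.independent B \<and> cvec.span B = UNIV)"

text \<open>Independent of the choice of the basis; zero on infinite-dimensional spaces.\<close>

definition lin_trace :: "('a::complex_vector \<Rightarrow> 'a) \<Rightarrow> complex"
  where "lin_trace f = (\<Sum>b\<in>some_basis. cvec.representation some_basis (f b) b)"

definition killing :: "'a::lie_algebra \<Rightarrow> 'a \<Rightarrow> complex"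
  where "killing x y = lin_trace (\<lambda>z. lie x (lie y z))"

text \<open>The form on the dual of the Cartan subalgebra induced by a form \<open>B\<close> on the algebra that is
  nondegenerate on the Cartan subalgebra.\<close>

definition dual_vec ::
  "('g::simple_lie_algebra \<Rightarrow> 'g \<Rightarrow> complex) \<Rightarrow> ('g \<Rightarrow> complex) \<Rightarrow> 'g"
  where "dual_vec B \<alpha> = (THE t. t \<in> cartan \<and> (\<forall>h\<in>cartan. B t h = \<alpha> h))"

definition dual_form ::
  "('g::simple_lie_algebra \<Rightarrow> 'g \<Rightarrow> complex) \<Rightarrow> ('g \<Rightarrow> complex) \<Rightarrow> ('g \<Rightarrow> complex) \<Rightarrow> complex"
  where "dual_form B \<alpha> \<beta> = B (dual_vec B \<alpha>) (dual_vec B \<beta>)"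

definition highest_root :: "'g::simple_lie_algebra \<Rightarrow> complex"
  where "highest_root = (THE \<theta>. \<theta> \<in> roots cartan \<and>
    (\<forall>\<alpha>\<in>roots cartan. \<exists>m :: ('g \<Rightarrow> complex) \<Rightarrow> nat.
      \<forall>x. \<theta> x - \<alpha> x = (\<Sum>\<beta>\<in>pos_roots. of_nat (m \<beta>) * \<beta> x)))"

definition form_scale :: "'g::simple_lie_algebra itself \<Rightarrow> complex"
  where "form_scale _ = (THE r. dual_form (\<lambda>x y :: 'g. r * killing x y)
    (highest_root :: 'g \<Rightarrow> complex) highest_root = 2)"

definition inv_form :: "'g::simple_lie_algebra \<Rightarrow> 'g \<Rightarrow> complex"
  where "inv_form x y = form_scale TYPE('g) * killing x y"

definition dominant_integral :: "('g::simple_lie_algebra \<Rightarrow> complex) set"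
  where "dominant_integral = {\<mu> \<in> dual_of cartan. \<forall>\<alpha>\<in>pos_roots. \<exists>m::nat.
    2 * dual_form inv_form \<mu> \<alpha> / dual_form inv_form \<alpha> \<alpha> = of_nat m}"

lemma some_basis:
  "cvec.independent (some_basis :: 'a::complex_vector set)"
  "cvec.span (some_basis :: 'a::complex_vector set) = UNIV"
proof -
  have "\<exists>B :: 'a set. cvec.independent B \<and> cvec.span B = UNIV"
    by (rule exI, rule conjI, rule cvec.independent_extend_basis[OF cvec.independent_empty],
      rule cvec.span_extend_basis[OF cvec.independent_empty])
  from someI_ex[OF this]
  show "cvec.independent (some_basis :: 'a set)" "cvec.span (some_basis :: 'a set) = UNIV"
    unfolding some_basis_def by blast+
qed

lemma lin_trace_add:
  fixes f g :: "'a::complex_vector \<Rightarrow> 'a"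
  shows "lin_trace (\<lambda>x. f x + g x) = lin_trace f + lin_trace g"
proof -
  let ?B = "some_basis :: 'a set"
  have B: "cvec.independent ?B" "cvec.span ?B = UNIV"
    by (rule some_basis)+
  show ?thesis
    using cvec.representation_add[OF B(1)] B(2)
    by (simp add: lin_trace_def sum.distrib)
qed

lemma lin_trace_scale:
  fixes f :: "'a::complex_vector \<Rightarrow> 'a"
  shows "lin_trace (\<lambda>x. c *\<^sub>C f x) = c * lin_trace f"
proof -
  let ?B = "some_basis :: 'a set"
  have B: "cvec.independent ?B" "cvec.span ?B = UNIV"
    by (rule some_basis)+
  show ?thesis
    using cvec.representation_scale[OF B(1)] B(2)
    by (simp add: lin_trace_def sum_distrib_left)
qed

lemma lin_trace_commute:
  fixes f g :: "'a::complex_vector \<Rightarrow> 'a"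
  assumes "clinear f" "clinear g"
  shows "lin_trace (\<lambda>x. f (g x)) = lin_trace (\<lambda>x. g (f x))"
proof -
  let ?B = "some_basis :: 'a set"
  have B: "cvec.independent ?B" "cvec.span ?B = UNIV"
    by (rule some_basis)+
  show ?thesis
  proof (cases "finite ?B")
    case False
    then show ?thesis by (simp add: lin_trace_def)
  next
    case True
    have *: "cvec.representation ?B (f (g b)) b =
        (\<Sum>b'\<in>?B. cvec.representation ?B (g b) b' * cvec.representation ?B (f b') b)"
      if "clinear f" for f g :: "'a \<Rightarrow> 'a" and b
    proof -
      interpret f: Vector_Spaces.linear scaleC scaleC f by fact
      have "g b = (\<Sum>b'\<in>?B. cvec.representation ?B (g b) b' *\<^sub>C b')"
        using cvec.sum_representation_eq[OF B(1) _ True order_refl] B(2) by simp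
      then have "f (g b) = (\<Sum>b'\<in>?B. cvec.representation ?B (g b) b' *\<^sub>C f b')"
        by (metis (mono_tags, lifting) f.scale f.sum sum.cong)
      then show ?thesis
        using cvec.representation_sum[OF B(1), of ?B] cvec.representation_scale[OF B(1)] B(2)
        by simp
    qed
    show ?thesis
      unfolding lin_trace_def *[OF assms(1), where g = g] *[OF assms(2), where g = f]
      by (subst sum.swap) (simp add: mult.commute)
  qed
qed

lemma lie_zero_left [simp]: "lie 0 (x::'a::lie_algebra) = 0"
  using lie_add_left[of 0 0 x] by simp

lemma lie_zero_right [simp]: "lie (x::'a::lie_algebra) 0 = 0"
  using lie_add_right[of x 0 0] by simp

lemma lie_antisym: "lie (y::'a::lie_algebra) x = - lie x y"
proof -
  have "lie x y + lie y x = 0"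
    using lie_self[of "x + y"] unfolding lie_add_left lie_add_right by (simp add: lie_self add.commute)
  then show ?thesis
    by (metis add.commute eq_neg_iff_add_eq_0)
qed

lemma lie_minus_right: "lie (x::'a::lie_algebra) (- y) = - lie x y"
  using lie_add_right[of x y "- y"] by (simp add: eq_neg_iff_add_eq_0 add.commute[of _ "lie x y"])

lemma lie_jacobi': "lie (lie x y) (z::'a::lie_algebra) = lie x (lie y z) - lie y (lie x z)"
proof -
  have "lie z (lie x y) = - lie x (lie y z) - lie y (lie z x)"
    using lie_jacobi[of x y z] by (simp add: algebra_simps eq_neg_iff_add_eq_0)
  then show ?thesis
    by (simp add: lie_antisym[of "lie x y" z] lie_antisym[of z x] lie_minus_right)
qed

lemma clinear_lie: "clinear (lie (x::'a::lie_algebra))"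
  by unfold_locales (simp_all add: lie_add_right lie_scale_right)

lemma killing_commute: "killing x y = killing y x"
  unfolding killing_def using lin_trace_commute[OF clinear_lie clinear_lie] by blast

lemma killing_add_left: "killing (x + y) z = killing x z + killing y z"
  by (simp add: killing_def lie_add_left lin_trace_add)

lemma killing_scale_left: "killing (c *\<^sub>C x) z = c * killing x z"
  by (simp add: killing_def lie_scale_left lin_trace_scale)

lemma killing_invariant: "killing (lie x y) z = killing x (lie y z)"
proof -
  have "(\<lambda>w. lie (lie x y) (lie z w)) =
      (\<lambda>w. lie x (lie y (lie z w)) + (-1) *\<^sub>C lie y (lie x (lie z w)))"
    by (simp add: lie_jacobi')
  then have 1: "killing (lie x y) z =
      lin_trace (\<lambda>w. lie x (lie y (lie z w))) + (-1) * lin_trace (\<lambda>w. lie y (lie x (lie z w)))"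
    unfolding killing_def by (simp only: lin_trace_add lin_trace_scale)
  have "(\<lambda>w. lie x (lie (lie y z) w)) =
      (\<lambda>w. lie x (lie y (lie z w)) + (-1) *\<^sub>C lie x (lie z (lie y w)))"
    by (simp add: lie_jacobi' lie_add_right[of x _ "- _"] lie_minus_right flip: add_uminus_conv_diff)
  then have 2: "killing x (lie y z) =
      lin_trace (\<lambda>w. lie x (lie y (lie z w))) + (-1) * lin_trace (\<lambda>w. lie x (lie z (lie y w)))"
    unfolding killing_def by (simp only: lin_trace_add lin_trace_scale)
  have "clinear (\<lambda>w. lie x (lie z w))"
    by unfold_locales (simp_all add: lie_add_right lie_scale_right)
  from lin_trace_commute[OF clinear_lie[of y] this] show ?thesis
    by (simp add: 1 2)
qed

lemma inv_form_commute: "inv_form x y = inv_form y x"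
  by (simp add: inv_form_def killing_commute)

lemma inv_form_add_left: "inv_form (x + y) z = inv_form x z + inv_form y z"
  by (simp add: inv_form_def killing_add_left algebra_simps)

lemma inv_form_add_right: "inv_form z (x + y) = inv_form z x + inv_form z y"
  by (simp add: inv_form_commute[of z] inv_form_add_left)

lemma inv_form_scale_left: "inv_form (c *\<^sub>C x) z = c * inv_form x z"
  by (simp add: inv_form_def killing_scale_left)

lemma inv_form_scale_right: "inv_form z (c *\<^sub>C x) = c * inv_form z x"
  by (simp add: inv_form_commute[of z] inv_form_scale_left)

lemma inv_form_zero [simp]: "inv_form 0 z = 0" "inv_form z 0 = 0"
  using inv_form_scale_left[of 0 0 z] inv_form_scale_right[of z 0 0] by simp_all

lemma inv_form_invariant: "inv_form (lie x y) z = inv_form x (lie y z)"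
  by (simp add: inv_form_def killing_invariant)

section \<open>The affine-Virasoro algebra\<close>

text \<open>An element consists of the coefficients in \<open>g\<close> of the powers of \<open>t\<close>, the coefficients of
  the \<open>d\<^sub>n\<close>, and the coefficients of the two central elements.\<close>

context
  notes [[typedef_overloaded]]
begin

datatype ('g::zero) affvir =
  AffVir (loop: "int \<Rightarrow>\<^sub>0 'g") (vir: "int \<Rightarrow>\<^sub>0 complex") (kcoeff: complex) (ccoeff: complex)

end

instantiation affvir :: (complex_vector) complex_vector
begin
definition "0 = AffVir 0 0 0 0"
definition "X + Y = AffVir (loop X + loop Y) (vir X + vir Y) (kcoeff X + kcoeff Y) (ccoeff X + ccoeff Y)"
definition "- X = AffVir (- loop X) (- vir X) (- kcoeff X) (- ccoeff X)"
definition "X - Y = AffVir (loop X - loop Y) (vir X - vir Y) (kcoeff X - kcoeff Y) (ccoeff X - ccoeff Y)"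
definition "s *\<^sub>C X = AffVir (s *\<^sub>C loop X) (s *\<^sub>C vir X) (s * kcoeff X) (s * ccoeff X)"
instance
  by standard (simp_all add: zero_affvir_def plus_affvir_def uminus_affvir_def minus_affvir_def
      scaleC_affvir_def scaleC_add_right scaleC_add_left scaleC_scaleC scaleC_one algebra_simps)
end

definition av_g :: "int \<Rightarrow> 'g \<Rightarrow> 'g::complex_vector affvir"
  where "av_g n x = AffVir (Poly_Mapping.single n x) 0 0 0"

definition av_d :: "int \<Rightarrow> 'g::complex_vector affvir"
  where "av_d n = AffVir 0 (Poly_Mapping.single n 1) 0 0"

definition av_k :: "'g::complex_vector affvir"
  where "av_k = AffVir 0 0 1 0"

definition av_c :: "'g::complex_vector affvir"
  where "av_c = AffVir 0 0 0 1"

text \<open>\<open>graded_ext f\<close> is the biadditive map taking \<open>(x t\<^sup>m, y t\<^sup>n)\<close> to \<open>(f m n x y) t\<^sup>m\<^sup>+\<^sup>n\<close>.\<close>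

definition graded_ext ::
  "(int \<Rightarrow> int \<Rightarrow> 'a::zero \<Rightarrow> 'b::zero \<Rightarrow> 'c::comm_monoid_add) \<Rightarrow> (int \<Rightarrow>\<^sub>0 'a) \<Rightarrow> (int \<Rightarrow>\<^sub>0 'b) \<Rightarrow> int \<Rightarrow>\<^sub>0 'c"
  where "graded_ext f p q =
    pm_sum (\<lambda>m x. pm_sum (\<lambda>n y. Poly_Mapping.single (m + n) (f m n x y)) q) p"

definition av_bracket :: "'g::simple_lie_algebra affvir \<Rightarrow> 'g affvir \<Rightarrow> 'g affvir"
  where "av_bracket X Y = AffVir
    (graded_ext (\<lambda>m n x y. lie x y) (loop X) (loop Y)
      + graded_ext (\<lambda>n m s y. (s * of_int m) *\<^sub>C y) (vir X) (loop Y)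
      - graded_ext (\<lambda>n m s x. (s * of_int m) *\<^sub>C x) (vir Y) (loop X))
    (graded_ext (\<lambda>m n s r. of_int (n - m) * s * r) (vir X) (vir Y))
    (pm_sum (\<lambda>m x. of_int m * inv_form x (Poly_Mapping.lookup (loop Y) (- m))) (loop X))
    (pm_sum (\<lambda>m s. of_int (m ^ 3 - m) / 12 * s * Poly_Mapping.lookup (vir Y) (- m)) (vir X))"

lemma affvir_sel [simp]:
  "loop 0 = 0" "vir 0 = 0" "kcoeff 0 = 0" "ccoeff 0 = 0"
  "loop (X + Y) = loop X + loop Y" "vir (X + Y) = vir X + vir Y"
  "kcoeff (X + Y) = kcoeff X + kcoeff Y" "ccoeff (X + Y) = ccoeff X + ccoeff Y"
  "loop (- X) = - loop X" "vir (- X) = - vir X" "kcoeff (- X) = - kcoeff X" "ccoeff (- X) = - ccoeff X"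
  "loop (X - Y) = loop X - loop Y" "vir (X - Y) = vir X - vir Y"
  "kcoeff (X - Y) = kcoeff X - kcoeff Y" "ccoeff (X - Y) = ccoeff X - ccoeff Y"
  "loop (s *\<^sub>C X) = s *\<^sub>C loop X" "vir (s *\<^sub>C X) = s *\<^sub>C vir X"
  "kcoeff (s *\<^sub>C X) = s * kcoeff X" "ccoeff (s *\<^sub>C X) = s * ccoeff X"
  by (simp_all add: zero_affvir_def plus_affvir_def uminus_affvir_def minus_affvir_def scaleC_affvir_def)

lemma affvir_eqI:
  "loop X = loop Y \<Longrightarrow> vir X = vir Y \<Longrightarrow> kcoeff X = kcoeff Y \<Longrightarrow> ccoeff X = ccoeff Y \<Longrightarrow> X = Y"
  by (cases X; cases Y) simp


lemma pm_induct [case_names single add]: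
  assumes "\<And>i x. P (Poly_Mapping.single i x)" "\<And>p q. P p \<Longrightarrow> P q \<Longrightarrow> P (p + q)"
  shows "P (p :: 'i \<Rightarrow>\<^sub>0 'b::comm_monoid_add)"
proof (induction p rule: update_induct)
  case const
  show ?case using assms(1)[of undefined 0] by simp
next
  case (update p i x)
  have "Poly_Mapping.update i x p = Poly_Mapping.single i x + p"
    using update(1) by (intro poly_mapping_eqI)
      (auto simp: lookup_update lookup_add lookup_single when_def in_keys_iff)
  then show ?case using assms update by simp
qed

lemma affvir_induct [case_names g d k c add scale]:
  fixes X :: "'g::complex_vector affvir"
  assumes g: "\<And>n x. P (av_g n x)" and d: "\<And>n. P (av_d n)" and k: "P av_k" and c: "P av_c"
    and add: "\<And>X Y. P X \<Longrightarrow> P Y \<Longrightarrow> P (X + Y)" and scale: "\<And>s X. P X \<Longrightarrow> P (s *\<^sub>C X)"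
  shows "P X"
proof -
  have 1: "P (AffVir p 0 0 0)" for p
  proof (induction p rule: pm_induct)
    case (single i x)
    then show ?case using g[of i x] by (simp add: av_g_def)
  next
    case (add p q)
    from assms(5)[OF this] show ?case by (simp add: plus_affvir_def)
  qed
  have 2: "P (AffVir 0 p 0 0)" for p
  proof (induction p rule: pm_induct)
    case (single i x)
    then show ?case using scale[OF d[of i], of x]
      by (simp add: av_d_def scaleC_affvir_def scaleC_single scaleC_complex_def)
  next
    case (add p q)
    from assms(5)[OF this] show ?case by (simp add: plus_affvir_def)
  qed
  have 3: "P (AffVir 0 0 s 0)" for s
    using scale[OF k, of s] by (simp add: av_k_def scaleC_affvir_def)
  have 4: "P (AffVir 0 0 0 s)" for s
    using scale[OF c, of s] by (simp add: av_c_def scaleC_affvir_def)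
  have "X = AffVir (loop X) 0 0 0 + (AffVir 0 (vir X) 0 0 + (AffVir 0 0 (kcoeff X) 0 + AffVir 0 0 0 (ccoeff X)))"
    by (simp add: plus_affvir_def)
  with add[OF 1[of "loop X"] add[OF 2[of "vir X"] add[OF 3[of "kcoeff X"] 4[of "ccoeff X"]]]]
  show ?thesis by simp
qed

lemma graded_ext_add_left:
  assumes "\<And>m n y. f m n 0 y = 0" "\<And>m n x x' y. f m n (x + x') y = f m n x y + f m n x' y"
  shows "graded_ext f (p + p') q = graded_ext f p q + graded_ext f p' q"
  unfolding graded_ext_def
  by (rule pm_sum_add) (simp_all add: assms single_add pm_sum_fun_add)

lemma graded_ext_add_right:
  assumes "\<And>m n x. f m n x 0 = 0" "\<And>m n x y y'. f m n x (y + y') = f m n x y + f m n x y'"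
  shows "graded_ext f p (q + q') = graded_ext f p q + graded_ext f p q'"
proof -
  have "pm_sum (\<lambda>n y. Poly_Mapping.single (m + n) (f m n x y)) (q + q') =
    pm_sum (\<lambda>n y. Poly_Mapping.single (m + n) (f m n x y)) q +
    pm_sum (\<lambda>n y. Poly_Mapping.single (m + n) (f m n x y)) q'" for m x
    by (rule pm_sum_add) (simp_all add: assms single_add)
  then show ?thesis
    by (simp add: graded_ext_def pm_sum_fun_add)
qed

lemma graded_ext_scale_left:
  fixes f :: "int \<Rightarrow> int \<Rightarrow> 'a::complex_vector \<Rightarrow> 'b::zero \<Rightarrow> 'c::complex_vector"
  assumes "\<And>m n y. f m n 0 y = 0" "\<And>m n x y. f m n (c *\<^sub>C x) y = c *\<^sub>C f m n x y"
  shows "graded_ext f (c *\<^sub>C p) q = c *\<^sub>C graded_ext f p q"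
  unfolding graded_ext_def
  by (rule pm_sum_scale) (simp_all add: assms flip: scaleC_single pm_sum_fun_scale)

lemma graded_ext_scale_right:
  fixes f :: "int \<Rightarrow> int \<Rightarrow> 'a::zero \<Rightarrow> 'b::complex_vector \<Rightarrow> 'c::complex_vector"
  assumes "\<And>m n x. f m n x 0 = 0" "\<And>m n x y. f m n x (c *\<^sub>C y) = c *\<^sub>C f m n x y"
  shows "graded_ext f p (c *\<^sub>C q) = c *\<^sub>C graded_ext f p q"
proof -
  have "pm_sum (\<lambda>n y. Poly_Mapping.single (m + n) (f m n x y)) (c *\<^sub>C q) =
    c *\<^sub>C pm_sum (\<lambda>n y. Poly_Mapping.single (m + n) (f m n x y)) q" for m x
    by (rule pm_sum_scale) (simp_all add: assms flip: scaleC_single)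
  then show ?thesis
    by (simp add: graded_ext_def pm_sum_fun_scale)
qed

lemma graded_ext_single:
  assumes "\<And>m n y. f m n 0 y = 0" "\<And>m n x. f m n x 0 = 0"
  shows "graded_ext f (Poly_Mapping.single m x) (Poly_Mapping.single n y) =
    Poly_Mapping.single (m + n) (f m n x y)"
  by (simp add: graded_ext_def pm_sum_single assms)

lemma graded_ext_zero [simp]: "graded_ext f 0 q = 0" "graded_ext f p 0 = 0"
  by (simp_all add: graded_ext_def)

lemmas bracket_simps = lie_add_left lie_add_right lie_scale_left lie_scale_right
  scaleC_add_right scaleC_add_left scaleC_scaleC scaleC_complex_def lookup_add lookup_scaleC
  inv_form_add_left inv_form_add_right inv_form_scale_left inv_form_scale_right
  distrib_left distrib_right

lemma pm_sum_scale_complex: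
  fixes f :: "'i \<Rightarrow> 'b::complex_vector \<Rightarrow> complex"
  assumes "\<And>i. f i 0 = 0" "\<And>i x. f i (c *\<^sub>C x) = c * f i x"
  shows "pm_sum f (c *\<^sub>C p) = c * pm_sum f p"
  using pm_sum_scale[of f c p] assms by (simp add: scaleC_complex_def)

lemma pm_sum_fun_scale_complex: "pm_sum (\<lambda>i x. (c::complex) * f i x) p = c * pm_sum f p"
  using pm_sum_fun_scale[of c f p] by (simp add: scaleC_complex_def)

lemma av_bracket_add_left: "av_bracket (X + Y) Z = av_bracket X Z + av_bracket Y Z"
proof (rule affvir_eqI)
  show "loop (av_bracket (X + Y) Z) = loop (av_bracket X Z + av_bracket Y Z)"
    by (simp add: av_bracket_def graded_ext_add_left graded_ext_add_right bracket_simps)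
  show "vir (av_bracket (X + Y) Z) = vir (av_bracket X Z + av_bracket Y Z)"
    by (simp add: av_bracket_def graded_ext_add_left bracket_simps del: of_int_diff)
  show "kcoeff (av_bracket (X + Y) Z) = kcoeff (av_bracket X Z + av_bracket Y Z)"
    by (simp add: av_bracket_def pm_sum_add bracket_simps)
  show "ccoeff (av_bracket (X + Y) Z) = ccoeff (av_bracket X Z + av_bracket Y Z)"
    by (simp add: av_bracket_def pm_sum_add bracket_simps add_divide_distrib del: of_int_diff)
qed

lemma av_bracket_scale_left: "av_bracket (c *\<^sub>C X) Y = c *\<^sub>C av_bracket X Y"
proof (rule affvir_eqI)
  show "loop (av_bracket (c *\<^sub>C X) Y) = loop (c *\<^sub>C av_bracket X Y)"
    by (simp add: av_bracket_def graded_ext_scale_left graded_ext_scale_right bracket_simps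
        cvec.scale_right_diff_distrib mult.commute mult.left_commute)
  show "vir (av_bracket (c *\<^sub>C X) Y) = vir (c *\<^sub>C av_bracket X Y)"
    by (simp add: av_bracket_def graded_ext_scale_left bracket_simps mult.left_commute del: of_int_diff)
  show "kcoeff (av_bracket (c *\<^sub>C X) Y) = kcoeff (c *\<^sub>C av_bracket X Y)"
    by (simp add: av_bracket_def pm_sum_scale_complex bracket_simps mult.left_commute)
  show "ccoeff (av_bracket (c *\<^sub>C X) Y) = ccoeff (c *\<^sub>C av_bracket X Y)"
    by (simp add: av_bracket_def pm_sum_scale_complex bracket_simps mult.left_commute del: of_int_diff)
qed

lemma av_bracket_add_right: "av_bracket X (Y + Z) = av_bracket X Y + av_bracket X Z"
proof (rule affvir_eqI)
  show "loop (av_bracket X (Y + Z)) = loop (av_bracket X Y + av_bracket X Z)"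
    by (simp add: av_bracket_def graded_ext_add_left graded_ext_add_right bracket_simps)
  show "vir (av_bracket X (Y + Z)) = vir (av_bracket X Y + av_bracket X Z)"
    by (simp add: av_bracket_def graded_ext_add_right bracket_simps del: of_int_diff)
  show "kcoeff (av_bracket X (Y + Z)) = kcoeff (av_bracket X Y + av_bracket X Z)"
    by (simp add: av_bracket_def pm_sum_fun_add bracket_simps)
  show "ccoeff (av_bracket X (Y + Z)) = ccoeff (av_bracket X Y + av_bracket X Z)"
    by (simp add: av_bracket_def pm_sum_fun_add bracket_simps del: of_int_diff)
qed

lemma av_bracket_g_g: "av_bracket (av_g m x) (av_g n y) =
    av_g (m + n) (lie x y) + (if m + n = 0 then (of_int m * inv_form x y) *\<^sub>C av_k else 0)"
proof -
  have "n = - m \<longleftrightarrow> m + n = 0" by auto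
  then show ?thesis
    by (intro affvir_eqI) (auto simp: av_bracket_def av_g_def av_k_def pm_sum_single graded_ext_single lookup_single when_def)
qed

lemma av_bracket_d_d: "av_bracket (av_d m) (av_d n) =
    of_int (n - m) *\<^sub>C av_d (m + n) + (if m + n = 0 then (of_int (m ^ 3 - m) / 12) *\<^sub>C av_c else 0)"
proof -
  have "n = - m \<longleftrightarrow> m + n = 0" by auto
  then show ?thesis
    by (intro affvir_eqI) (auto simp: av_bracket_def av_d_def av_c_def pm_sum_single graded_ext_single lookup_single when_def
      scaleC_single scaleC_complex_def)
qed

lemma av_bracket_d_g: "av_bracket (av_d n) (av_g m x) = of_int m *\<^sub>C av_g (m + n) x"
  by (intro affvir_eqI) (simp_all add: av_bracket_def av_d_def av_g_def graded_ext_single scaleC_single add.commute[of n m])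

lemma av_bracket_g_d: "av_bracket (av_g m x) (av_d n) = - (of_int m *\<^sub>C av_g (m + n) x)"
  by (intro affvir_eqI) (simp_all add: av_bracket_def av_d_def av_g_def graded_ext_single scaleC_single add.commute[of n m])

lemma av_bracket_central:
  "av_bracket av_k X = 0" "av_bracket X av_k = 0" "av_bracket av_c X = 0" "av_bracket X av_c = 0"
  by (intro affvir_eqI; simp add: av_bracket_def av_k_def av_c_def)+


lemma av_g_add: "av_g n (x + y) = av_g n x + av_g n y"
  by (rule affvir_eqI) (simp_all add: av_g_def single_add)

lemma av_g_scale: "av_g n (c *\<^sub>C x) = c *\<^sub>C av_g n x"
  by (rule affvir_eqI) (simp_all add: av_g_def scaleC_single)

lemma av_bracket_zero [simp]: "av_bracket 0 X = 0" "av_bracket X 0 = 0"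
  by (rule affvir_eqI; simp add: av_bracket_def)+

lemma av_bracket_minus_left: "av_bracket (- X) Y = - av_bracket X Y"
  using av_bracket_add_left[of X "- X" Y] by (simp add: eq_neg_iff_add_eq_0 add.commute)

lemma av_bracket_scale_right: "av_bracket X (c *\<^sub>C Y) = c *\<^sub>C av_bracket X Y"
proof (rule affvir_eqI)
  show "loop (av_bracket X (c *\<^sub>C Y)) = loop (c *\<^sub>C av_bracket X Y)"
    by (simp add: av_bracket_def graded_ext_scale_left graded_ext_scale_right bracket_simps
        cvec.scale_right_diff_distrib mult.commute mult.left_commute)
  show "vir (av_bracket X (c *\<^sub>C Y)) = vir (c *\<^sub>C av_bracket X Y)"
    by (simp add: av_bracket_def graded_ext_scale_right bracket_simps mult.left_commute del: of_int_diff)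
  show "kcoeff (av_bracket X (c *\<^sub>C Y)) = kcoeff (c *\<^sub>C av_bracket X Y)"
    by (simp add: av_bracket_def bracket_simps mult.left_commute[of _ c] pm_sum_fun_scale_complex)
  show "ccoeff (av_bracket X (c *\<^sub>C Y)) = ccoeff (c *\<^sub>C av_bracket X Y)"
    by (simp add: av_bracket_def bracket_simps mult.left_commute del: of_int_diff
        flip: pm_sum_fun_scale_complex)
qed

lemmas av_bracket_linear = av_bracket_add_left av_bracket_add_right
  av_bracket_scale_left av_bracket_scale_right

lemma av_bracket_minus_right: "av_bracket X (- Y) = - av_bracket X Y"
  using av_bracket_scale_right[of X "-1" Y] by (simp add: cvec.scale_minus_left)

lemma av_bracket_if: "av_bracket X (if b then Y else 0) = (if b then av_bracket X Y else 0)"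
  by simp

lemma av_sel:
  "loop (av_g n x) = Poly_Mapping.single n x" "vir (av_g n x) = 0" "kcoeff (av_g n x) = 0" "ccoeff (av_g n x) = 0"
  "loop (av_d n) = 0" "vir (av_d n) = Poly_Mapping.single n 1" "kcoeff (av_d n) = 0" "ccoeff (av_d n) = 0"
  "loop av_k = 0" "vir av_k = 0" "kcoeff av_k = 1" "ccoeff av_k = 0"
  "loop av_c = 0" "vir av_c = 0" "kcoeff av_c = 0" "ccoeff av_c = 1"
  by (simp_all add: av_g_def av_d_def av_k_def av_c_def)

lemmas av_bracket_generators = av_bracket_g_g av_bracket_d_d av_bracket_d_g av_bracket_g_d
  av_bracket_central

lemma av_bracket_antisym_gen:
  "av_bracket (av_g n x) (av_g m y) = - av_bracket (av_g m y) (av_g n x)"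
  "av_bracket (av_d n) (av_d m) = - av_bracket (av_d m) (av_d n)"
proof -
  consider "n = - m" | "n + m \<noteq> 0" "m + n \<noteq> 0" by linarith
  then show "av_bracket (av_g n x) (av_g m y) = - av_bracket (av_g m y) (av_g n x)"
    by cases (rule affvir_eqI; simp add: av_bracket_g_g lie_antisym[of x y] inv_form_commute[of x y]
        add.commute[of m n] av_sel single_uminus)+
  consider "n = - m" | "n + m \<noteq> 0" "m + n \<noteq> 0" by linarith
  then show "av_bracket (av_d n) (av_d m) = - av_bracket (av_d m) (av_d n)"
  proof cases
    case 1
    have "of_int (m - n) = - (of_int (n - m) :: complex)" by simp
    moreover have "of_int (n ^ 3 - n) / 12 = - (of_int (m ^ 3 - m) / 12 :: complex)"
      by (simp add: 1 diff_divide_distrib minus_divide_left)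
    ultimately show ?thesis
      unfolding av_bracket_d_d by (simp add: 1 cvec.scale_minus_left)
  next
    case 2
    have "of_int (m - n) = - (of_int (n - m) :: complex)" by simp
    with 2 show ?thesis
      unfolding av_bracket_d_d by (simp add: cvec.scale_minus_left add.commute del: of_int_diff)
  qed
qed

lemma av_bracket_antisym: "av_bracket X Y = - av_bracket Y X"
proof (induction X rule: affvir_induct)
  case (g n x)
  show ?case
    by (induction Y rule: affvir_induct)
      (simp_all add: av_bracket_antisym_gen(1)[of n] av_bracket_d_g av_bracket_g_d av_bracket_central av_bracket_linear)
next
  case (d n)
  show ?case
    by (induction Y rule: affvir_induct)
      (simp_all add: av_bracket_antisym_gen(2)[of n] av_bracket_d_g av_bracket_g_d av_bracket_central av_bracket_linear)
qed (simp_all add: av_bracket_central av_bracket_linear)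

definition av_jac :: "'g::simple_lie_algebra affvir \<Rightarrow> 'g affvir \<Rightarrow> 'g affvir \<Rightarrow> 'g affvir"
  where "av_jac X Y Z = av_bracket X (av_bracket Y Z) + av_bracket Y (av_bracket Z X)
    + av_bracket Z (av_bracket X Y)"

lemma av_jac_cyclic: "av_jac X Y Z = av_jac Y Z X"
  by (simp add: av_jac_def algebra_simps)

lemma av_jac_add: "av_jac X Y (Z + Z') = av_jac X Y Z + av_jac X Y Z'"
  by (simp add: av_jac_def av_bracket_linear)

lemma av_jac_scale: "av_jac X Y (s *\<^sub>C Z) = s *\<^sub>C av_jac X Y Z"
  by (simp add: av_jac_def av_bracket_linear scaleC_add_right)

lemma av_jac_central: "av_jac X Y av_k = 0" "av_jac X Y av_c = 0"
  by (simp_all add: av_jac_def av_bracket_central)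

lemma av_jac_ggg: "av_jac (av_g m x) (av_g n y) (av_g p z) = 0"
proof (rule affvir_eqI)
  have "loop (av_jac (av_g m x) (av_g n y) (av_g p z)) =
    Poly_Mapping.single (m + n + p) (lie x (lie y z) + lie y (lie z x) + lie z (lie x y))"
    by (simp add: av_jac_def av_bracket_g_g av_bracket_linear av_bracket_if av_bracket_central
      av_sel single_add algebra_simps)
  then show "loop (av_jac (av_g m x) (av_g n y) (av_g p z)) = loop 0"
    by (simp add: lie_jacobi)
  have i: "inv_form y (lie z x) = inv_form x (lie y z)" "inv_form z (lie x y) = inv_form x (lie y z)"
    by (metis inv_form_invariant inv_form_commute)+
  have "kcoeff (av_jac (av_g m x) (av_g n y) (av_g p z)) =
    (if m + n + p = 0 then of_int m * inv_form x (lie y z) + of_int n * inv_form x (lie y z)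
      + of_int p * inv_form x (lie y z) else 0)"
    by (auto simp: av_jac_def av_bracket_g_g av_bracket_linear av_bracket_if av_bracket_central
      av_sel i algebra_simps)
  also have "of_int m * inv_form x (lie y z) + of_int n * inv_form x (lie y z)
      + of_int p * inv_form x (lie y z) = of_int (m + n + p) * inv_form x (lie y z)"
    by (simp add: algebra_simps)
  finally show "kcoeff (av_jac (av_g m x) (av_g n y) (av_g p z)) = kcoeff 0"
    by simp
qed (simp_all add: av_jac_def av_bracket_g_g av_bracket_linear av_bracket_if av_bracket_central
      av_sel)

lemma av_jac_ggd: "av_jac (av_g m x) (av_g n y) (av_d p) = 0"
  by (rule affvir_eqI) (simp_all add: av_jac_def av_bracket_generators av_bracket_linear av_bracket_if
      av_bracket_minus_right av_sel algebra_simps lie_antisym[of x y] inv_form_commute[of x y]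
      scaleC_single flip: single_add single_uminus single_diff)

lemma av_bracket_g_dd: "av_bracket (av_g m x) (av_bracket (av_d n) (av_d p)) =
    of_int ((n - p) * m) *\<^sub>C av_g (m + n + p) x"
proof -
  have "of_int ((n - p) * m) = - (of_int (p - n) * of_int m :: complex)"
    by (simp add: algebra_simps)
  then show ?thesis
    unfolding av_bracket_d_d av_bracket_linear av_bracket_if av_bracket_central av_bracket_g_d
    by (simp add: scaleC_scaleC add.assoc cvec.scale_minus_left del: of_int_diff)
qed

lemma av_bracket_d_dg: "av_bracket (av_d n) (av_bracket (av_d p) (av_g m x)) =
    of_int (m * (m + p)) *\<^sub>C av_g (m + n + p) x"
  by (simp add: av_bracket_d_g av_bracket_linear scaleC_scaleC add_ac)

lemma av_bracket_d_gd: "av_bracket (av_d p) (av_bracket (av_g m x) (av_d n)) =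
    of_int (- m * (m + n)) *\<^sub>C av_g (m + n + p) x"
  by (simp add: av_bracket_d_g av_bracket_g_d av_bracket_minus_right av_bracket_linear scaleC_scaleC
      cvec.scale_minus_left)

lemma av_jac_gdd: "av_jac (av_g m x) (av_d n) (av_d p) = 0"
proof -
  have "av_jac (av_g m x) (av_d n) (av_d p) =
      of_int ((n - p) * m + m * (m + p) + - m * (m + n)) *\<^sub>C av_g (m + n + p) x"
    unfolding av_jac_def av_bracket_g_dd av_bracket_d_dg av_bracket_d_gd of_int_add scaleC_add_left ..
  also have "(n - p) * m + m * (m + p) + - m * (m + n) = 0"
    by (simp add: algebra_simps)
  finally show ?thesis by simp
qed

lemma av_bracket_d_dd: "av_bracket (av_d m) (av_bracket (av_d n) (av_d p)) =
    of_int ((p - n) * (n + p - m)) *\<^sub>C av_d (m + n + p) +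
    (if m + n + p = 0 then (of_int ((p - n) * (m ^ 3 - m)) / 12) *\<^sub>C av_c else 0)"
  unfolding av_bracket_d_d av_bracket_linear av_bracket_if av_bracket_central
  by (simp add: scaleC_scaleC scaleC_add_right add.assoc del: of_int_diff)

lemma av_jac_ddd: "av_jac (av_d m) (av_d n) (av_d p) = 0"
proof -
  have *: "n + p + m = m + n + p" "p + m + n = m + n + p" by simp_all
  have z: "(p - n) * (m ^ 3 - m) + (m - p) * (n ^ 3 - n) + (n - m) * (p ^ 3 - p) = 0"
    if "m + n + p = 0"
  proof -
    have "p = - m - n" using that by simp
    show ?thesis
      unfolding \<open>p = - m - n\<close> by (simp add: power3_eq_cube algebra_simps)
  qed
  have "av_jac (av_d m) (av_d n) (av_d p) =
      of_int ((p - n) * (n + p - m) + (m - p) * (p + m - n) + (n - m) * (m + n - p)) *\<^sub>C av_d (m + n + p) +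
      (if m + n + p = 0 then (of_int ((p - n) * (m ^ 3 - m) + (m - p) * (n ^ 3 - n) + (n - m) * (p ^ 3 - p)) / 12)
        *\<^sub>C av_c else 0)"
    unfolding av_jac_def av_bracket_d_dd * of_int_add scaleC_add_left add_divide_distrib
    by (simp add: add_ac del: of_int_diff of_int_mult)
  also have "(p - n) * (n + p - m) + (m - p) * (p + m - n) + (n - m) * (m + n - p) = 0"
    by (simp add: algebra_simps)
  finally have "av_jac (av_d m) (av_d n) (av_d p) = (if m + n + p = 0 then
      (of_int ((p - n) * (m ^ 3 - m) + (m - p) * (n ^ 3 - n) + (n - m) * (p ^ 3 - p)) / 12) *\<^sub>C av_c else 0)"
    by simp
  then show ?thesis
    by (cases "m + n + p = 0") (simp_all only: z, simp_all)
qed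

lemma av_jac_eq_0: "av_jac X Y Z = 0"
proof -
  have cyc: "av_jac A B C = 0 \<Longrightarrow> av_jac B C A = 0" for A B C :: "'a affvir"
    using av_jac_cyclic[of A B C] by simp
  have gg: "av_jac (av_g m x) (av_g n y) Z = 0" for m x n Z and y :: 'a
    by (induction Z rule: affvir_induct)
      (simp_all add: av_jac_add av_jac_scale av_jac_central av_jac_ggg av_jac_ggd)
  have dd: "av_jac (av_d m) (av_d n) Z = 0" for m n and Z :: "'a affvir"
    by (induction Z rule: affvir_induct)
      (simp_all add: av_jac_add av_jac_scale av_jac_central av_jac_ddd cyc[OF av_jac_gdd])
  have gd: "av_jac (av_g m x) (av_d n) Z = 0" for m n Z and x :: 'a
    by (induction Z rule: affvir_induct)
      (simp_all add: av_jac_add av_jac_scale av_jac_central av_jac_gdd cyc[OF av_jac_ggd])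
  have g': "av_jac Y Z (av_g m x) = 0" for m Y Z and x :: 'a
  proof -
    have "av_jac Z (av_g m x) Y = 0"
    proof (induction Y rule: affvir_induct)
      case (g n y)
      show ?case by (rule cyc[OF cyc[OF gg]])
    next
      case (d n)
      show ?case by (rule cyc[OF cyc[OF gd]])
    qed (simp_all add: av_jac_add av_jac_scale av_jac_central)
    then show ?thesis
      using cyc by blast
  qed
  have d': "av_jac Y Z (av_d m) = 0" for m and Y Z :: "'a affvir"
  proof -
    have "av_jac Z (av_d m) Y = 0"
    proof (induction Y rule: affvir_induct)
      case (g n y)
      show ?case by (rule g')
    next
      case (d n)
      show ?case by (rule cyc[OF cyc[OF dd]])
    qed (simp_all add: av_jac_add av_jac_scale av_jac_central)
    then show ?thesis
      using cyc by blast
  qed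
  show ?thesis
    by (induction Z rule: affvir_induct)
      (simp_all add: av_jac_add av_jac_scale av_jac_central g' d')
qed

instantiation affvir :: (simple_lie_algebra) lie_algebra
begin
definition lie_affvir_def: "lie X Y = av_bracket X Y"
instance
proof
  fix X Y Z :: "'a affvir" and c :: complex
  show "lie X X = 0"
  proof -
    have "(2::complex) *\<^sub>C av_bracket X X = 0"
      using av_bracket_antisym[of X X] scaleC_add_left[of 1 1 "av_bracket X X"]
      by (simp add: scaleC_one eq_neg_iff_add_eq_0)
    then show ?thesis
      by (simp add: lie_affvir_def)
  qed
  show "lie X (lie Y Z) + lie Y (lie Z X) + lie Z (lie X Y) = 0"
    using av_jac_eq_0[of X Y Z] by (simp add: lie_affvir_def av_jac_def)
qed (simp_all add: lie_affvir_def av_bracket_linear)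
end


section \<open>Universal enveloping algebras\<close>

text \<open>Words form a monoid under concatenation, so the monoid algebra of this monoid, given by the
  convolution product on finitely supported functions, is the free associative algebra.\<close>

datatype 'a fword = FWord (letters: "'a list")

instantiation fword :: (type) monoid_add
begin
definition zero_fword_def: "0 = FWord []"
definition plus_fword_def: "v + w = FWord (letters v @ letters w)"
instance by standard (simp_all add: zero_fword_def plus_fword_def)
end

abbreviation letter :: "'a \<Rightarrow> 'a fword \<Rightarrow>\<^sub>0 complex"
  where "letter x \<equiv> Poly_Mapping.single (FWord [x]) 1"

inductive_set uea_ideal :: "('a::lie_algebra fword \<Rightarrow>\<^sub>0 complex) set" where
  zero: "0 \<in> uea_ideal"
| add: "p \<in> uea_ideal \<Longrightarrow> q \<in> uea_ideal \<Longrightarrow> p + q \<in> uea_ideal"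
| mult: "p \<in> uea_ideal \<Longrightarrow> q * p * r \<in> uea_ideal"
| letter_add: "letter (x + y) - letter x - letter y \<in> uea_ideal"
| letter_scale: "letter (c *\<^sub>C x) - c *\<^sub>C letter x \<in> uea_ideal"
| letter_lie: "letter x * letter y - letter y * letter x - letter (lie x y) \<in> uea_ideal"

definition uea_rel :: "('a::lie_algebra fword \<Rightarrow>\<^sub>0 complex) \<Rightarrow> ('a fword \<Rightarrow>\<^sub>0 complex) \<Rightarrow> bool"
  where "uea_rel p q \<longleftrightarrow> p - q \<in> uea_ideal"

lemma uea_ideal_mult_left: "p \<in> uea_ideal \<Longrightarrow> q * p \<in> uea_ideal"
  using uea_ideal.mult[of p q 1] by simp

lemma uea_ideal_mult_right: "p \<in> uea_ideal \<Longrightarrow> p * q \<in> uea_ideal"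
  using uea_ideal.mult[of p 1 q] by simp

lemma uea_ideal_uminus: "p \<in> uea_ideal \<Longrightarrow> - p \<in> uea_ideal"
  using uea_ideal_mult_left[of p "- 1"] by simp

quotient_type (overloaded) 'a uea = "'a::lie_algebra fword \<Rightarrow>\<^sub>0 complex" / uea_rel
proof (rule equivpI)
  show "reflp uea_rel"
    by (auto simp: reflp_def uea_rel_def uea_ideal.zero)
  show "symp uea_rel"
    unfolding symp_def uea_rel_def using uea_ideal_uminus by fastforce
  show "transp uea_rel"
    unfolding transp_def uea_rel_def using uea_ideal.add by fastforce
qed

definition const_coeff :: "('a fword \<Rightarrow>\<^sub>0 complex) \<Rightarrow> complex"
  where "const_coeff p = Poly_Mapping.lookup p 0"

lemma const_coeff_add: "const_coeff (p + q) = const_coeff p + const_coeff q"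
  by (simp add: const_coeff_def lookup_add)

lemma const_coeff_mult: "const_coeff (p * q) = const_coeff p * const_coeff q"
proof (induction p rule: pm_induct)
  case (single v s)
  show ?case
  proof (induction q rule: pm_induct)
    case (single w r)
    show ?case
      by (simp add: const_coeff_def mult_single lookup_single when_def zero_fword_def
          plus_fword_def fword.expand)
  qed (simp add: const_coeff_add distrib_left)
qed (simp add: const_coeff_add distrib_right)

lemma const_coeff_uea_ideal: "p \<in> uea_ideal \<Longrightarrow> const_coeff p = 0"
  by (induction rule: uea_ideal.induct)
    (simp_all add: const_coeff_add const_coeff_mult,
     simp_all add: const_coeff_def lookup_minus lookup_single when_def zero_fword_def
       lookup_scaleC mult_single plus_fword_def)

instantiation uea :: (lie_algebra) ring_1
begin

lift_definition zero_uea :: "'a uea" is 0 .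
lift_definition one_uea :: "'a uea" is 1 .
lift_definition plus_uea :: "'a uea \<Rightarrow> 'a uea \<Rightarrow> 'a uea" is "(+)"
  unfolding uea_rel_def add_diff_add by (rule uea_ideal.add)
lift_definition uminus_uea :: "'a uea \<Rightarrow> 'a uea" is "uminus"
  unfolding uea_rel_def minus_diff_minus by (rule uea_ideal_uminus)
lift_definition minus_uea :: "'a uea \<Rightarrow> 'a uea \<Rightarrow> 'a uea" is "(-)"
proof -
  fix p p' q q' :: "'a fword \<Rightarrow>\<^sub>0 complex"
  assume "uea_rel p p'" "uea_rel q q'"
  then have "(p - p') + - (q - q') \<in> uea_ideal"
    unfolding uea_rel_def by (intro uea_ideal.add uea_ideal_uminus)
  then show "uea_rel (p - q) (p' - q')"
    by (simp add: uea_rel_def algebra_simps)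
qed
lift_definition times_uea :: "'a uea \<Rightarrow> 'a uea \<Rightarrow> 'a uea" is "(*)"
proof -
  fix p p' q q' :: "'a fword \<Rightarrow>\<^sub>0 complex"
  assume "uea_rel p p'" "uea_rel q q'"
  then have "(p - p') * q + p' * (q - q') \<in> uea_ideal"
    unfolding uea_rel_def
    by (intro uea_ideal.add uea_ideal_mult_left uea_ideal_mult_right)
  then show "uea_rel (p * q) (p' * q')"
    by (simp add: uea_rel_def algebra_simps)
qed

instance
proof
  show "(0::'a uea) \<noteq> 1"
  proof transfer
    have "const_coeff (0 - 1 :: 'a fword \<Rightarrow>\<^sub>0 complex) \<noteq> 0"
      by (simp add: const_coeff_def lookup_minus lookup_one)
    then show "\<not> uea_rel (0 :: 'a fword \<Rightarrow>\<^sub>0 complex) 1"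
      using const_coeff_uea_ideal unfolding uea_rel_def by blast
  qed
qed (transfer, simp add: uea_rel_def algebra_simps uea_ideal.zero)+

end

instantiation uea :: (lie_algebra) complex_vector
begin
lift_definition scaleC_uea :: "complex \<Rightarrow> 'a uea \<Rightarrow> 'a uea" is "scaleC"
proof -
  fix c and p q :: "'a fword \<Rightarrow>\<^sub>0 complex"
  have "Poly_Mapping.single 0 c * r = c *\<^sub>C r" for r :: "'a fword \<Rightarrow>\<^sub>0 complex"
    by (induction r rule: pm_induct)
      (simp_all add: mult_single scaleC_single scaleC_complex_def distrib_left scaleC_add_right)
  then show "uea_rel p q \<Longrightarrow> uea_rel (c *\<^sub>C p) (c *\<^sub>C q)"
    unfolding uea_rel_def by (metis cvec.scale_right_diff_distrib uea_ideal_mult_left)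
qed
instance
  by standard (transfer, simp add: uea_rel_def scaleC_add_right scaleC_add_left
      scaleC_scaleC scaleC_one uea_ideal.zero)+
end

lift_definition ugen :: "'a::lie_algebra \<Rightarrow> 'a uea" is "\<lambda>x. letter x" .

text \<open>The subalgebra of the enveloping algebra generated by a set of Lie algebra elements; for a Lie
  subalgebra \<open>S\<close> this is, by the PBW theorem, the enveloping algebra of \<open>S\<close>.\<close>

inductive_set uea_sub :: "'a::lie_algebra set \<Rightarrow> 'a uea set" for S where
  one: "1 \<in> uea_sub S"
| gen: "x \<in> S \<Longrightarrow> ugen x \<in> uea_sub S"
| add: "P \<in> uea_sub S \<Longrightarrow> Q \<in> uea_sub S \<Longrightarrow> P + Q \<in> uea_sub S"
| scale: "P \<in> uea_sub S \<Longrightarrow> c *\<^sub>C P \<in> uea_sub S"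
| mult: "P \<in> uea_sub S \<Longrightarrow> Q \<in> uea_sub S \<Longrightarrow> P * Q \<in> uea_sub S"

section \<open>Modules\<close>

definition lie_module :: "('l::lie_algebra \<Rightarrow> 'm::complex_vector \<Rightarrow> 'm) \<Rightarrow> bool"
  where "lie_module \<rho> \<longleftrightarrow> (\<forall>x. clinear (\<rho> x)) \<and> (\<forall>w. clinear (\<lambda>x. \<rho> x w)) \<and>
    (\<forall>x y w. \<rho> (lie x y) w = \<rho> x (\<rho> y w) - \<rho> y (\<rho> x w))"

definition irreducible_module :: "('l::lie_algebra \<Rightarrow> 'm::complex_vector \<Rightarrow> 'm) \<Rightarrow> bool"
  where "irreducible_module \<rho> \<longleftrightarrow> lie_module \<rho> \<and> (\<exists>w::'m. w \<noteq> 0) \<and>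
    (\<forall>W. cvec.subspace W \<and> (\<forall>x. \<forall>w\<in>W. \<rho> x w \<in> W) \<longrightarrow> W = {0} \<or> W = UNIV)"

text \<open>The action of the enveloping algebra on a module; for a module it does not depend on the
  representative in the free algebra.\<close>

definition uea_act ::
  "('l::lie_algebra \<Rightarrow> 'm::complex_vector \<Rightarrow> 'm) \<Rightarrow> 'l uea \<Rightarrow> 'm \<Rightarrow> 'm"
  where "uea_act \<rho> P w = pm_sum (\<lambda>xs s. s *\<^sub>C foldr \<rho> (letters xs) w) (rep_uea P)"

text \<open>The product \<open>P \<circ> w\<close>: \<open>(g\<^sub>1 \<dots> g\<^sub>s) \<circ> w = (- 1)\<^sup>s g\<^sub>s \<dots> g\<^sub>1 w\<close>.\<close>

definition uea_circ ::
  "('l::lie_algebra \<Rightarrow> 'm::complex_vector \<Rightarrow> 'm) \<Rightarrow> 'l uea \<Rightarrow> 'm \<Rightarrow> 'm"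
  where "uea_circ \<sigma> P w =
    pm_sum (\<lambda>xs s. (s * (- 1) ^ length (letters xs)) *\<^sub>C fold \<sigma> (letters xs) w) (rep_uea P)"

text \<open>\<open>\<sigma>\<close> is a realization of the finite-dimensional irreducible module of highest weight \<open>\<mu>\<close>.\<close>

definition fin_dim_irreducible ::
  "('g::simple_lie_algebra \<Rightarrow> complex) \<Rightarrow> ('g \<Rightarrow> 'v::complex_vector \<Rightarrow> 'v) \<Rightarrow> bool"
  where "fin_dim_irreducible \<mu> \<sigma> \<longleftrightarrow> irreducible_module \<sigma> \<and>
    (\<exists>B :: 'v set. finite B \<and> cvec.span B = UNIV) \<and>
    (\<exists>v. v \<noteq> 0 \<and> (\<forall>x\<in>n_plus. \<sigma> x v = 0) \<and> (\<forall>h\<in>cartan. \<sigma> h v = \<mu> h *\<^sub>C v))"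

subsection \<open>Highest weight modules of the affine-Virasoro algebra\<close>

definition av_plus :: "'g::simple_lie_algebra affvir set"
  where "av_plus = cvec.span (av_g 0 ` n_plus \<union> {av_g n x | n x. n > 0} \<union> {av_d n | n. n > 0})"

definition av_minus :: "'g::simple_lie_algebra affvir set"
  where "av_minus = cvec.span (av_g 0 ` n_minus \<union> {av_g (- n) x | n x. n > 0} \<union> {av_d (- n) | n. n > 0})"

definition vir_minus :: "'g::simple_lie_algebra affvir set"
  where "vir_minus = cvec.span {av_d (- n) | n. n > 0}"

definition loop_minus :: "'g::simple_lie_algebra affvir set"
  where "loop_minus = cvec.span {av_g (- n) x | n x. n > 0}"

text \<open>The Verma module is the quotient of the enveloping algebra by the left ideal generated by the
  relations of the inducing one-dimensional module; its elements are the cosets of this ideal.\<close>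

definition verma_ideal ::
  "('g::simple_lie_algebra \<Rightarrow> complex) \<Rightarrow> complex \<Rightarrow> complex \<Rightarrow> complex \<Rightarrow> 'g affvir uea set"
  where "verma_ideal lam l k c = cvec.span {P * R | P R.
    R \<in> {ugen (av_g 0 h) - lam h *\<^sub>C 1 | h. h \<in> cartan} \<union> ugen ` av_plus \<union>
      {ugen (av_d 0) - l *\<^sub>C 1, ugen av_k - k *\<^sub>C 1, ugen av_c - c *\<^sub>C 1}}"

definition verma_class ::
  "('g::simple_lie_algebra \<Rightarrow> complex) \<Rightarrow> complex \<Rightarrow> complex \<Rightarrow> complex \<Rightarrow> 'g affvir uea \<Rightarrow> 'g affvir uea set"
  where "verma_class lam l k c P = {Q. Q - P \<in> verma_ideal lam l k c}"

definition verma_module ::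
  "('g::simple_lie_algebra \<Rightarrow> complex) \<Rightarrow> complex \<Rightarrow> complex \<Rightarrow> complex \<Rightarrow> 'g affvir uea set set"
  where "verma_module lam l k c = range (verma_class lam l k c)"

text \<open>\<open>\<rho>\<close> is a realization of the irreducible quotient of the Verma module, in which \<open>ubar\<close> is the
  image of the canonical generator (the class of 1).\<close>

definition irreducible_verma_quotient ::
  "('g::simple_lie_algebra \<Rightarrow> complex) \<Rightarrow> complex \<Rightarrow> complex \<Rightarrow> complex \<Rightarrow>
    ('g affvir \<Rightarrow> 'm::complex_vector \<Rightarrow> 'm) \<Rightarrow> 'm \<Rightarrow> bool"
  where "irreducible_verma_quotient lam l k c \<rho> ubar \<longleftrightarrow> irreducible_module \<rho> \<and>
    (\<exists>\<pi>. \<pi> ` verma_module lam l k c = UNIV \<and>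
      (\<forall>P Q. \<pi> (verma_class lam l k c (P + Q)) = \<pi> (verma_class lam l k c P) + \<pi> (verma_class lam l k c Q)) \<and>
      (\<forall>s P. \<pi> (verma_class lam l k c (s *\<^sub>C P)) = s *\<^sub>C \<pi> (verma_class lam l k c P)) \<and>
      (\<forall>X P. \<pi> (verma_class lam l k c (ugen X * P)) = \<rho> X (\<pi> (verma_class lam l k c P))) \<and>
      \<pi> (verma_class lam l k c 1) = ubar)"

definition top_space ::
  "complex \<Rightarrow> ('g::simple_lie_algebra affvir \<Rightarrow> 'm::complex_vector \<Rightarrow> 'm) \<Rightarrow> 'm set"
  where "top_space l \<rho> = {w. \<rho> (av_d 0) w = l *\<^sub>C w}"

definition annihilator ::
  "('g::simple_lie_algebra affvir \<Rightarrow> 'm::complex_vector \<Rightarrow> 'm) \<Rightarrow> 'm \<Rightarrow> 'g affvir uea set"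
  where "annihilator \<rho> ubar = {P \<in> uea_sub av_minus. uea_act \<rho> P ubar = 0}"

definition homogeneous :: "'g::simple_lie_algebra affvir uea \<Rightarrow> int \<Rightarrow> bool"
  where "homogeneous P m \<longleftrightarrow> ugen (av_d 0) * P - P * ugen (av_d 0) = of_int m *\<^sub>C P"

subsection \<open>The tensor product module\<close>

text \<open>The Laurent polynomials are the finitely supported functions on the integers.\<close>

definition laurent_t :: "int \<Rightarrow> (int \<Rightarrow>\<^sub>0 complex)"
  where "laurent_t n = Poly_Mapping.single n 1"

definition tensor_act ::
  "('g::simple_lie_algebra affvir \<Rightarrow> 'm::complex_vector \<Rightarrow> 'm) \<Rightarrow> 'm \<Rightarrow> ('g \<Rightarrow> 'v::complex_vector \<Rightarrow> 'v) \<Rightarrow>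
    complex \<Rightarrow> complex \<Rightarrow> complex \<Rightarrow> complex \<Rightarrow>
    'g affvir \<Rightarrow> (('m, 'v) tensor, int \<Rightarrow>\<^sub>0 complex) tensor \<Rightarrow> (('m, 'v) tensor, int \<Rightarrow>\<^sub>0 complex) tensor"
  where "tensor_act \<rho> ubar \<sigma> k c a b = (THE \<tau>.
    (\<forall>X. clinear (\<tau> X)) \<and> (\<forall>w. clinear (\<lambda>X. \<tau> X w)) \<and>
    (\<forall>P\<in>uea_sub av_minus. \<forall>p v m n. homogeneous P p \<longrightarrow>
      (let w = uea_act \<rho> P ubar in
        \<tau> (av_d m) (w \<otimes> v \<otimes> laurent_t n) =
          (\<rho> (av_d m) w + (a + of_int n - of_int p + b * of_int m) *\<^sub>C w) \<otimes> v \<otimes> laurent_t (m + n))) \<and>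
    (\<forall>P\<in>uea_sub av_minus. \<forall>p x v m n. homogeneous P p \<longrightarrow>
      (let w = uea_act \<rho> P ubar in
        \<tau> (av_g m x) (w \<otimes> v \<otimes> laurent_t n) =
          (\<rho> (av_g m x) w \<otimes> v + w \<otimes> \<sigma> x v) \<otimes> laurent_t (m + n))) \<and>
    (\<forall>w. \<tau> av_k w = k *\<^sub>C w) \<and> (\<forall>w. \<tau> av_c w = c *\<^sub>C w))"

section \<open>The maps \<open>\<psi>\<^sub>n\<close> and \<open>\<phi>\<^sub>n\<close>\<close>

text \<open>These maps are well defined on subspaces: \<open>psi\<close> on the enveloping algebra of \<open>vir_minus\<close>,
  \<open>omit_t\<close> on that of \<open>loop_minus\<close>, and \<open>phi\<close> on the tensor product of that of \<open>av_minus\<close> with the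
  second factor. They are given here as total linear functions with the required values on the
  subspace; the values elsewhere are unspecified and never used. In \<open>psi\<close>, the list \<open>ks\<close> is
  \<open>k\<^sub>1, \<dots>, k\<^sub>r\<close> with indices shifted to start at 0.\<close>

definition psi :: "complex \<Rightarrow> complex \<Rightarrow> int \<Rightarrow> 'g::simple_lie_algebra affvir uea \<Rightarrow> complex"
  where "psi a b n = (SOME f. clinear f \<and>
    (\<forall>ks::nat list. (\<forall>k\<in>set ks. k > 0) \<longrightarrow>
      f (prod_list (map (\<lambda>k. ugen (av_d (- int k))) (rev ks))) =
      (\<Prod>j<length ks. of_nat (ks ! j) * b - a - of_int n - (\<Sum>i\<le>j. of_nat (ks ! i)))))"

definition omit_t :: "'g::simple_lie_algebra affvir uea \<Rightarrow> 'g uea"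
  where "omit_t = (SOME f. clinear f \<and>
    (\<forall>xs::(nat \<times> 'g) list. (\<forall>(i, x)\<in>set xs. i > 0) \<longrightarrow>
      f (prod_list (map (\<lambda>(i, x). ugen (av_g (- int i) x)) xs)) = prod_list (map (\<lambda>(i, x). ugen x) xs)))"

definition phi ::
  "('g::simple_lie_algebra affvir \<Rightarrow> 'm::complex_vector \<Rightarrow> 'm) \<Rightarrow> 'm \<Rightarrow> ('g \<Rightarrow> 'v::complex_vector \<Rightarrow> 'v) \<Rightarrow>
    complex \<Rightarrow> complex \<Rightarrow> int \<Rightarrow> ('g affvir uea, 'v) tensor \<Rightarrow> ('m, 'v) tensor"
  where "phi \<rho> ubar \<sigma> a b n = (SOME f. clinear f \<and>
    (\<forall>x\<in>uea_sub loop_minus. \<forall>y\<in>uea_sub vir_minus. \<forall>z\<in>uea_sub (av_g 0 ` n_minus). \<forall>v.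
      f ((x * y * z) \<otimes> v) =
        psi a b n y *\<^sub>C (uea_act \<rho> z ubar \<otimes> uea_circ \<sigma> (omit_t x) v)))"

end

theory Submission
  imports Defs "HOL-Computational_Algebra.Fundamental_Theorem_Algebra"
begin

text \<open>The tensor product is graded by the powers of \<open>t\<close>, and its component of degree \<open>n\<close> is
  \<open>L \<otimes> V\<close> for \<open>L = L(\<lambda>, l, k, c)\<close> and \<open>V = L(\<mu>)\<close>. Let \<open>R\<^sub>n\<close> be the part of it that is
  produced by the elements \<open>x(- i)\<close> and \<open>d\<^sub>-\<^sub>i\<close> with \<open>i > 0\<close>. Both conditions are equivalent to
  \<open>R\<^sub>n = L \<otimes> V\<close> for all \<open>n\<close>.

  The components of degree greater than \<open>n\<close> generate a submodule whose component of degree \<open>n\<close> is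
  contained in \<open>R\<^sub>n\<close>, so irreducibility forces \<open>R\<^sub>n = L \<otimes> V\<close>. Conversely, let \<open>W\<close> be a nonzero
  submodule. As \<open>x(m)\<close> and \<open>d\<^sub>m\<close> annihilate a given element of \<open>L\<close> for large \<open>m\<close>, the set of all
  \<open>s\<close> with \<open>s \<otimes> t\<^sup>n \<in> W\<close> for all large \<open>n\<close> is stable under the actions on each of the two
  factors separately, hence it is everything by Schur's lemma; then \<open>W\<close> contains all components
  of large degree, and by \<open>R\<^sub>n = L \<otimes> V\<close> all others.

  Modulo \<open>R\<^sub>n\<close> one has \<open>P u \<otimes> v \<equiv> \<phi>\<^sub>n(P \<otimes> v)\<close>, and every generator of \<open>R\<^sub>n\<close> is the image of an
  element of \<open>U(L(g)\<^sub>-) \<otimes> V\<close> in the kernel of \<open>\<phi>\<^sub>n\<close>. Since \<open>Ann(u) \<otimes> V\<close> is the kernel of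
  \<open>P \<otimes> v \<mapsto> P u \<otimes> v\<close>, the quotient of \<open>L \<otimes> V\<close> by \<open>R\<^sub>n\<close> is the quotient of \<open>L\<^sub>0 \<otimes> V\<close> by
  \<open>\<phi>\<^sub>n(Ann(u) \<otimes> V)\<close>.\<close>

section \<open>Linear algebra\<close>

text \<open>The scalars in \<open>\<psi>\<^sub>n\<close> and the reversed, signed products in
  \<open>\<circ>\<close> are what remains modulo \<open>R\<^sub>n\<close>: there
  \<open>x(-i) w \<otimes> v\<close> becomes \<open>- w \<otimes> x v\<close>, and for
  \<open>P\<close> of degree \<open>p\<close> the tensor
  \<open>d\<^sub>-\<^sub>i P u \<otimes> v\<close> becomes
  \<open>(p - a - n - i + b i) P u \<otimes> v\<close>. For \<open>i = k\<^sub>j\<close> and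
  \<open>p = - k\<^sub>1 - ... - k\<^sub>j\<^sub>-\<^sub>1\<close> this is the \<open>j\<close>-th
  factor of \<open>\<psi>\<^sub>n\<close>. The obstacle is that \<open>psi\<close>,
  \<open>omit_t\<close> and \<open>phi\<close> are chosen among linear maps with prescribed values,
  so nothing is known about them before one such map is exhibited. Each map is read off from a
  module, as \<open>P\<close> applied to a fixed vector. For \<open>phi\<close> only the part of
  nonpositive degree acts; the enveloping algebra of the whole is therefore first projected onto
  that of this part. The condition on \<open>\<mu>\<close> enters through the absence of invariants
  in \<open>V\<close>: if a nonzero \<open>s \<otimes> t^n\<close> lies in \<open>W\<close>, some
  \<open>x\<close> acts on the second factor of \<open>s\<close> with nonzero result. Finite
  dimension of \<open>V\<close> gives Schur's lemma, a degree bound uniform in \<open>v\<close>, and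
  the kernel of evaluation.\<close>

lemma clinear_iff:
  "clinear f \<longleftrightarrow> (\<forall>x y. f (x + y) = f x + f y) \<and> (\<forall>c x. f (c *\<^sub>C x) = c *\<^sub>C f x)"
proof
  assume "clinear f"
  then interpret Vector_Spaces.linear scaleC scaleC f .
  show "(\<forall>x y. f (x + y) = f x + f y) \<and> (\<forall>c x. f (c *\<^sub>C x) = c *\<^sub>C f x)"
    by (simp add: add scale)
next
  assume "(\<forall>x y. f (x + y) = f x + f y) \<and> (\<forall>c x. f (c *\<^sub>C x) = c *\<^sub>C f x)"
  then show "clinear f" by unfold_locales simp_all
qed

lemma clinearI:
  "(\<And>x y. f (x + y) = f x + f y) \<Longrightarrow> (\<And>c x. f (c *\<^sub>C x) = c *\<^sub>C f x) \<Longrightarrow> clinear f"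
  by (simp add: clinear_iff)

lemma clinear_add: "clinear f \<Longrightarrow> f (x + y) = f x + f y"
  and clinear_scale: "clinear f \<Longrightarrow> f (c *\<^sub>C x) = c *\<^sub>C f x"
  by (simp_all add: clinear_iff)

lemma clinear_0: "clinear f \<Longrightarrow> f 0 = 0"
  by (metis clinear_scale cvec.scale_zero_left)

lemma clinear_neg: "clinear f \<Longrightarrow> f (- x) = - f x"
  by (metis clinear_add clinear_0 add.right_inverse add_eq_0_iff)

lemma clinear_diff: "clinear f \<Longrightarrow> f (x - y) = f x - f y"
  by (metis clinear_add clinear_neg add_uminus_conv_diff)

lemma clinear_sum: "clinear f \<Longrightarrow> f (sum g A) = (\<Sum>i\<in>A. f (g i))"
  by (induction A rule: infinite_finite_induct) (simp_all add: clinear_0 clinear_add)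

lemma clinear_comp: "clinear f \<Longrightarrow> clinear g \<Longrightarrow> clinear (\<lambda>x. f (g x))"
  by (simp add: clinear_iff)

lemma clinear_plus: "clinear f \<Longrightarrow> clinear g \<Longrightarrow> clinear (\<lambda>x. f x + g x)"
  by (simp add: clinear_iff scaleC_add_right)

lemma clinear_minus: "clinear f \<Longrightarrow> clinear g \<Longrightarrow> clinear (\<lambda>x. f x - g x)"
  by (simp add: clinear_iff cvec.scale_right_diff_distrib)

lemma clinear_scaled: "clinear f \<Longrightarrow> clinear (\<lambda>x. c *\<^sub>C f x)"
  by (simp add: clinear_iff scaleC_add_right scaleC_scaleC mult.commute)

lemma clinear_const0: "clinear (\<lambda>x. 0)"
  by (simp add: clinear_iff)

lemma clinear_ident: "clinear (\<lambda>x. x)"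
  by (simp add: clinear_iff)

lemmas clinear_simps = clinear_0 clinear_add clinear_scale clinear_diff clinear_neg

lemmas subspace_closed = cvec.subspace_0 cvec.subspace_add cvec.subspace_scale cvec.subspace_diff cvec.subspace_neg

lemma subspace_vimage:
  assumes "clinear f" "cvec.subspace S" shows "cvec.subspace {x. f x \<in> S}"
  using assms by (auto simp: cvec.subspace_def clinear_add clinear_scale clinear_0)

text \<open>Induction over a span, in the form in which nearly every extension from generators to a
  generated subspace is carried out below.\<close>

lemma subspace_vimageD: "clinear f \<Longrightarrow> cvec.subspace S \<Longrightarrow> x \<in> cvec.span B \<Longrightarrow>
    (\<And>b. b \<in> B \<Longrightarrow> f b \<in> S) \<Longrightarrow> f x \<in> S"
  using cvec.span_minimal[OF _ subspace_vimage, of B f S] by auto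

lemma clinear_eq_on_span:
  assumes "clinear f" "clinear g" "\<And>x. x \<in> B \<Longrightarrow> f x = g x" "x \<in> cvec.span B"
  shows "f x = g x"
  using subspace_vimageD[OF clinear_minus[OF assms(1,2)] cvec.subspace_single_0 assms(4)]
  by (simp add: assms(3))

lemma subspace_diff_iff: "cvec.subspace S \<Longrightarrow> x \<in> S \<Longrightarrow> x - y \<in> S \<longleftrightarrow> y \<in> S"
  using cvec.subspace_diff[of S x y] cvec.subspace_diff[of S x "x - y"] by auto

lemma subspace_scale_iff: "cvec.subspace S \<Longrightarrow> c \<noteq> 0 \<Longrightarrow> c *\<^sub>C x \<in> S \<longleftrightarrow> x \<in> S"
  using cvec.subspace_scale[of S x c] cvec.subspace_scale[of S "c *\<^sub>C x" "inverse c"]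
  by (auto simp: scaleC_scaleC scaleC_one)

lemma coordinate_functional:
  fixes B :: "'a::complex_vector set"
  assumes "cvec.independent B" "w \<in> B"
  obtains f :: "'a \<Rightarrow> complex" where "clinear f" "f w = 1" "\<And>x. x \<in> B \<Longrightarrow> x \<noteq> w \<Longrightarrow> f x = 0"
proof -
  let ?E = "cvec.extend_basis B"
  have E: "cvec.independent ?E" "cvec.span ?E = UNIV" "B \<subseteq> ?E"
    using assms(1) cvec.independent_extend_basis cvec.span_extend_basis cvec.extend_basis_superset by blast+
  let ?f = "\<lambda>x. cvec.representation ?E x w"
  have "clinear ?f"
    using cvec.representation_add[OF E(1)] cvec.representation_scale[OF E(1)] E(2)
    by (simp add: clinear_iff scaleC_complex_def)
  moreover have "?f w = 1" "\<And>x. x \<in> B \<Longrightarrow> x \<noteq> w \<Longrightarrow> ?f x = 0"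
    using cvec.representation_basis[OF E(1)] E(3) assms(2) by (simp_all add: subset_iff)
  ultimately show ?thesis using that by blast
qed

text \<open>Applying \<open>D - e i\<^sub>0\<close> removes one eigencomponent.\<close>

lemma eigen_components:
  fixes D :: "'a::complex_vector \<Rightarrow> 'a"
  assumes "finite F" "clinear D" "cvec.subspace W" "\<And>w. w \<in> W \<Longrightarrow> D w \<in> W"
    and "inj_on e F" "\<And>i. i \<in> F \<Longrightarrow> D (g i) = e i *\<^sub>C g i" "(\<Sum>i\<in>F. g i) \<in> W" "i \<in> F"
  shows "g i \<in> W"
  using assms(1,5-8)
proof (induction F arbitrary: g i)
  case empty
  then show ?case by simp
next
  case (insert j F)
  let ?h = "\<lambda>i. (e i - e j) *\<^sub>C g i"
  have Dw: "D (\<Sum>i\<in>insert j F. g i) = (\<Sum>i\<in>insert j F. e i *\<^sub>C g i)"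
    by (simp only: clinear_sum[OF assms(2)] insert.prems(2) cong: sum.cong)
  have "D (\<Sum>i\<in>insert j F. g i) - e j *\<^sub>C (\<Sum>i\<in>insert j F. g i) = (\<Sum>i\<in>F. ?h i)"
    unfolding Dw using insert.hyps
    by (simp add: cvec.scale_left_diff_distrib sum_subtractf cvec.scale_sum_right scaleC_add_right)
  then have 1: "(\<Sum>i\<in>F. ?h i) \<in> W"
    using insert.prems(3) assms(3,4) by (metis cvec.subspace_diff cvec.subspace_scale)
  have g: "g i \<in> W" if "i \<in> F" for i
  proof -
    have "?h i \<in> W"
      by (rule insert.IH[OF _ _ 1 that])
        (use insert.prems in \<open>auto simp: clinear_scale[OF assms(2)] scaleC_scaleC mult.commute\<close>)
    moreover have "e i - e j \<noteq> 0"
      using insert.prems(1) insert.hyps(2) that by (metis inj_onD insertCI right_minus_eq)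
    ultimately show ?thesis
      using subspace_scale_iff assms(3) by blast
  qed
  have "(\<Sum>i\<in>insert j F. g i) - (\<Sum>i\<in>F. g i) \<in> W"
    using insert.prems(3) g assms(3) by (metis cvec.subspace_diff cvec.subspace_sum)
  then have "g j \<in> W" using insert.hyps by simp
  with g insert.prems(4) show ?case by auto
qed

lemma poly_factor_root:
  fixes p :: "complex poly"
  assumes "degree p \<noteq> 0"
  obtains z q where "p = [:- z, 1:] * q"
proof -
  have "\<not> constant (poly p)" using assms by (simp add: constant_degree)
  then obtain z where "poly p z = 0" using fundamental_theorem_of_algebra by blast
  then show ?thesis using that by (metis poly_eq_0_iff_dvd dvdE)
qed

text \<open>Here \<open>E p\<close> is \<open>p(f) v\<close>. A nonzero \<open>p\<close> of least
  degree with \<open>p(f) v = 0\<close> is not constant, so it has a linear factor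
  \<open>X - z\<close>; by minimality the cofactor \<open>q\<close> has
  \<open>q(f) v \<noteq> 0\<close>, and this vector is an eigenvector for \<open>z\<close>.\<close>

lemma exists_eigenvector:
  fixes f :: "'a::complex_vector \<Rightarrow> 'a"
  assumes f: "clinear f" and B: "finite B" "cvec.span B = (UNIV :: 'a set)" and v: "(v::'a) \<noteq> 0"
  obtains c y where "y \<noteq> 0" "f y = c *\<^sub>C y"
proof -
  define E where "E p = (\<Sum>i\<le>degree p. coeff p i *\<^sub>C (f ^^ i) v)" for p :: "complex poly"
  have E_alt: "E p = (\<Sum>i\<le>n. coeff p i *\<^sub>C (f ^^ i) v)" if "degree p \<le> n" for p n
    unfolding E_def by (rule sum.mono_neutral_left) (use that in \<open>auto simp: coeff_eq_0\<close>)
  have E_mult: "E ([:- z, 1:] * q) = f (E q) - z *\<^sub>C E q" for z q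
  proof -
    have "degree ([:- z, 1:] * q) \<le> Suc (degree q)"
      using degree_mult_le[of "[:- z, 1:]" q] by simp
    moreover have "[:- z, 1:] * q = pCons 0 q - smult z q"
      by (simp add: algebra_simps)
    ultimately have "E ([:- z, 1:] * q) =
        (\<Sum>i\<le>Suc (degree q). (coeff (pCons 0 q) i - z * coeff q i) *\<^sub>C (f ^^ i) v)"
      using E_alt by (metis (no_types, lifting) coeff_diff coeff_smult sum.cong)
    also have "\<dots> = (\<Sum>i\<le>Suc (degree q). coeff (pCons 0 q) i *\<^sub>C (f ^^ i) v)
        - z *\<^sub>C (\<Sum>i\<le>Suc (degree q). coeff q i *\<^sub>C (f ^^ i) v)"
      by (simp add: cvec.scale_left_diff_distrib sum_subtractf cvec.scale_sum_right scaleC_scaleC scaleC_add_right)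
    also have "(\<Sum>i\<le>Suc (degree q). coeff q i *\<^sub>C (f ^^ i) v) = E q"
      by (rule E_alt[symmetric]) simp
    also have "(\<Sum>i\<le>Suc (degree q). coeff (pCons 0 q) i *\<^sub>C (f ^^ i) v) = f (E q)"
      unfolding sum.atMost_Suc_shift by (simp add: E_def clinear_sum[OF f] clinear_scale[OF f])
    finally show ?thesis .
  qed
  \<comment> \<open>Dependence is a property of sets, so a repetition among the
    \<open>card B + 1\<close> vectors \<open>v, f v, ...\<close> is a case of its own; it yields the
    polynomial \<open>X^j - X^i\<close>.\<close>
  have "\<exists>p. p \<noteq> 0 \<and> E p = 0"
  proof (cases "inj_on (\<lambda>i. (f ^^ i) v) {..card B}")
    case False
    then obtain i j where ij: "i < j" "(f ^^ i) v = (f ^^ j) v"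
      unfolding inj_on_def by (metis linorder_neqE_nat)
    let ?p = "monom 1 j - monom 1 i :: complex poly"
    have "coeff ?p j = 1" using ij by simp
    then have "?p \<noteq> 0" by (metis coeff_0 zero_neq_one)
    moreover have "degree ?p \<le> j"
      using ij by (intro degree_diff_le) (auto simp: degree_monom_eq)
    from E_alt[OF this] have "E ?p = (\<Sum>n\<le>j. (if n = j then (f ^^ n) v else 0) - (if n = i then (f ^^ n) v else 0))"
      by (auto simp: scaleC_one cvec.scale_minus_left intro!: sum.cong)
    then have "E ?p = 0" using ij by (simp add: sum_subtractf)
    ultimately show ?thesis by blast
  next
    case True
    let ?S = "(\<lambda>i. (f ^^ i) v) ` {..card B}"
    have "\<not> cvec.independent ?S"
      using cvec.independent_span_bound[OF B(1), of ?S] B(2) card_image[OF True] by auto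
    then obtain u w where u: "(\<Sum>w\<in>?S. u w *\<^sub>C w) = 0" "w \<in> ?S" "u w \<noteq> 0"
      using cvec.dependent_finite[of ?S] by auto
    define p :: "complex poly" where "p = (\<Sum>i\<le>card B. monom (u ((f ^^ i) v)) i)"
    have cp: "coeff p i = (if i \<le> card B then u ((f ^^ i) v) else 0)" for i
      by (simp add: p_def coeff_sum)
    have "p \<noteq> 0" using u(2,3) cp by (metis (no_types, lifting) atMost_iff coeff_0 imageE)
    moreover have "degree p \<le> card B" by (rule degree_le) (simp add: cp)
    from E_alt[OF this] have "E p = 0"
      using u(1) by (simp add: cp sum.reindex[OF True])
    ultimately show ?thesis by blast
  qed
  then obtain p where p: "p \<noteq> 0" "E p = 0" "\<And>q. q \<noteq> 0 \<Longrightarrow> E q = 0 \<Longrightarrow> degree p \<le> degree q"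
    using exists_least_iff[of "\<lambda>n. \<exists>p. p \<noteq> 0 \<and> E p = 0 \<and> degree p = n"] by (metis not_le)
  have "degree p \<noteq> 0"
  proof
    assume "degree p = 0"
    then obtain c where "p = [:c:]" by (metis degree_eq_zeroE)
    with p(1,2) v show False by (simp add: E_def)
  qed
  then obtain z q where zq: "p = [:- z, 1:] * q" by (rule poly_factor_root)
  with p(1) have q: "q \<noteq> 0" by auto
  have "degree p = Suc (degree q)"
    unfolding zq using q by (subst degree_mult_eq) auto
  with p(3)[OF q] have "E q \<noteq> 0" by auto
  moreover have "f (E q) = z *\<^sub>C E q" using p(2) zq E_mult by simp
  ultimately show ?thesis using that by blast
qed

section \<open>Tensor products\<close>

lemma tensor_add_left: "(x + x') \<otimes> y = x \<otimes> y + x' \<otimes> y"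
  by transfer (metis tensor_rel_def tensor_null.add_left diff_diff_eq)

lemma tensor_add_right: "x \<otimes> (y + y') = x \<otimes> y + x \<otimes> y'"
  by transfer (metis tensor_rel_def tensor_null.add_right diff_diff_eq)

lemma tensor_scale_left: "(c *\<^sub>C x) \<otimes> y = c *\<^sub>C (x \<otimes> y)"
  by transfer (simp add: tensor_rel_def scaleC_single scaleC_complex_def tensor_null.scale_left)

lemma tensor_scale_right: "x \<otimes> (c *\<^sub>C y) = c *\<^sub>C (x \<otimes> y)"
  by transfer (simp add: tensor_rel_def scaleC_single scaleC_complex_def tensor_null.scale_right)

lemma clinear_tensor_left: "clinear (\<lambda>x. x \<otimes> y)"
  and clinear_tensor_right: "clinear (\<lambda>y. x \<otimes> y)"
  by (simp_all add: clinear_iff tensor_add_left tensor_add_right tensor_scale_left tensor_scale_right)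

lemmas tensor_0_left [simp] = clinear_0[OF clinear_tensor_left]
lemmas tensor_0_right [simp] = clinear_0[OF clinear_tensor_right]
lemmas tensor_diff_left = clinear_diff[OF clinear_tensor_left]
lemmas tensor_diff_right = clinear_diff[OF clinear_tensor_right]
lemmas tensor_neg_right = clinear_neg[OF clinear_tensor_right]

lemma tensor_abs_cases: obtains p where "s = abs_tensor p"
  by (induction s rule: tensor.abs_induct) blast

lemma tensor_induct [case_names tensor add]:
  assumes t: "\<And>x y. P (x \<otimes> y)" and a: "\<And>s s'. P s \<Longrightarrow> P s' \<Longrightarrow> P (s + s')"
  shows "P (s :: ('a::complex_vector, 'b::complex_vector) tensor)"
proof -
  obtain p where s: "s = abs_tensor p" by (rule tensor_abs_cases)
  have "P (abs_tensor p)"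
  proof (induction p rule: pm_induct)
    case (single i r)
    obtain x y where i: "i = (x, y)" by fastforce
    have "abs_tensor (Poly_Mapping.single i r) = r *\<^sub>C (x \<otimes> y)"
      by (simp add: i tensor_of.abs_eq scaleC_tensor.abs_eq scaleC_single scaleC_complex_def)
    also have "\<dots> = (r *\<^sub>C x) \<otimes> y" by (simp add: tensor_scale_left)
    finally show ?case using t by simp
  next
    case (add p q)
    then show ?case using a by (metis plus_tensor.abs_eq)
  qed
  with s show ?thesis by simp
qed

definition bilin :: "('a::complex_vector \<Rightarrow> 'b::complex_vector \<Rightarrow> 'c::complex_vector) \<Rightarrow> bool"
  where "bilin \<beta> \<longleftrightarrow> (\<forall>x. clinear (\<beta> x)) \<and> (\<forall>y. clinear (\<lambda>x. \<beta> x y))"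

lemma bilinI: "(\<And>x. clinear (\<beta> x)) \<Longrightarrow> (\<And>y. clinear (\<lambda>x. \<beta> x y)) \<Longrightarrow> bilin \<beta>"
  by (simp add: bilin_def)

lemma bilinD: "bilin \<beta> \<Longrightarrow> clinear (\<beta> x)" "bilin \<beta> \<Longrightarrow> clinear (\<lambda>x. \<beta> x y)"
  by (simp_all add: bilin_def)

definition tensor_lift :: "('a::complex_vector \<Rightarrow> 'b::complex_vector \<Rightarrow> 'c::complex_vector) \<Rightarrow> ('a, 'b) tensor \<Rightarrow> 'c"
  where "tensor_lift \<beta> s = pm_sum (\<lambda>xy r. r *\<^sub>C \<beta> (fst xy) (snd xy)) (rep_tensor s)"

context
  fixes \<beta> :: "'a::complex_vector \<Rightarrow> 'b::complex_vector \<Rightarrow> 'c::complex_vector"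
  assumes \<beta>: "bilin \<beta>"
begin

private abbreviation "L \<equiv> pm_sum (\<lambda>xy r. r *\<^sub>C \<beta> (fst xy) (snd xy))"

private lemma L: "clinear L"
  by (rule clinearI)
    (simp_all add: pm_sum_add pm_sum_scale scaleC_add_left scaleC_scaleC scaleC_complex_def)

private lemma L_null: "p \<in> tensor_null \<Longrightarrow> L p = 0"
  by (induction rule: tensor_null.induct)
    (simp_all add: clinear_simps[OF L] pm_sum_single scaleC_one
      clinear_simps[OF bilinD(1)[OF \<beta>]] clinear_simps[OF bilinD(2)[OF \<beta>]])

private lemma L_abs: "tensor_lift \<beta> (abs_tensor p) = L p"
proof -
  have "tensor_rel (rep_tensor (abs_tensor p)) p"
    by (simp add: tensor.abs_eq_iff[symmetric] Quotient3_abs_rep[OF Quotient3_tensor])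
  then have "L (rep_tensor (abs_tensor p)) - L p = 0"
    unfolding tensor_rel_def using L_null clinear_diff[OF L] by metis
  then show ?thesis by (simp add: tensor_lift_def)
qed

lemma tensor_lift_tensor: "tensor_lift \<beta> (x \<otimes> y) = \<beta> x y"
  by (simp add: tensor_of.abs_eq L_abs pm_sum_single scaleC_one)

lemma clinear_tensor_lift: "clinear (tensor_lift \<beta>)"
proof (rule clinearI)
  fix s t :: "('a, 'b) tensor" and c
  obtain p q where pq: "s = abs_tensor p" "t = abs_tensor q"
    by (metis tensor_abs_cases)
  show "tensor_lift \<beta> (s + t) = tensor_lift \<beta> s + tensor_lift \<beta> t"
    by (simp add: pq plus_tensor.abs_eq L_abs clinear_add[OF L])
  show "tensor_lift \<beta> (c *\<^sub>C s) = c *\<^sub>C tensor_lift \<beta> s"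
    by (simp add: pq scaleC_tensor.abs_eq L_abs clinear_scale[OF L])
qed

end

lemma clinear_eq_tensor:
  assumes "clinear f" "clinear g" "\<And>x y. f (x \<otimes> y) = g (x \<otimes> y)"
  shows "f s = g s"
  by (induction s rule: tensor_induct) (simp_all add: assms clinear_add)

definition tmap :: "('a::complex_vector \<Rightarrow> 'c::complex_vector) \<Rightarrow> ('b::complex_vector \<Rightarrow> 'd::complex_vector)
    \<Rightarrow> ('a, 'b) tensor \<Rightarrow> ('c, 'd) tensor"
  where "tmap f g = tensor_lift (\<lambda>x y. f x \<otimes> g y)"

lemma bilin_tmap: "clinear f \<Longrightarrow> clinear g \<Longrightarrow> bilin (\<lambda>x y. f x \<otimes> g y)"
  by (intro bilinI) (simp_all add: clinear_iff tensor_add_left tensor_add_right tensor_scale_left tensor_scale_right)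

lemma tmap_tensor: "clinear f \<Longrightarrow> clinear g \<Longrightarrow> tmap f g (x \<otimes> y) = f x \<otimes> g y"
  by (simp add: tmap_def tensor_lift_tensor bilin_tmap)

lemma clinear_tmap: "clinear f \<Longrightarrow> clinear g \<Longrightarrow> clinear (tmap f g)"
  by (simp add: tmap_def clinear_tensor_lift bilin_tmap)

lemma tensor_subI: "x \<in> A \<Longrightarrow> y \<in> B \<Longrightarrow> x \<otimes> y \<in> tensor_sub A B"
  unfolding tensor_sub_def by (rule cvec.span_base) blast

lemma subspace_tensor_sub: "cvec.subspace (tensor_sub A B)"
  by (simp add: tensor_sub_def cvec.subspace_span)

lemma tensor_sub_image:
  assumes "clinear f" "cvec.subspace S" "\<And>x y. x \<in> A \<Longrightarrow> y \<in> B \<Longrightarrow> f (x \<otimes> y) \<in> S" "s \<in> tensor_sub A B"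
  shows "f s \<in> S"
  by (rule subspace_vimageD[OF assms(1,2) assms(4)[unfolded tensor_sub_def]]) (use assms(3) in auto)

lemma tensor_finite_sum:
  obtains B :: "'a::complex_vector set" and g :: "'a \<Rightarrow> 'b::complex_vector"
  where "finite B" "s = (\<Sum>w\<in>B. w \<otimes> g w)"
proof -
  have "\<exists>B g. finite B \<and> s = (\<Sum>w\<in>B. w \<otimes> g w)"
  proof (induction s rule: tensor_induct)
    case (tensor x y)
    show ?case by (rule exI[of _ "{x}"], rule exI[of _ "\<lambda>_. y"]) simp
  next
    case (add s s')
    then obtain B g B' g' where *: "finite B" "s = (\<Sum>w\<in>B. w \<otimes> g w)" "finite B'" "s' = (\<Sum>w\<in>B'. w \<otimes> g' w)"
      by blast
    let ?h = "\<lambda>w. (if w \<in> B then g w else 0) + (if w \<in> B' then g' w else 0)"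
    have "(\<Sum>w\<in>B \<union> B'. w \<otimes> ?h w) = (\<Sum>w\<in>B \<union> B'. w \<otimes> (if w \<in> B then g w else 0))
        + (\<Sum>w\<in>B \<union> B'. w \<otimes> (if w \<in> B' then g' w else 0))"
      by (simp add: tensor_add_right sum.distrib)
    also have "(\<Sum>w\<in>B \<union> B'. w \<otimes> (if w \<in> B then g w else 0)) = s"
      unfolding *(2) using *(1,3) by (intro sum.mono_neutral_cong_right) auto
    also have "(\<Sum>w\<in>B \<union> B'. w \<otimes> (if w \<in> B' then g' w else 0)) = s'"
      unfolding *(4) using *(1,3) by (intro sum.mono_neutral_cong_right) auto
    finally show ?case using *(1,3) by (metis finite_Un)
  qed
  then show ?thesis using that by blast
qed

text \<open>A representation with the least number of terms has linearly independent first factors.\<close>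

lemma tensor_shrink:
  assumes "finite B" "s = (\<Sum>w\<in>B. w \<otimes> g w)" "cvec.dependent B"
  obtains B' g' where "finite B'" "s = (\<Sum>w\<in>B'. w \<otimes> g' w)" "card B' < card B"
proof -
  obtain w0 where w0: "w0 \<in> B" "w0 \<in> cvec.span (B - {w0})"
    using assms(3) by (auto simp: cvec.dependent_def)
  obtain r where r: "w0 = (\<Sum>w\<in>B - {w0}. r w *\<^sub>C w)"
    using w0(2) assms(1) cvec.span_finite[of "B - {w0}"] by auto
  have "s = w0 \<otimes> g w0 + (\<Sum>w\<in>B - {w0}. w \<otimes> g w)"
    unfolding assms(2) using assms(1) w0(1) by (rule sum.remove)
  also have "w0 \<otimes> g w0 = (\<Sum>w\<in>B - {w0}. w \<otimes> (r w *\<^sub>C g w0))"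
    by (subst r) (simp add: clinear_sum[OF clinear_tensor_left] tensor_scale_left tensor_scale_right)
  also have "\<dots> + (\<Sum>w\<in>B - {w0}. w \<otimes> g w) = (\<Sum>w\<in>B - {w0}. w \<otimes> (r w *\<^sub>C g w0 + g w))"
    by (simp add: tensor_add_right sum.distrib)
  finally have "s = (\<Sum>w\<in>B - {w0}. w \<otimes> (r w *\<^sub>C g w0 + g w))" .
  moreover have "card (B - {w0}) < card B"
    using assms(1) w0(1) by (rule card_Diff1_less)
  ultimately show ?thesis using that assms(1) by (metis finite_Diff)
qed

text \<open>The coordinate functional of \<open>w\<close>, applied to the first factors, turns the
  sum into \<open>g w\<close>.\<close>

lemma tensor_independent_sum:
  fixes g :: "'a::complex_vector \<Rightarrow> 'b::complex_vector"
  assumes "cvec.independent B" "finite B" "(\<Sum>w\<in>B. w \<otimes> g w) = 0" "w \<in> B"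
  shows "g w = 0"
proof -
  obtain f :: "'a \<Rightarrow> complex" where f: "clinear f" "f w = 1" "\<And>x. x \<in> B \<Longrightarrow> x \<noteq> w \<Longrightarrow> f x = 0"
    by (rule coordinate_functional[OF assms(1,4)]) (rule that)
  have b: "bilin (\<lambda>x y. f x *\<^sub>C y)"
    by (intro bilinI)
      (simp_all add: clinear_iff clinear_simps[OF f(1)] scaleC_add_left
        scaleC_add_right scaleC_scaleC scaleC_complex_def mult.commute)
  have "0 = tensor_lift (\<lambda>x y. f x *\<^sub>C y) (\<Sum>w\<in>B. w \<otimes> g w)"
    by (simp add: assms(3) clinear_0[OF clinear_tensor_lift[OF b]])
  also have "\<dots> = (\<Sum>x\<in>B. f x *\<^sub>C g x)"
    by (simp add: clinear_sum[OF clinear_tensor_lift[OF b]] tensor_lift_tensor[OF b])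
  also have "\<dots> = (\<Sum>x\<in>B. if x = w then g w else 0)"
    by (rule sum.cong) (auto simp: f scaleC_one)
  also have "\<dots> = g w" using assms(2,4) by simp
  finally show ?thesis by simp
qed

lemma tensor_independent_form:
  obtains B :: "'a::complex_vector set" and g :: "'a \<Rightarrow> 'b::complex_vector"
  where "finite B" "cvec.independent B" "s = (\<Sum>w\<in>B. w \<otimes> g w)"
proof -
  let ?P = "\<lambda>n. \<exists>B g. finite B \<and> s = (\<Sum>w\<in>B. w \<otimes> g w) \<and> card (B :: 'a set) = n"
  obtain B g where B: "finite B" "s = (\<Sum>w\<in>B. w \<otimes> g w)" "\<And>m. m < card B \<Longrightarrow> \<not> ?P m"
    using tensor_finite_sum[of s] exists_least_iff[of ?P] by metis
  then have "cvec.independent B"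
    using tensor_shrink[OF B(1,2)] by metis
  with B that show ?thesis by blast
qed

lemma tensor_nonzero:
  assumes "x \<noteq> 0" "y \<noteq> 0" shows "x \<otimes> y \<noteq> 0"
  using tensor_independent_sum[of "{x}" "\<lambda>_. y" x] assms by auto

section \<open>Enveloping algebras\<close>

lemma uea_abs_cases: obtains p where "P = abs_uea p"
  by (induction P rule: uea.abs_induct) blast

lemma single_0_mult: "Poly_Mapping.single 0 c * r = c *\<^sub>C (r :: 'a fword \<Rightarrow>\<^sub>0 complex)"
  by (induction r rule: pm_induct)
    (simp_all add: mult_single scaleC_single scaleC_complex_def distrib_left scaleC_add_right)

lemma mult_single_0: "r * Poly_Mapping.single 0 c = c *\<^sub>C (r :: 'a fword \<Rightarrow>\<^sub>0 complex)"
  by (induction r rule: pm_induct)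
    (simp_all add: mult_single scaleC_single scaleC_complex_def distrib_right scaleC_add_right mult.commute)

lemma fscale_mult: "(c *\<^sub>C p) * q = c *\<^sub>C (p * (q :: 'a fword \<Rightarrow>\<^sub>0 complex))"
  "p * (c *\<^sub>C q) = c *\<^sub>C (p * (q :: 'a fword \<Rightarrow>\<^sub>0 complex))"
  by (metis single_0_mult mult.assoc) (metis mult_single_0 mult.assoc)

lemma uea_rel_refl: "uea_rel p p"
  by (simp add: uea_rel_def uea_ideal.zero)

lemma uea_scale_mult_left: "(c *\<^sub>C P) * Q = c *\<^sub>C (P * (Q :: 'a::lie_algebra uea))"
  by transfer (simp add: fscale_mult uea_rel_refl)

lemma uea_scale_mult_right: "P * (c *\<^sub>C Q) = c *\<^sub>C (P * (Q :: 'a::lie_algebra uea))"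
  by transfer (simp add: fscale_mult uea_rel_refl)

lemmas uea_scale_mult = uea_scale_mult_left uea_scale_mult_right

lemma clinear_uea_mult_left: "clinear (\<lambda>P. P * (Q :: 'a::lie_algebra uea))"
  and clinear_uea_mult_right: "clinear (\<lambda>P. (Q :: 'a::lie_algebra uea) * P)"
  by (simp_all add: clinear_iff uea_scale_mult distrib_left distrib_right)

lemma ugen_add: "ugen (x + y) = ugen x + ugen y"
proof transfer
  fix x y :: 'a
  show "uea_rel (letter (x + y)) (letter x + letter y)"
    using uea_ideal.letter_add[of x y] by (simp add: uea_rel_def algebra_simps)
qed

lemma ugen_scale: "ugen (c *\<^sub>C x) = c *\<^sub>C ugen x"
  by transfer (simp add: uea_rel_def uea_ideal.letter_scale)

lemma clinear_ugen: "clinear ugen"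
  by (simp add: clinear_iff ugen_add ugen_scale)

lemma ugen_lie: "ugen (lie x y) = ugen x * ugen y - ugen y * ugen x"
proof transfer
  fix x y :: 'a
  show "uea_rel (letter (lie x y)) (letter x * letter y - letter y * letter x)"
    using uea_ideal_uminus[OF uea_ideal.letter_lie[of x y]] by (simp add: uea_rel_def algebra_simps)
qed

definition uea_word :: "'a::lie_algebra list \<Rightarrow> 'a uea"
  where "uea_word xs = prod_list (map ugen xs)"

lemma uea_word_simps [simp]:
  "uea_word [] = 1" "uea_word (x # xs) = ugen x * uea_word xs" "uea_word (xs @ ys) = uea_word xs * uea_word ys"
  by (simp_all add: uea_word_def)

lemma abs_uea_word: "abs_uea (Poly_Mapping.single (FWord xs) 1) = uea_word xs"
proof (induction xs)
  case Nil
  then show ?case by (simp add: one_uea.abs_eq zero_fword_def flip: single_one)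
next
  case (Cons x xs)
  have "Poly_Mapping.single (FWord (x # xs)) (1::complex) = letter x * Poly_Mapping.single (FWord xs) 1"
    by (simp add: mult_single plus_fword_def)
  then show ?case using Cons by (simp add: times_uea.abs_eq[symmetric] ugen.abs_eq)
qed

lemma uea_word_induct [case_names word add scale]:
  assumes w: "\<And>xs. Q (uea_word xs)" and a: "\<And>P P'. Q P \<Longrightarrow> Q P' \<Longrightarrow> Q (P + P')"
    and s: "\<And>c P. Q P \<Longrightarrow> Q (c *\<^sub>C P)"
  shows "Q P"
proof -
  obtain p where P: "P = abs_uea p" by (rule uea_abs_cases)
  have "Q (abs_uea p)"
  proof (induction p rule: pm_induct)
    case (single v r)
    obtain xs where v: "v = FWord xs" by (cases v)
    have "abs_uea (Poly_Mapping.single v r) = r *\<^sub>C abs_uea (Poly_Mapping.single v 1)"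
      by (simp add: scaleC_uea.abs_eq scaleC_single scaleC_complex_def)
    then show ?case using w s by (simp add: v abs_uea_word)
  next
    case (add p q)
    then show ?case using a by (metis plus_uea.abs_eq)
  qed
  then show ?thesis by (simp add: P)
qed

lemma uea_induct [case_names one gen add scale]:
  assumes "Q 1" "\<And>x P. Q P \<Longrightarrow> Q (ugen x * P)" "\<And>P P'. Q P \<Longrightarrow> Q P' \<Longrightarrow> Q (P + P')"
    "\<And>c P. Q P \<Longrightarrow> Q (c *\<^sub>C P)"
  shows "Q P"
proof (induction P rule: uea_word_induct)
  case (word xs)
  show ?case by (induction xs) (simp_all add: assms(1,2))
qed (simp_all add: assms(3,4))

definition uea_lift :: "('a list \<Rightarrow> 'c::complex_vector) \<Rightarrow> 'a::lie_algebra uea \<Rightarrow> 'c"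
  where "uea_lift F P = pm_sum (\<lambda>xs s. s *\<^sub>C F (letters xs)) (rep_uea P)"

text \<open>The functions on words that factor through the enveloping algebra.\<close>

definition uea_compat :: "('a::lie_algebra list \<Rightarrow> 'c::complex_vector) \<Rightarrow> bool"
  where "uea_compat F \<longleftrightarrow>
    (\<forall>us x y vs. F (us @ (x + y) # vs) = F (us @ x # vs) + F (us @ y # vs)) \<and>
    (\<forall>us c x vs. F (us @ (c *\<^sub>C x) # vs) = c *\<^sub>C F (us @ x # vs)) \<and>
    (\<forall>us x y vs. F (us @ lie x y # vs) = F (us @ x # y # vs) - F (us @ y # x # vs))"

lemma uea_compatI:
  assumes "\<And>us x y vs. F (us @ (x + y) # vs) = F (us @ x # vs) + F (us @ y # vs)"
    "\<And>us c x vs. F (us @ (c *\<^sub>C x) # vs) = c *\<^sub>C F (us @ x # vs)"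
    "\<And>us x y vs. F (us @ lie x y # vs) = F (us @ x # y # vs) - F (us @ y # x # vs)"
  shows "uea_compat F"
  using assms by (simp add: uea_compat_def)

context
  fixes F :: "'a::lie_algebra list \<Rightarrow> 'c::complex_vector"
  assumes F: "uea_compat F"
begin

private abbreviation "W \<equiv> pm_sum (\<lambda>xs s. s *\<^sub>C F (letters xs))"

private lemma W: "clinear W"
  by (rule clinearI)
    (simp_all add: pm_sum_add pm_sum_scale scaleC_add_left scaleC_scaleC scaleC_complex_def)

text \<open>The words \<open>u\<close> and \<open>v\<close> on both sides are needed for the
  induction: multiplication of an element of the ideal by further words only lengthens them.\<close>

private lemma W_ideal:
  "p \<in> uea_ideal \<Longrightarrow> W (Poly_Mapping.single u 1 * p * Poly_Mapping.single v 1) = 0"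
proof (induction arbitrary: u v rule: uea_ideal.induct)
  case (mult p q r)
  show ?case
  proof (induction q rule: pm_induct)
    case (single i s)
    show ?case
    proof (induction r rule: pm_induct)
      case (single j t)
      have "Poly_Mapping.single u 1 * (Poly_Mapping.single i s * p * Poly_Mapping.single j t) * Poly_Mapping.single v 1
          = (s * t) *\<^sub>C (Poly_Mapping.single (u + i) 1 * p * Poly_Mapping.single (j + v) 1)"
      proof -
        have *: "Poly_Mapping.single i s = s *\<^sub>C Poly_Mapping.single i 1"
          "Poly_Mapping.single j t = t *\<^sub>C Poly_Mapping.single j 1"
          by (simp_all add: scaleC_single scaleC_complex_def)
        have "Poly_Mapping.single (u + i) (1::complex) = Poly_Mapping.single u 1 * Poly_Mapping.single i 1"
          "Poly_Mapping.single (j + v) (1::complex) = Poly_Mapping.single j 1 * Poly_Mapping.single v 1"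
          by (simp_all add: mult_single)
        then show ?thesis
          unfolding * by (simp add: fscale_mult mult.assoc scaleC_scaleC mult.commute)
      qed
      then show ?case by (simp add: clinear_scale[OF W] mult.IH)
    qed (simp add: distrib_left distrib_right clinear_add[OF W])
  qed (simp add: distrib_left distrib_right clinear_add[OF W])
next
  case (letter_add x y)
  show ?case using F
    by (simp add: left_diff_distrib right_diff_distrib mult_single plus_fword_def clinear_diff[OF W]
        pm_sum_single scaleC_one uea_compat_def)
next
  case (letter_scale c x)
  show ?case using F
    by (simp add: left_diff_distrib right_diff_distrib mult_single plus_fword_def clinear_diff[OF W]
        pm_sum_single scaleC_one uea_compat_def scaleC_single scaleC_complex_def)
next
  case (letter_lie x y)
  show ?case using F
    by (simp add: left_diff_distrib right_diff_distrib mult_single plus_fword_def clinear_diff[OF W]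
        pm_sum_single scaleC_one uea_compat_def)
qed (simp_all add: distrib_left distrib_right clinear_simps[OF W])

private lemma W_abs: "uea_lift F (abs_uea p) = W p"
proof -
  have "uea_rel (rep_uea (abs_uea p)) p"
    by (simp add: uea.abs_eq_iff[symmetric] Quotient3_abs_rep[OF Quotient3_uea])
  then have "W (rep_uea (abs_uea p)) - W p = 0"
    using W_ideal[of "rep_uea (abs_uea p) - p" 0 0] by (simp add: uea_rel_def clinear_diff[OF W])
  then show ?thesis by (simp add: uea_lift_def)
qed

lemma uea_lift_word: "uea_lift F (uea_word xs) = F xs"
  by (simp add: W_abs pm_sum_single scaleC_one flip: abs_uea_word)

lemma clinear_uea_lift: "clinear (uea_lift F)"
proof (rule clinearI)
  fix P Q :: "'a uea" and c
  obtain p q where pq: "P = abs_uea p" "Q = abs_uea q"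
    by (metis uea_abs_cases)
  show "uea_lift F (P + Q) = uea_lift F P + uea_lift F Q"
    by (simp add: pq plus_uea.abs_eq W_abs clinear_add[OF W])
  show "uea_lift F (c *\<^sub>C P) = c *\<^sub>C uea_lift F P"
    by (simp add: pq scaleC_uea.abs_eq W_abs clinear_scale[OF W])
qed

end

subsection \<open>The action on modules\<close>

lemma lie_moduleD:
  assumes "lie_module \<rho>"
  shows "clinear (\<rho> x)" "clinear (\<lambda>x. \<rho> x w)" "\<rho> (lie x y) w = \<rho> x (\<rho> y w) - \<rho> y (\<rho> x w)"
  using assms by (simp_all add: lie_module_def)

lemma lie_module_swap: "lie_module \<rho> \<Longrightarrow> \<rho> x (\<rho> y w) = \<rho> y (\<rho> x w) + \<rho> (lie x y) w"
  by (simp add: lie_moduleD)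

context
  fixes \<rho> :: "'l::lie_algebra \<Rightarrow> 'm::complex_vector \<Rightarrow> 'm"
  assumes \<rho>: "lie_module \<rho>"
begin

private lemma clinear_foldr: "clinear (foldr \<rho> xs)"
  by (induction xs)
    (simp_all add: clinear_ident id_def clinear_comp[OF lie_moduleD(1)[OF \<rho>]] comp_def)

private lemma compat_act: "uea_compat (\<lambda>xs. foldr \<rho> xs w)"
  by (rule uea_compatI)
    (simp_all add: clinear_simps[OF lie_moduleD(2)[OF \<rho>]] clinear_simps[OF clinear_foldr] lie_moduleD(3)[OF \<rho>])

private lemma act_lift: "uea_act \<rho> P w = uea_lift (\<lambda>xs. foldr \<rho> xs w) P"
  by (simp add: uea_act_def uea_lift_def)

lemma uea_act_word: "uea_act \<rho> (uea_word xs) w = foldr \<rho> xs w"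
  by (simp add: act_lift uea_lift_word[OF compat_act])

lemma clinear_uea_act_left: "clinear (\<lambda>P. uea_act \<rho> P w)"
  by (simp add: act_lift clinear_uea_lift[OF compat_act])

lemma clinear_uea_act: "clinear (uea_act \<rho> P)"
proof (induction P rule: uea_word_induct)
  case (word xs)
  then show ?case by (simp add: uea_act_word[abs_def] clinear_foldr)
next
  case (add P P')
  then show ?case by (simp add: clinear_add[OF clinear_uea_act_left, abs_def] clinear_plus)
next
  case (scale c P)
  then show ?case by (simp add: clinear_scale[OF clinear_uea_act_left, abs_def] clinear_scaled)
qed

lemma uea_act_1 [simp]: "uea_act \<rho> 1 w = w"
  using uea_act_word[of "[]"] by simp

lemma uea_act_mult: "uea_act \<rho> (P * Q) w = uea_act \<rho> P (uea_act \<rho> Q w)"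
proof (induction P rule: uea_word_induct)
  case (word xs)
  show ?case
  proof (induction Q rule: uea_word_induct)
    case (word ys)
    show ?case by (simp add: uea_act_word flip: uea_word_simps(3))
  qed (simp_all add: distrib_left uea_scale_mult clinear_simps[OF clinear_uea_act_left]
    clinear_simps[OF clinear_uea_act])
qed (simp_all add: distrib_right uea_scale_mult clinear_simps[OF clinear_uea_act_left])

lemma uea_act_gen [simp]: "uea_act \<rho> (ugen x) w = \<rho> x w"
  using uea_act_word[of "[x]"] by simp

private lemma clinear_fold: "clinear (fold \<rho> xs)"
  by (induction xs)
    (simp_all add: clinear_ident id_def clinear_comp[OF _ lie_moduleD(1)[OF \<rho>]] comp_def)

text \<open>\<open>fold\<close> applies the first letter first, and this reversal replaces a
  commutator by its negative. The sign compensates for that, so that a right action of the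
  enveloping algebra results.\<close>

private lemma compat_circ: "uea_compat (\<lambda>xs. (- 1) ^ length xs *\<^sub>C fold \<rho> xs w)"
  by (rule uea_compatI)
    (simp_all add: clinear_simps[OF lie_moduleD(2)[OF \<rho>]] clinear_simps[OF clinear_fold] lie_moduleD(3)[OF \<rho>]
      scaleC_add_right cvec.scale_right_diff_distrib scaleC_scaleC mult.commute cvec.scale_minus_left)

private lemma circ_lift: "uea_circ \<rho> P w = uea_lift (\<lambda>xs. (- 1) ^ length xs *\<^sub>C fold \<rho> xs w) P"
  by (simp add: uea_circ_def uea_lift_def scaleC_scaleC)

lemma uea_circ_word: "uea_circ \<rho> (uea_word xs) w = (- 1) ^ length xs *\<^sub>C fold \<rho> xs w"
  by (simp add: circ_lift uea_lift_word[OF compat_circ])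

lemma clinear_uea_circ_left: "clinear (\<lambda>P. uea_circ \<rho> P w)"
  by (simp add: circ_lift clinear_uea_lift[OF compat_circ])

lemma clinear_uea_circ: "clinear (uea_circ \<rho> P)"
proof (induction P rule: uea_word_induct)
  case (word xs)
  then show ?case by (simp add: uea_circ_word[abs_def] clinear_fold clinear_scaled)
next
  case (add P P')
  then show ?case by (simp add: clinear_add[OF clinear_uea_circ_left, abs_def] clinear_plus)
next
  case (scale c P)
  then show ?case by (simp add: clinear_scale[OF clinear_uea_circ_left, abs_def] clinear_scaled)
qed

lemma uea_circ_1 [simp]: "uea_circ \<rho> 1 w = w"
  using uea_circ_word[of "[]"] by (simp add: scaleC_one)

lemma uea_circ_mult: "uea_circ \<rho> (P * Q) w = uea_circ \<rho> Q (uea_circ \<rho> P w)"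
proof (induction P rule: uea_word_induct)
  case (word xs)
  show ?case
  proof (induction Q rule: uea_word_induct)
    case (word ys)
    show ?case by (simp add: uea_circ_word scaleC_scaleC power_add clinear_scale[OF clinear_fold]
        mult.commute flip: uea_word_simps(3))
  qed (simp_all add: distrib_left uea_scale_mult clinear_simps[OF clinear_uea_circ_left])
qed (simp_all add: distrib_right uea_scale_mult clinear_simps[OF clinear_uea_circ_left]
  clinear_simps[OF clinear_uea_circ])

lemma uea_circ_gen [simp]: "uea_circ \<rho> (ugen x) w = - \<rho> x w"
  using uea_circ_word[of "[x]"] by (simp add: cvec.scale_minus_left scaleC_one)

end

lemma lie_moduleI:
  assumes "\<And>x. clinear (\<rho> x)" "\<And>w. clinear (\<lambda>x. \<rho> x w)"
    "\<And>x y w. \<rho> (lie x y) w = \<rho> x (\<rho> y w) - \<rho> y (\<rho> x w)"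
  shows "lie_module \<rho>"
  using assms by (simp add: lie_module_def)

lemma lie_module_left_mult: "lie_module (\<lambda>x P. ugen x * P)"
  by (rule lie_moduleI)
    (simp_all add: clinear_iff distrib_left distrib_right ugen_add ugen_scale uea_scale_mult
      ugen_lie left_diff_distrib mult.assoc)

lemma uea_sub_mono: "P \<in> uea_sub A \<Longrightarrow> (\<And>x. x \<in> A \<Longrightarrow> ugen x \<in> uea_sub B) \<Longrightarrow> P \<in> uea_sub B"
  by (induction rule: uea_sub.induct) (auto intro: uea_sub.intros)

lemma subspace_uea_sub: "cvec.subspace (uea_sub A)"
proof -
  have "0 \<in> uea_sub A"
    using uea_sub.scale[OF uea_sub.one, where c = 0] by simp
  then show ?thesis by (simp add: cvec.subspace_def uea_sub.add uea_sub.scale)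
qed

lemma uea_sub_span: "x \<in> cvec.span A \<Longrightarrow> ugen x \<in> uea_sub A"
  by (rule subspace_vimageD[OF clinear_ugen subspace_uea_sub _ uea_sub.gen])

lemma uea_sub_span_eq: "uea_sub (cvec.span A) = uea_sub A"
  using uea_sub_mono[of _ "cvec.span A" A] uea_sub_mono[of _ A "cvec.span A"] uea_sub_span
  by (meson cvec.span_base subsetI subset_antisym uea_sub.gen)

lemma uea_sub_mult_stable:
  assumes "P \<in> uea_sub A" "cvec.subspace S" "\<And>x Q. x \<in> A \<Longrightarrow> Q \<in> S \<Longrightarrow> ugen x * Q \<in> S" "Q \<in> S"
  shows "P * Q \<in> S"
  using assms(1,4)
proof (induction arbitrary: Q rule: uea_sub.induct)
  case (add P P')
  then show ?case by (simp add: distrib_right cvec.subspace_add[OF assms(2)])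
next
  case (scale P c)
  then show ?case by (simp add: uea_scale_mult cvec.subspace_scale[OF assms(2)])
next
  case (mult P P')
  then show ?case by (simp add: mult.assoc)
qed (simp_all add: assms(3))

text \<open>Commutators with a fixed generator are derivations.\<close>

lemma uea_sub_commutator:
  assumes "P \<in> uea_sub A" "\<And>x. x \<in> A \<Longrightarrow> ugen (lie y x) \<in> uea_sub A"
  shows "ugen y * P - P * ugen y \<in> uea_sub A"
  using assms(1)
proof (induction rule: uea_sub.induct)
  case (gen x)
  then show ?case using assms(2) by (simp add: ugen_lie)
next
  case (add P Q)
  have "ugen y * (P + Q) - (P + Q) * ugen y = (ugen y * P - P * ugen y) + (ugen y * Q - Q * ugen y)"
    by (simp add: algebra_simps)
  then show ?case using add by (simp add: uea_sub.add)
next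
  case (scale P c)
  have "ugen y * (c *\<^sub>C P) - (c *\<^sub>C P) * ugen y = c *\<^sub>C (ugen y * P - P * ugen y)"
    by (simp add: uea_scale_mult cvec.scale_right_diff_distrib)
  then show ?case using scale by (simp add: uea_sub.scale)
next
  case (mult P Q)
  have "ugen y * (P * Q) - (P * Q) * ugen y = (ugen y * P - P * ugen y) * Q + P * (ugen y * Q - Q * ugen y)"
    by (simp add: algebra_simps)
  then show ?case using mult by (simp add: uea_sub.add uea_sub.mult)
next
  case one
  show ?case using uea_sub.scale[OF uea_sub.one, where c = 0] by simp
qed

subsection \<open>Extending modules from a complemented subalgebra\<close>

text \<open>If a Lie algebra is the direct sum of the subalgebras \<open>range \<iota>\<close> and \<open>{x. p x = 0}\<close>, then
  the enveloping algebra of the first is a module over the whole algebra, namely the one induced from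
  the trivial module of the second. This replaces the PBW theorem.\<close>

locale complemented_subalgebra =
  fixes \<iota> :: "'s::lie_algebra \<Rightarrow> 'l::lie_algebra" and p :: "'l \<Rightarrow> 's"
  assumes \<iota>: "clinear \<iota>" and p: "clinear p" and \<iota>_lie: "\<iota> (lie x y) = lie (\<iota> x) (\<iota> y)"
    and p_\<iota>: "p (\<iota> x) = x" and p_lie: "p X = 0 \<Longrightarrow> p Y = 0 \<Longrightarrow> p (lie X Y) = 0"
begin

text \<open>This is \<open>X y\<^sub>1 ... y\<^sub>r\<close> applied to the generator of the induced
  module: \<open>X\<close> is moved to the right by \<open>X y = y X + [X, y]\<close>, and at the
  end only its component \<open>p X\<close> survives, as the complement annihilates the
  generator.\<close>

primrec ind_word :: "'s list \<Rightarrow> 'l \<Rightarrow> 's uea" where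
  "ind_word [] X = ugen (p X)"
| "ind_word (y # ys) X = ugen y * ind_word ys X + ind_word ys (lie X (\<iota> y))"

lemma clinear_ind_word: "clinear (ind_word ys)"
proof (induction ys)
  case Nil
  show ?case by (simp add: clinear_iff clinear_simps[OF p] ugen_add ugen_scale)
next
  case (Cons y ys)
  then show ?case
    by (simp add: clinear_iff lie_add_left lie_scale_left distrib_left uea_scale_mult scaleC_add_right)
qed

lemma ind_word_\<iota>: "ind_word ys (\<iota> z) = ugen z * uea_word ys"
proof (induction ys arbitrary: z)
  case (Cons y ys)
  then show ?case using \<iota>_lie[of z y] by (simp add: ugen_lie algebra_simps flip: \<iota>_lie)
qed (simp add: p_\<iota>)

lemma uea_compat_ind_word: "uea_compat (\<lambda>ys. ind_word ys X)"
proof (rule uea_compatI)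
  fix us vs x y c
  note lin = clinear_simps[OF clinear_ind_word]
  show "ind_word (us @ (x + y) # vs) X = ind_word (us @ x # vs) X + ind_word (us @ y # vs) X"
    by (induction us arbitrary: X)
      (simp_all add: ugen_add algebra_simps clinear_add[OF \<iota>] lie_add_right lin)
  show "ind_word (us @ (c *\<^sub>C x) # vs) X = c *\<^sub>C ind_word (us @ x # vs) X"
    by (induction us arbitrary: X)
      (simp_all add: ugen_scale algebra_simps uea_scale_mult clinear_scale[OF \<iota>] lie_scale_right lin scaleC_add_right)
  show "ind_word (us @ lie x y # vs) X = ind_word (us @ x # y # vs) X - ind_word (us @ y # x # vs) X"
  proof (induction us arbitrary: X)
    case Nil
    have "lie X (lie (\<iota> x) (\<iota> y)) = lie (lie X (\<iota> x)) (\<iota> y) - lie (lie X (\<iota> y)) (\<iota> x)"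
      using lie_jacobi'[of X "\<iota> x" "\<iota> y"] lie_antisym[of "lie X (\<iota> y)" "\<iota> x"] by simp
    then have "ind_word vs (lie X (lie (\<iota> x) (\<iota> y))) =
        ind_word vs (lie (lie X (\<iota> x)) (\<iota> y)) - ind_word vs (lie (lie X (\<iota> y)) (\<iota> x))"
      by (simp only: lin)
    then show ?case by (simp add: ugen_lie \<iota>_lie algebra_simps)
  next
    case (Cons u us)
    show ?case by (simp only: append_Cons ind_word.simps Cons.IH right_diff_distrib) simp
  qed
qed

definition ind_act :: "'l \<Rightarrow> 's uea \<Rightarrow> 's uea"
  where "ind_act X = uea_lift (\<lambda>ys. ind_word ys X)"

lemma ind_act_word: "ind_act X (uea_word ys) = ind_word ys X"
  by (simp add: ind_act_def uea_lift_word[OF uea_compat_ind_word])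

lemma clinear_ind_act: "clinear (ind_act X)"
  by (simp add: ind_act_def clinear_uea_lift[OF uea_compat_ind_word])

lemma clinear_ind_act_left: "clinear (\<lambda>X. ind_act X u)"
proof (induction u rule: uea_word_induct)
  case (word xs)
  then show ?case by (simp add: ind_act_word clinear_ind_word)
next
  case (add P P')
  then show ?case by (simp add: clinear_add[OF clinear_ind_act] clinear_plus)
next
  case (scale c P)
  then show ?case by (simp add: clinear_scale[OF clinear_ind_act] clinear_scaled)
qed

lemma ind_act_gen_mult: "ind_act X (ugen y * u) = ugen y * ind_act X u + ind_act (lie X (\<iota> y)) u"
proof (induction u rule: uea_word_induct)
  case (word xs)
  show ?case using ind_act_word[of X "y # xs"] by (simp add: ind_act_word)
qed (simp_all add: distrib_left uea_scale_mult clinear_simps[OF clinear_ind_act]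
    scaleC_add_right)

lemma ind_act_\<iota>: "ind_act (\<iota> z) u = ugen z * u"
  by (induction u rule: uea_word_induct)
    (simp_all add: ind_act_word ind_word_\<iota> clinear_simps[OF clinear_ind_act]
      distrib_left uea_scale_mult)

text \<open>For a product \<open>ugen y * u\<close> the claim follows from the claims at
  \<open>u\<close> for the pairs built from \<open>X\<close>, \<open>Y\<close> and
  \<open>\<iota> y\<close>, by the Jacobi identity; hence \<open>X\<close> and \<open>Y\<close> are
  arbitrary in the induction. That the complement is closed under brackets is used only at
  \<open>1\<close>, after splitting \<open>X\<close> and \<open>Y\<close> into their two
  components.\<close>

lemma lie_module_ind_act: "lie_module ind_act"
proof (rule lie_moduleI)
  fix X Y u
  note lin = clinear_simps[OF clinear_ind_act_left] clinear_simps[OF clinear_ind_act]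
  show "ind_act (lie X Y) u = ind_act X (ind_act Y u) - ind_act Y (ind_act X u)"
  proof (induction u arbitrary: X Y rule: uea_induct)
    case one
    have dec: "\<exists>z Z. X = \<iota> z + Z \<and> p Z = 0" for X
      by (rule exI[of _ "p X"], rule exI[of _ "X - \<iota> (p X)"]) (simp add: clinear_diff[OF p] p_\<iota>)
    obtain x X' y Y' where xy: "X = \<iota> x + X'" "p X' = 0" "Y = \<iota> y + Y'" "p Y' = 0"
      using dec[of X] dec[of Y] by auto
    have a1: "ind_act X 1 = ugen (p X)" for X
      using ind_act_word[of X "[]"] by simp
    have a2: "ind_act X (ugen z) = ugen z * ugen (p X) + ugen (p (lie X (\<iota> z)))" for X z
      using ind_act_word[of X "[z]"] by simp
    have *: "lie (\<iota> x) Y' = - lie Y' (\<iota> x)"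
      by (rule lie_antisym)
    have "p (lie X Y) = lie x y - p (lie Y' (\<iota> x)) + p (lie X' (\<iota> y))"
      unfolding xy(1,3) lie_add_left lie_add_right clinear_add[OF p] *
      by (simp add: clinear_neg[OF p] p_\<iota> p_lie[OF xy(2,4)] flip: \<iota>_lie)
    moreover have "p (lie X (\<iota> y)) = lie x y + p (lie X' (\<iota> y))" "p (lie Y (\<iota> x)) = lie y x + p (lie Y' (\<iota> x))"
      unfolding xy(1,3) lie_add_left clinear_add[OF p] by (simp_all add: p_\<iota> flip: \<iota>_lie)
    moreover have "p X = x" "p Y = y"
      unfolding xy(1,3) clinear_add[OF p] by (simp_all add: p_\<iota> xy(2,4))
    ultimately show ?case
      unfolding a1 by (simp add: a2 ugen_add clinear_diff[OF clinear_ugen] ugen_lie del: diff_add_eq)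
  next
    case (gen y u)
    have "ind_act (lie (lie X Y) (\<iota> y)) u = ind_act (lie X (lie Y (\<iota> y))) u + ind_act (lie (lie X (\<iota> y)) Y) u"
    proof -
      have "lie (lie X Y) (\<iota> y) = lie X (lie Y (\<iota> y)) + lie (lie X (\<iota> y)) Y"
        using lie_jacobi'[of X Y "\<iota> y"] lie_antisym[of "lie X (\<iota> y)" Y] by simp
      then show ?thesis by (simp add: lin)
    qed
    then show ?case by (simp add: ind_act_gen_mult lin gen.IH algebra_simps)
  qed (simp_all add: lin cvec.scale_right_diff_distrib)
qed (rule clinear_ind_act clinear_ind_act_left)+

text \<open>The induced action on \<open>1\<close> projects the large enveloping algebra onto that
  of the subalgebra; the result is then evaluated at \<open>w\<close>.\<close>

lemma extend_module:
  fixes \<nu> :: "'s \<Rightarrow> 'n::complex_vector \<Rightarrow> 'n"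
  assumes \<nu>: "lie_module \<nu>"
  obtains f where "clinear f" "f 1 = w" "\<And>z P. f (ugen (\<iota> z) * P) = \<nu> z (f P)"
proof
  let ?f = "\<lambda>P. uea_act \<nu> (uea_act ind_act P 1) w"
  show "clinear ?f"
    by (rule clinear_comp[OF clinear_uea_act_left[OF \<nu>] clinear_uea_act_left[OF lie_module_ind_act]])
  show "?f 1 = w"
    by (simp add: \<nu> lie_module_ind_act)
  show "?f (ugen (\<iota> z) * P) = \<nu> z (?f P)" for z P
    by (simp add: uea_act_mult \<nu> lie_module_ind_act ind_act_\<iota>)
qed

end

section \<open>Modules of the affine-Virasoro algebra\<close>

lemmas lie_generators = av_bracket_generators[folded lie_affvir_def]

lemma clinear_av_g: "clinear (av_g n)"
  by (simp add: clinear_iff av_g_add av_g_scale)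

lemma affvir_moduleI:
  fixes \<rho> :: "'g::simple_lie_algebra affvir \<Rightarrow> 'm::complex_vector \<Rightarrow> 'm"
  assumes lin: "\<And>X. clinear (\<rho> X)" "\<And>w. clinear (\<lambda>X. \<rho> X w)"
    and gg: "\<And>m x n y w. \<rho> (lie (av_g m x) (av_g n y)) w = \<rho> (av_g m x) (\<rho> (av_g n y) w) - \<rho> (av_g n y) (\<rho> (av_g m x) w)"
    and dg: "\<And>m n y w. \<rho> (lie (av_d m) (av_g n y)) w = \<rho> (av_d m) (\<rho> (av_g n y) w) - \<rho> (av_g n y) (\<rho> (av_d m) w)"
    and dd: "\<And>m n w. \<rho> (lie (av_d m) (av_d n)) w = \<rho> (av_d m) (\<rho> (av_d n) w) - \<rho> (av_d n) (\<rho> (av_d m) w)"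
    and k: "\<And>X w. \<rho> X (\<rho> av_k w) = \<rho> av_k (\<rho> X w)" and c: "\<And>X w. \<rho> X (\<rho> av_c w) = \<rho> av_c (\<rho> X w)"
  shows "lie_module \<rho>"
proof -
  define ok where "ok X Y \<longleftrightarrow> (\<forall>w. \<rho> (lie X Y) w = \<rho> X (\<rho> Y w) - \<rho> Y (\<rho> X w))" for X Y
  have sym: "ok X Y \<Longrightarrow> ok Y X" for X Y
    unfolding ok_def lie_antisym[of Y X] clinear_neg[OF lin(2)] by simp
  have add: "ok X Y \<Longrightarrow> ok X Y' \<Longrightarrow> ok X (Y + Y')" for X Y Y'
    unfolding ok_def lie_add_right clinear_add[OF lin(2)] clinear_add[OF lin(1)] by (simp add: algebra_simps)
  have scale: "ok X Y \<Longrightarrow> ok X (s *\<^sub>C Y)" for X Y s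
    unfolding ok_def lie_scale_right clinear_scale[OF lin(2)] clinear_scale[OF lin(1)]
    by (simp add: cvec.scale_right_diff_distrib)
  have central: "ok X av_k" "ok X av_c" for X
    using k c clinear_0[OF lin(2)] by (simp_all add: ok_def lie_generators)
  have 1: "ok (av_g m x) Y" for m x Y
    by (induction Y rule: affvir_induct)
      (use gg sym[of "av_d _"] dg central add scale in \<open>auto simp: ok_def\<close>)
  have 2: "ok (av_d m) Y" for m Y
    by (induction Y rule: affvir_induct)
      (use dd dg central add scale in \<open>auto simp: ok_def\<close>)
  have "ok Y X" for X Y
    by (induction X rule: affvir_induct) (use sym 1 2 central add scale in auto)
  then show ?thesis
    using lin by (simp add: lie_module_def ok_def)
qed

text \<open>Evaluation of a Laurent polynomial at \<open>t = 1\<close>.\<close>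

definition coeff_sum :: "(int \<Rightarrow>\<^sub>0 'b::complex_vector) \<Rightarrow> 'b"
  where "coeff_sum p = pm_sum (\<lambda>_ x. x) p"

lemma clinear_coeff_sum: "clinear coeff_sum"
  by (rule clinearI) (simp_all add: coeff_sum_def pm_sum_add pm_sum_scale)

lemma coeff_sum_single [simp]: "coeff_sum (Poly_Mapping.single s u) = u"
  by (simp add: coeff_sum_def pm_sum_single)

lemma clinear_eq_pm:
  fixes f g :: "('i \<Rightarrow>\<^sub>0 'b::complex_vector) \<Rightarrow> 'c::complex_vector"
  assumes "clinear f" "clinear g" "\<And>i x. f (Poly_Mapping.single i x) = g (Poly_Mapping.single i x)"
  shows "f p = g p"
  by (induction p rule: pm_induct) (simp_all add: assms clinear_add)

text \<open>The loop module \<open>L\<^sub>\<alpha>\<^sub>,\<^sub>\<beta>(\<sigma>)\<close>.\<close>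

definition loop_act :: "complex \<Rightarrow> complex \<Rightarrow> ('g \<Rightarrow> 'b::complex_vector \<Rightarrow> 'b) \<Rightarrow>
    'g::simple_lie_algebra affvir \<Rightarrow> (int \<Rightarrow>\<^sub>0 'b) \<Rightarrow> (int \<Rightarrow>\<^sub>0 'b)"
  where "loop_act \<alpha> \<beta> \<sigma> X p = graded_ext (\<lambda>m s x u. \<sigma> x u) (loop X) p
    + graded_ext (\<lambda>m s r u. (r * (\<alpha> + \<beta> * of_int m + of_int s)) *\<^sub>C u) (vir X) p"

context
  fixes \<sigma> :: "'g::simple_lie_algebra \<Rightarrow> 'b::complex_vector \<Rightarrow> 'b" and \<alpha> \<beta> :: complex
  assumes \<sigma>: "lie_module \<sigma>"
begin

lemma clinear_loop_act: "clinear (loop_act \<alpha> \<beta> \<sigma> X)"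
  by (rule clinearI)
    (simp_all add: loop_act_def graded_ext_add_right graded_ext_scale_right scaleC_add_right
      clinear_simps[OF lie_moduleD(1)[OF \<sigma>]] scaleC_scaleC mult.commute mult.left_commute)

lemma clinear_loop_act_left: "clinear (\<lambda>X. loop_act \<alpha> \<beta> \<sigma> X p)"
  by (rule clinearI)
    (simp_all add: loop_act_def graded_ext_add_left graded_ext_scale_left scaleC_add_right scaleC_add_left
      clinear_simps[OF lie_moduleD(2)[OF \<sigma>]] scaleC_scaleC scaleC_complex_def distrib_right mult.assoc)

lemma loop_act_simps [simp]:
  "loop_act \<alpha> \<beta> \<sigma> (av_g m x) (Poly_Mapping.single s u) = Poly_Mapping.single (m + s) (\<sigma> x u)"
  "loop_act \<alpha> \<beta> \<sigma> (av_d m) (Poly_Mapping.single s u) =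
    Poly_Mapping.single (m + s) ((\<alpha> + \<beta> * of_int m + of_int s) *\<^sub>C u)"
  "loop_act \<alpha> \<beta> \<sigma> av_k p = 0" "loop_act \<alpha> \<beta> \<sigma> av_c p = 0"
  by (simp_all add: loop_act_def av_sel graded_ext_single
      clinear_0[OF lie_moduleD(1)[OF \<sigma>]] clinear_0[OF lie_moduleD(2)[OF \<sigma>]])

lemma lie_module_loop_act: "lie_module (loop_act \<alpha> \<beta> \<sigma>)"
proof (rule affvir_moduleI)
  note lin = clinear_loop_act clinear_comp[OF clinear_loop_act clinear_loop_act]
    clinear_minus[OF clinear_comp[OF clinear_loop_act clinear_loop_act] clinear_comp[OF clinear_loop_act clinear_loop_act]]
  note lin_left = clinear_simps[OF clinear_loop_act_left]
  fix m n :: int and x y :: 'g and w :: "int \<Rightarrow>\<^sub>0 'b"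
  have cyc: "n + (m + s) = m + (n + s)" for s :: int by simp
  show "loop_act \<alpha> \<beta> \<sigma> (lie (av_g m x) (av_g n y)) w =
      loop_act \<alpha> \<beta> \<sigma> (av_g m x) (loop_act \<alpha> \<beta> \<sigma> (av_g n y) w) -
      loop_act \<alpha> \<beta> \<sigma> (av_g n y) (loop_act \<alpha> \<beta> \<sigma> (av_g m x) w)"
    by (rule clinear_eq_pm[OF lin(1,3)])
      (simp add: lie_generators lin_left clinear_0[OF clinear_loop_act_left] cyc add.assoc lie_moduleD(3)[OF \<sigma>] single_diff)
  show "loop_act \<alpha> \<beta> \<sigma> (lie (av_d m) (av_g n y)) w =
      loop_act \<alpha> \<beta> \<sigma> (av_d m) (loop_act \<alpha> \<beta> \<sigma> (av_g n y) w) -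
      loop_act \<alpha> \<beta> \<sigma> (av_g n y) (loop_act \<alpha> \<beta> \<sigma> (av_d m) w)"
    by (rule clinear_eq_pm[OF lin(1,3)])
      (simp add: lie_generators lin_left cyc add.assoc scaleC_single clinear_simps[OF lie_moduleD(1)[OF \<sigma>]] algebra_simps flip: single_diff cvec.scale_left_diff_distrib)
  show "loop_act \<alpha> \<beta> \<sigma> (lie (av_d m) (av_d n)) w =
      loop_act \<alpha> \<beta> \<sigma> (av_d m) (loop_act \<alpha> \<beta> \<sigma> (av_d n) w) -
      loop_act \<alpha> \<beta> \<sigma> (av_d n) (loop_act \<alpha> \<beta> \<sigma> (av_d m) w)"
  proof (rule clinear_eq_pm[OF lin(1,3)])
    fix s :: int and u :: 'b
    have "of_int (n - m) * (\<alpha> + \<beta> * of_int (m + n) + of_int s) =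
        (\<alpha> + \<beta> * of_int m + of_int (n + s)) * (\<alpha> + \<beta> * of_int n + of_int s) -
        (\<alpha> + \<beta> * of_int n + of_int (m + s)) * (\<alpha> + \<beta> * of_int m + of_int s)"
      by (simp add: algebra_simps)
    then show "loop_act \<alpha> \<beta> \<sigma> (lie (av_d m) (av_d n)) (Poly_Mapping.single s u) =
      loop_act \<alpha> \<beta> \<sigma> (av_d m) (loop_act \<alpha> \<beta> \<sigma> (av_d n) (Poly_Mapping.single s u)) -
      loop_act \<alpha> \<beta> \<sigma> (av_d n) (loop_act \<alpha> \<beta> \<sigma> (av_d m) (Poly_Mapping.single s u))"
      by (simp add: lie_generators lin_left clinear_0[OF clinear_loop_act_left] cyc add.assoc scaleC_single scaleC_scaleC del: of_int_diff of_int_add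
          flip: single_diff cvec.scale_left_diff_distrib)
  qed
qed (simp_all add: clinear_loop_act clinear_loop_act_left clinear_0[OF clinear_loop_act])

end

section \<open>The map \<open>\<psi>\<^sub>n\<close> and the omission of powers of \<open>t\<close>\<close>

lemma uea_sub_words: "P \<in> uea_sub A \<Longrightarrow> P \<in> cvec.span {uea_word xs | xs. set xs \<subseteq> A}"
proof -
  let ?S = "cvec.span {uea_word xs | xs. set xs \<subseteq> A}"
  assume P: "P \<in> uea_sub A"
  have "P * 1 \<in> ?S"
  proof (rule uea_sub_mult_stable[OF P cvec.subspace_span])
    fix x Q assume "x \<in> A" "Q \<in> ?S"
    show "ugen x * Q \<in> ?S"
    proof (rule subspace_vimageD[OF clinear_uea_mult_right cvec.subspace_span \<open>Q \<in> ?S\<close>])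
      fix b assume "b \<in> {uea_word xs |xs. set xs \<subseteq> A}"
      then obtain xs where "b = uea_word xs" "set xs \<subseteq> A" by blast
      with \<open>x \<in> A\<close> have "ugen x * b = uea_word (x # xs)" "set (x # xs) \<subseteq> A" by simp_all
      then show "ugen x * b \<in> ?S" by (blast intro: cvec.span_base)
    qed
  next
    show "1 \<in> ?S"
      by (intro cvec.span_base CollectI exI[of _ "[]"]) simp
  qed
  then show ?thesis by simp
qed

abbreviation trivial_act :: "'g::simple_lie_algebra \<Rightarrow> complex \<Rightarrow> complex"
  where "trivial_act \<equiv> \<lambda>x u. 0"

lemma lie_module_trivial: "lie_module trivial_act"
  by (rule lie_moduleI) (simp_all add: clinear_const0)

abbreviation left_mult :: "'g::simple_lie_algebra \<Rightarrow> 'g uea \<Rightarrow> 'g uea"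
  where "left_mult \<equiv> \<lambda>x u. ugen x * u"

text \<open>The products defining \<open>\<psi>\<^sub>n\<close> describe the action on \<open>t\<^sup>-\<^sup>n\<close> in a module over the whole
  algebra; this shows that \<open>\<psi>\<^sub>n\<close> is well defined.\<close>

lemma psi_products:
  fixes ks :: "nat list"
  shows "uea_act (loop_act (- a) (1 - b) trivial_act)
      (prod_list (map (\<lambda>k. ugen (av_d (- int k) :: 'g::simple_lie_algebra affvir)) (rev ks))) (Poly_Mapping.single (- n) 1)
    = Poly_Mapping.single (- n - (\<Sum>i<length ks. int (ks ! i)))
       (\<Prod>j<length ks. of_nat (ks ! j) * b - a - of_int n - (\<Sum>i\<le>j. of_nat (ks ! i)))"
proof (induction ks rule: rev_induct)
  case Nil
  show ?case by (simp add: lie_module_loop_act[OF lie_module_trivial])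
next
  case (snoc k ks)
  note mod = lie_module_loop_act[OF lie_module_trivial]
  let ?f = "\<lambda>ks j. of_nat (ks ! j) * b - a - of_int n - (\<Sum>i\<le>j. of_nat (ks ! i))"
  have 1: "(\<Prod>j<length ks. ?f (ks @ [k]) j) = (\<Prod>j<length ks. ?f ks j)"
    by (intro prod.cong refl) (simp add: nth_append)
  have 2: "(\<Sum>i\<le>length ks. of_nat ((ks @ [k]) ! i)) = of_nat k + (\<Sum>i<length ks. of_nat (ks ! i) :: complex)"
    by (subst lessThan_Suc_atMost[symmetric]) (simp add: nth_append add.commute)
  have 3: "(\<Sum>i<length (ks @ [k]). int ((ks @ [k]) ! i)) = int k + (\<Sum>i<length ks. int (ks ! i))"
    by (simp add: nth_append)
  have 4: "(\<Prod>j<length (ks @ [k]). ?f (ks @ [k]) j) = ?f (ks @ [k]) (length ks) * (\<Prod>j<length ks. ?f ks j)"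
    unfolding length_append_singleton prod.lessThan_Suc 1 by (rule mult.commute)
  show ?case
    unfolding 3 4 using snoc.IH
    by (simp add: uea_act_mult[OF mod] uea_act_gen[OF mod] lie_module_trivial 2 scaleC_complex_def algebra_simps)
qed

text \<open>The loop module of the trivial module with parameters \<open>- a\<close> and
  \<open>1 - b\<close> is the restricted dual of the one with parameters \<open>a\<close> and
  \<open>b\<close>, and \<open>t^(-n)\<close> is dual to \<open>t^n\<close>. In it
  \<open>d\<^sub>-\<^sub>k\<close> sends \<open>t^s\<close> to
  \<open>(k b - a + s - k) t^(s - k)\<close>; with
  \<open>s = - n - k\<^sub>1 - ... - k\<^sub>j\<^sub>-\<^sub>1\<close> and
  \<open>k = k\<^sub>j\<close> the scalar is the \<open>j\<close>-th factor of
  \<open>\<psi>\<^sub>n\<close>.\<close>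

definition psi_fun :: "complex \<Rightarrow> complex \<Rightarrow> int \<Rightarrow> 'g::simple_lie_algebra affvir uea \<Rightarrow> complex"
  where "psi_fun a b n P =
    coeff_sum (uea_act (loop_act (- a) (1 - b) trivial_act) P (Poly_Mapping.single (- n) 1))"

lemma psi_spec:
  "clinear (psi a b n :: 'g::simple_lie_algebra affvir uea \<Rightarrow> complex) \<and>
    (\<forall>ks::nat list. (\<forall>k\<in>set ks. k > 0) \<longrightarrow>
      psi a b n (prod_list (map (\<lambda>k. ugen (av_d (- int k) :: 'g affvir)) (rev ks))) =
      (\<Prod>j<length ks. of_nat (ks ! j) * b - a - of_int n - (\<Sum>i\<le>j. of_nat (ks ! i))))"
proof -
  have "clinear (psi_fun a b n :: 'g affvir uea \<Rightarrow> complex) \<and> (\<forall>ks. (\<forall>k\<in>set ks. 0 < k) \<longrightarrow>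
       psi_fun a b n (prod_list (map (\<lambda>k. ugen (av_d (- int k) :: 'g affvir)) (rev ks))) =
       (\<Prod>j<length ks. of_nat (ks ! j) * b - a - of_int n - (\<Sum>i\<le>j. of_nat (ks ! i))))"
    unfolding psi_fun_def psi_products
    by (simp add: clinear_comp[OF clinear_coeff_sum clinear_uea_act_left[OF lie_module_loop_act[OF lie_module_trivial]]])
  from someI[where P = "\<lambda>f. clinear f \<and> (\<forall>ks. (\<forall>k\<in>set ks. 0 < k) \<longrightarrow>
       f (prod_list (map (\<lambda>k. ugen (av_d (- int k) :: 'g affvir)) (rev ks))) =
       (\<Prod>j<length ks. of_nat (ks ! j) * b - a - of_int n - (\<Sum>i\<le>j. of_nat (ks ! i))))", OF this]
  show ?thesis unfolding psi_def .
qed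

text \<open>The products on which \<open>psi\<close> is prescribed span the enveloping algebra of
  \<open>vir_minus\<close>, so the choice in its definition does not affect its values
  there.\<close>

lemma psi_eq:
  fixes P :: "'g::simple_lie_algebra affvir uea"
  assumes "P \<in> uea_sub vir_minus"
  shows "psi a b n P = psi_fun a b n P"
proof (rule clinear_eq_on_span[where f = "psi a b n" and g = "psi_fun a b n"])
  have "P \<in> uea_sub {av_d (- n) | n. n > 0}"
    using assms by (simp add: vir_minus_def uea_sub_span_eq)
  then show "P \<in> cvec.span {uea_word xs | xs. set xs \<subseteq> {av_d (- n) | n. n > 0}}"
    by (rule uea_sub_words)
  show "clinear (psi a b n :: 'g affvir uea \<Rightarrow> complex)"
    using psi_spec by blast
  show "clinear (psi_fun a b n :: 'g affvir uea \<Rightarrow> complex)"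
    unfolding psi_fun_def
    by (rule clinear_comp[OF clinear_coeff_sum clinear_uea_act_left[OF lie_module_loop_act[OF lie_module_trivial]]])
  fix Q :: "'g affvir uea" assume "Q \<in> {uea_word xs | xs. set xs \<subseteq> {av_d (- n) | n. n > 0}}"
  then obtain xs where xs: "Q = uea_word xs" "set xs \<subseteq> {av_d (- n) | n. n > 0}" by blast
  have "\<exists>ks. xs = map (\<lambda>k. av_d (- int k)) ks \<and> (\<forall>k\<in>set ks. k > 0)"
    using xs(2)
  proof (induction xs)
    case (Cons x xs)
    then obtain ks n where "xs = map (\<lambda>k. av_d (- int k)) ks" "\<forall>k\<in>set ks. k > 0" "x = av_d (- n)" "n > 0"
      by auto
    then show ?case by (intro exI[of _ "nat n # ks"]) simp
  qed simp
  then obtain ks where ks: "xs = map (\<lambda>k. av_d (- int k)) (rev ks)" "\<forall>k\<in>set ks. k > 0"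
    by (metis rev_rev_ident set_rev)
  have Q: "Q = prod_list (map (\<lambda>k. ugen (av_d (- int k))) (rev ks))"
    by (simp add: xs(1) ks(1) uea_word_def comp_def)
  show "psi a b n Q = psi_fun a b n Q"
    unfolding Q psi_fun_def psi_products using psi_spec ks(2) by auto
qed

lemma coeff_sum_loop_act:
  "i > 0 \<Longrightarrow> coeff_sum (loop_act \<alpha> \<beta> left_mult (av_g (- i) x) q) = ugen x * coeff_sum q"
  by (rule clinear_eq_pm[OF clinear_comp[OF clinear_coeff_sum clinear_loop_act] clinear_comp[OF clinear_uea_mult_right clinear_coeff_sum]])
    (simp_all add: lie_module_left_mult)

text \<open>In the loop module of \<open>U(g)\<close> under left multiplication,
  \<open>x(-i)\<close> sends \<open>u t^s\<close> to \<open>x u t^(s - i)\<close>. Acting on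
  \<open>1\<close> and putting \<open>t = 1\<close> thus omits the degrees, and the module property
  makes this well defined.\<close>

definition omit_fun :: "'g::simple_lie_algebra affvir uea \<Rightarrow> 'g uea"
  where "omit_fun P = coeff_sum (uea_act (loop_act 0 0 left_mult) P (Poly_Mapping.single 0 1))"

lemma clinear_omit_fun: "clinear omit_fun"
  unfolding omit_fun_def
  by (rule clinear_comp[OF clinear_coeff_sum clinear_uea_act_left[OF lie_module_loop_act[OF lie_module_left_mult]]])

lemma coeff_sum_loop_minus:
  assumes "\<forall>(i, x)\<in>set xs. i > (0::nat)"
  shows "coeff_sum (uea_act (loop_act \<alpha> \<beta> left_mult)
      (prod_list (map (\<lambda>(i, x). ugen (av_g (- int i) x :: 'g::simple_lie_algebra affvir)) xs)) q)
    = prod_list (map (\<lambda>(i, x). ugen x) xs) * coeff_sum q"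
  using assms
proof (induction xs)
  case Nil
  show ?case by (simp add: lie_module_loop_act lie_module_left_mult)
next
  case (Cons ix xs)
  obtain i x where ix: "ix = (i, x)" by fastforce
  note mod = lie_module_loop_act[OF lie_module_left_mult, where 'g='g]
  show ?case using Cons
    by (simp add: ix uea_act_mult[OF mod] uea_act_gen[OF mod] coeff_sum_loop_act mult.assoc)
qed

lemma omit_t_spec:
  "clinear (omit_t :: 'g::simple_lie_algebra affvir uea \<Rightarrow> 'g uea) \<and>
    (\<forall>xs::(nat \<times> 'g) list. (\<forall>(i, x)\<in>set xs. i > 0) \<longrightarrow>
      omit_t (prod_list (map (\<lambda>(i, x). ugen (av_g (- int i) x)) xs)) = prod_list (map (\<lambda>(i, x). ugen x) xs))"
proof -
  have "clinear (omit_fun :: 'g affvir uea \<Rightarrow> 'g uea) \<and> (\<forall>xs::(nat \<times> 'g) list. (\<forall>(i, x)\<in>set xs. i > 0) \<longrightarrow>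
      omit_fun (prod_list (map (\<lambda>(i, x). ugen (av_g (- int i) x)) xs)) = prod_list (map (\<lambda>(i, x). ugen x) xs))"
    by (auto simp: clinear_omit_fun omit_fun_def coeff_sum_loop_minus simp del: single_one)
  from someI[where P = "\<lambda>f. clinear f \<and> (\<forall>xs::(nat \<times> 'g) list. (\<forall>(i, x)\<in>set xs. i > 0) \<longrightarrow>
      f (prod_list (map (\<lambda>(i, x). ugen (av_g (- int i) x)) xs)) = prod_list (map (\<lambda>(i, x). ugen x) xs))", OF this]
  show ?thesis unfolding omit_t_def .
qed

lemma loop_minus_eq: "uea_sub loop_minus = uea_sub {av_g (- n) x | n x. n > 0}"
  by (simp add: loop_minus_def uea_sub_span_eq)

lemma coeff_sum_omit:
  fixes P :: "'g::simple_lie_algebra affvir uea"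
  assumes "P \<in> uea_sub loop_minus"
  shows "coeff_sum (uea_act (loop_act \<alpha> \<beta> left_mult) P q) = omit_t P * coeff_sum q"
proof (rule clinear_eq_on_span[where f = "\<lambda>P. coeff_sum (uea_act (loop_act \<alpha> \<beta> left_mult) P q)"
      and g = "\<lambda>P. omit_t P * coeff_sum q"])
  show "P \<in> cvec.span {uea_word xs | xs. set xs \<subseteq> {av_g (- n) x | n x. n > 0}}"
    using assms by (intro uea_sub_words) (simp add: loop_minus_eq)
  show "clinear (\<lambda>P. coeff_sum (uea_act (loop_act \<alpha> \<beta> left_mult) P q))"
    by (rule clinear_comp[OF clinear_coeff_sum clinear_uea_act_left[OF lie_module_loop_act[OF lie_module_left_mult]]])
  show "clinear (\<lambda>P :: 'g affvir uea. omit_t P * coeff_sum q)"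
    using omit_t_spec by (intro clinear_comp[OF clinear_uea_mult_left]) blast
  fix Q :: "'g affvir uea" assume "Q \<in> {uea_word xs | xs. set xs \<subseteq> {av_g (- n) x | n x. n > 0}}"
  then obtain xs where xs: "Q = uea_word xs" "set xs \<subseteq> {av_g (- n) x | n x. n > 0}" by blast
  have "\<exists>ys. xs = map (\<lambda>(i, x). av_g (- int i) x) ys \<and> (\<forall>(i, x)\<in>set ys. i > 0)"
    using xs(2)
  proof (induction xs)
    case (Cons X xs)
    then obtain ys n x where "xs = map (\<lambda>(i, x). av_g (- int i) x) ys" "\<forall>(i, x)\<in>set ys. i > 0"
      "X = av_g (- n) x" "n > 0"
      by auto
    then show ?case by (intro exI[of _ "(nat n, x) # ys"]) simp
  qed simp
  then obtain ys where ys: "xs = map (\<lambda>(i, x). av_g (- int i) x) ys" "\<forall>(i, x)\<in>set ys. i > 0"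
    by blast
  have Q: "Q = prod_list (map (\<lambda>(i, x). ugen (av_g (- int i) x)) ys)"
    by (simp add: xs(1) ys(1) uea_word_def comp_def case_prod_unfold)
  show "coeff_sum (uea_act (loop_act \<alpha> \<beta> left_mult) Q q) = omit_t Q * coeff_sum q"
    using coeff_sum_loop_minus[OF ys(2)] omit_t_spec ys(2) unfolding Q by metis
qed

section \<open>The subalgebra of nonpositive degree\<close>

text \<open>This subalgebra is larger than \<open>av_minus\<close>: it contains all of
  \<open>g\<close> in degree 0, and \<open>d\<^sub>0\<close>. It is complemented simply by degree,
  namely by the span of \<open>positive_gens\<close>, so that no directness of the triangular
  decomposition of \<open>g\<close> has to be established.\<close>

definition nonpos_gens :: "'g::simple_lie_algebra affvir set"
  where "nonpos_gens = {av_g n x | n x. n \<le> 0} \<union> {av_d n | n. n \<le> 0}"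

lemma nonpos_gens_cases:
  assumes "X \<in> nonpos_gens"
  obtains n x where "X = av_g n x" "n \<le> 0" | n where "X = av_d n" "n \<le> 0"
  using assms by (auto simp: nonpos_gens_def)

lemma nonpos_gensI: "n \<le> 0 \<Longrightarrow> av_g n x \<in> cvec.span nonpos_gens" "n \<le> 0 \<Longrightarrow> av_d n \<in> cvec.span nonpos_gens"
  by (auto intro!: cvec.span_base simp: nonpos_gens_def)

lemma clinear_lie_left: "clinear (\<lambda>x. lie x (y::'a::lie_algebra))"
  by (simp add: clinear_iff lie_add_left lie_scale_left)

lemma nonpos_lie:
  assumes "X \<in> cvec.span nonpos_gens" "Y \<in> cvec.span nonpos_gens"
  shows "lie X Y \<in> cvec.span nonpos_gens"
proof (rule subspace_vimageD[OF clinear_lie cvec.subspace_span assms(2)])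
  fix Y' :: "'a affvir" assume Y': "Y' \<in> nonpos_gens"
  show "lie X Y' \<in> cvec.span nonpos_gens"
  proof (rule subspace_vimageD[OF clinear_lie_left cvec.subspace_span assms(1)])
    fix X' :: "'a affvir" assume "X' \<in> nonpos_gens"
    \<comment> \<open>Central terms could arise only in total degree 0; both degrees are then 0, and
      the coefficients \<open>m\<close> and \<open>m^3 - m\<close> vanish.\<close>
    have z: "m + n = 0 \<Longrightarrow> m \<le> 0 \<Longrightarrow> n \<le> 0 \<Longrightarrow> m = 0" for m n :: int by simp
    from \<open>X' \<in> nonpos_gens\<close> Y' show "lie X' Y' \<in> cvec.span nonpos_gens"
      by (elim nonpos_gens_cases)
        (auto simp: lie_generators cvec.span_scale cvec.span_neg nonpos_gensI dest: z)
  qed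
qed

definition truncate :: "(int \<Rightarrow>\<^sub>0 'b::complex_vector) \<Rightarrow> int \<Rightarrow>\<^sub>0 'b"
  where "truncate p = pm_sum (\<lambda>n x. if n \<le> 0 then Poly_Mapping.single n x else 0) p"

lemma clinear_truncate: "clinear truncate"
  unfolding truncate_def
  by (intro clinearI pm_sum_add pm_sum_scale) (simp_all add: single_add scaleC_single)

definition nonpos_proj :: "'g::simple_lie_algebra affvir \<Rightarrow> 'g affvir"
  where "nonpos_proj X = AffVir (truncate (loop X)) (truncate (vir X)) 0 0"

lemma clinear_nonpos_proj: "clinear nonpos_proj"
  by (rule clinearI)
    (simp_all add: nonpos_proj_def plus_affvir_def scaleC_affvir_def
      clinear_simps[OF clinear_truncate])

lemma nonpos_proj_simps [simp]:
  "nonpos_proj (av_g n x) = (if n \<le> 0 then av_g n x else 0)"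
  "nonpos_proj (av_d n) = (if n \<le> 0 then av_d n else 0)"
  "nonpos_proj av_k = 0" "nonpos_proj av_c = 0"
  by (simp_all add: nonpos_proj_def av_sel clinear_0[OF clinear_truncate])
    (simp_all add: truncate_def pm_sum_single av_g_def av_d_def zero_affvir_def)

lemma nonpos_proj_in: "nonpos_proj X \<in> cvec.span nonpos_gens"
  by (induction X rule: affvir_induct)
    (simp_all add: nonpos_gensI cvec.span_zero cvec.span_add cvec.span_scale
      clinear_simps[OF clinear_nonpos_proj])

lemma nonpos_proj_id: "X \<in> cvec.span nonpos_gens \<Longrightarrow> nonpos_proj X = X"
  by (erule clinear_eq_on_span[OF clinear_nonpos_proj clinear_ident, rotated])
    (auto elim: nonpos_gens_cases)

definition positive_gens :: "'g::simple_lie_algebra affvir set"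
  where "positive_gens = {av_g n x | n x. n > 0} \<union> {av_d n | n. n > 0} \<union> {av_k, av_c}"

lemma positive_gens_cases:
  assumes "X \<in> positive_gens"
  obtains n x where "X = av_g n x" "n > 0" | n where "X = av_d n" "n > 0" | "X = av_k" | "X = av_c"
  using assms by (auto simp: positive_gens_def)

lemma positive_gensI: "n > 0 \<Longrightarrow> av_g n x \<in> cvec.span positive_gens" "n > 0 \<Longrightarrow> av_d n \<in> cvec.span positive_gens"
  "av_k \<in> cvec.span positive_gens" "av_c \<in> cvec.span positive_gens"
  by (auto intro!: cvec.span_base simp: positive_gens_def)

lemma positive_lie:
  assumes "X \<in> cvec.span positive_gens" "Y \<in> cvec.span positive_gens"
  shows "lie X Y \<in> cvec.span positive_gens"
proof (rule subspace_vimageD[OF clinear_lie cvec.subspace_span assms(2)])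
  fix Y' :: "'a affvir" assume Y': "Y' \<in> positive_gens"
  show "lie X Y' \<in> cvec.span positive_gens"
  proof (rule subspace_vimageD[OF clinear_lie_left cvec.subspace_span assms(1)])
    fix X' :: "'a affvir" assume "X' \<in> positive_gens"
    from this Y' show "lie X' Y' \<in> cvec.span positive_gens"
      by (elim positive_gens_cases)
        (auto simp: lie_generators cvec.span_scale cvec.span_neg cvec.span_zero positive_gensI)
  qed
qed

lemma nonpos_proj_0_iff: "nonpos_proj X = 0 \<longleftrightarrow> X \<in> cvec.span positive_gens"
proof
  have "X - nonpos_proj X \<in> cvec.span positive_gens"
  proof (induction X rule: affvir_induct)
    case (add X Y)
    have e: "X + Y - nonpos_proj (X + Y) = (X - nonpos_proj X) + (Y - nonpos_proj Y)"
      by (simp add: clinear_add[OF clinear_nonpos_proj])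
    show ?case unfolding e using add by (rule cvec.span_add)
  next
    case (scale s X)
    then show ?case
      by (simp add: clinear_scale[OF clinear_nonpos_proj] cvec.span_scale flip: cvec.scale_right_diff_distrib)
  qed (simp_all add: positive_gensI cvec.span_zero)
  then show "nonpos_proj X = 0 \<Longrightarrow> X \<in> cvec.span positive_gens" by simp
  show "X \<in> cvec.span positive_gens \<Longrightarrow> nonpos_proj X = 0"
    by (erule clinear_eq_on_span[OF clinear_nonpos_proj clinear_const0, rotated])
      (auto elim: positive_gens_cases)
qed

text \<open>A type of its own, because the enveloping algebra of a Lie algebra is formed from its
  type.\<close>

typedef (overloaded) 'g av_nonpos = "cvec.span nonpos_gens :: 'g::simple_lie_algebra affvir set"
  morphisms nonpos_emb Abs_nonpos
  using cvec.span_zero by blast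

setup_lifting type_definition_av_nonpos

instantiation av_nonpos :: (simple_lie_algebra) lie_algebra
begin

lift_definition zero_av_nonpos :: "'a av_nonpos" is 0 by (rule cvec.span_zero)
lift_definition plus_av_nonpos :: "'a av_nonpos \<Rightarrow> 'a av_nonpos \<Rightarrow> 'a av_nonpos" is "(+)" by (rule cvec.span_add)
lift_definition minus_av_nonpos :: "'a av_nonpos \<Rightarrow> 'a av_nonpos \<Rightarrow> 'a av_nonpos" is "(-)" by (rule cvec.span_diff)
lift_definition uminus_av_nonpos :: "'a av_nonpos \<Rightarrow> 'a av_nonpos" is "uminus" by (rule cvec.span_neg)
lift_definition scaleC_av_nonpos :: "complex \<Rightarrow> 'a av_nonpos \<Rightarrow> 'a av_nonpos" is "scaleC" by (rule cvec.span_scale)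
lift_definition lie_av_nonpos :: "'a av_nonpos \<Rightarrow> 'a av_nonpos \<Rightarrow> 'a av_nonpos" is "lie" by (rule nonpos_lie)

instance
  by standard (transfer, simp add: algebra_simps scaleC_add_right scaleC_add_left scaleC_scaleC scaleC_one
    lie_add_left lie_add_right lie_scale_left lie_scale_right lie_self lie_jacobi[unfolded add.assoc])+

end

interpretation nonpos: complemented_subalgebra nonpos_emb
  "\<lambda>X :: 'g::simple_lie_algebra affvir. Abs_nonpos (nonpos_proj X)"
proof (rule complemented_subalgebra.intro)
  have emb: "nonpos_emb (Abs_nonpos (nonpos_proj X)) = nonpos_proj X" for X :: "'g affvir"
    by (simp add: Abs_nonpos_inverse nonpos_proj_in)
  show "clinear (nonpos_emb :: 'g av_nonpos \<Rightarrow> _)"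
    by (rule clinearI; transfer) simp_all
  show "clinear (\<lambda>X :: 'g affvir. Abs_nonpos (nonpos_proj X))"
    by (rule clinearI; rule nonpos_emb_inject[THEN iffD1])
      (simp_all add: emb plus_av_nonpos.rep_eq scaleC_av_nonpos.rep_eq
        Abs_nonpos_inverse cvec.span_add cvec.span_scale nonpos_proj_in clinear_simps[OF clinear_nonpos_proj])
  show "nonpos_emb (lie x y) = lie (nonpos_emb x) (nonpos_emb y)" for x y :: "'g av_nonpos"
    by (rule lie_av_nonpos.rep_eq)
  show "Abs_nonpos (nonpos_proj (nonpos_emb x)) = x" for x :: "'g av_nonpos"
    using nonpos_emb[of x] by (simp add: nonpos_proj_id nonpos_emb_inverse)
  have z: "Abs_nonpos (nonpos_proj X) = 0 \<longleftrightarrow> X \<in> cvec.span positive_gens" for X :: "'g affvir"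
    unfolding nonpos_proj_0_iff[symmetric] nonpos_emb_inject[symmetric] emb zero_av_nonpos.rep_eq ..
  show "Abs_nonpos (nonpos_proj X) = 0 \<Longrightarrow> Abs_nonpos (nonpos_proj Y) = 0 \<Longrightarrow>
      Abs_nonpos (nonpos_proj (lie X Y)) = 0" for X Y :: "'g affvir"
    unfolding z by (rule positive_lie)
qed

text \<open>On the enveloping algebra of the nonpositive part, \<open>f P\<close> is
  \<open>P\<close> applied to \<open>w\<close>. Thus any module over this part alone yields a linear
  map on the full enveloping algebra with known behaviour under left multiplication by it.\<close>

lemma extend_nonpos_module:
  fixes \<nu> :: "'g::simple_lie_algebra affvir \<Rightarrow> 'n::complex_vector \<Rightarrow> 'n"
  assumes "\<And>X. clinear (\<nu> X)" "\<And>w. clinear (\<lambda>X. \<nu> X w)"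
    "\<And>X Y w. X \<in> cvec.span nonpos_gens \<Longrightarrow> Y \<in> cvec.span nonpos_gens \<Longrightarrow>
      \<nu> (lie X Y) w = \<nu> X (\<nu> Y w) - \<nu> Y (\<nu> X w)"
  shows "\<exists>f. clinear f \<and> f 1 = w \<and> (\<forall>X P. X \<in> cvec.span nonpos_gens \<longrightarrow> f (ugen X * P) = \<nu> X (f P))"
proof -
  have "lie_module (\<lambda>z. \<nu> (nonpos_emb z))"
    by (rule lie_moduleI[OF assms(1) clinear_comp[OF assms(2) nonpos.\<iota>]])
      (simp add: lie_av_nonpos.rep_eq assms(3) nonpos_emb)
  from nonpos.extend_module[OF this, of w] obtain f where
    f: "clinear f" "f 1 = w" "\<And>z P. f (ugen (nonpos_emb z) * P) = \<nu> (nonpos_emb z) (f P)"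
    by (metis (no_types, lifting))
  then show ?thesis
    by (intro exI[of _ f]) (metis Abs_nonpos_inverse)
qed

section \<open>The map \<open>\<phi>\<^sub>n\<close>\<close>

definition right_mult :: "'g::simple_lie_algebra \<Rightarrow> (int \<Rightarrow>\<^sub>0 'g uea) \<Rightarrow> int \<Rightarrow>\<^sub>0 'g uea"
  where "right_mult z p = pm_sum (\<lambda>s u. Poly_Mapping.single s (u * ugen z)) p"

lemma clinear_right_mult: "clinear (right_mult z)"
  unfolding right_mult_def
  by (intro clinearI pm_sum_add pm_sum_scale) (simp_all add: single_add distrib_right uea_scale_mult scaleC_single)

lemma right_mult_single [simp]:
  "right_mult z (Poly_Mapping.single s u) = Poly_Mapping.single s (u * ugen z)"
  by (simp add: right_mult_def pm_sum_single)

lemma clinear_right_mult_left: "clinear (\<lambda>z. right_mult z p)"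
proof (induction p rule: pm_induct)
  case (single i x)
  then show ?case by (simp add: clinear_iff ugen_add ugen_scale distrib_left uea_scale_mult single_add scaleC_single)
next
  case (add p q)
  then show ?case by (simp add: clinear_add[OF clinear_right_mult] clinear_plus)
qed

lemma right_mult_lie: "right_mult (lie x y) p = right_mult y (right_mult x p) - right_mult x (right_mult y p)"
  by (rule clinear_eq_pm[OF clinear_right_mult clinear_minus[OF clinear_comp[OF clinear_right_mult clinear_right_mult]
          clinear_comp[OF clinear_right_mult clinear_right_mult]]])
    (simp add: ugen_lie right_diff_distrib mult.assoc single_diff)

lemma right_mult_loop_act:
  "right_mult z (loop_act \<alpha> \<beta> left_mult X p) = loop_act \<alpha> \<beta> left_mult X (right_mult z p)"
proof (rule clinear_eq_pm[OF clinear_comp[OF clinear_right_mult clinear_loop_act] clinear_comp[OF clinear_loop_act clinear_right_mult]])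
  note left = clinear_loop_act_left[OF lie_module_left_mult]
  show "right_mult z (loop_act \<alpha> \<beta> left_mult X (Poly_Mapping.single s u)) =
      loop_act \<alpha> \<beta> left_mult X (right_mult z (Poly_Mapping.single s u))" for s u
    by (induction X rule: affvir_induct)
      (simp_all add: lie_module_left_mult mult.assoc uea_scale_mult clinear_simps[OF clinear_right_mult]
        clinear_simps[OF left])
qed (rule lie_module_left_mult)+

text \<open>The values \<open>\<phi>\<^sub>n(P \<otimes> v)\<close> are obtained from an element of \<open>M \<otimes> U(g)[t, t\<^sup>-\<^sup>1]\<close>:
  the elements of negative degree act by the density module on the second factor, while \<open>g\<close>
  acts on \<open>U(g)\<close> by commutators.\<close>

context
  fixes \<rho> :: "'g::simple_lie_algebra affvir \<Rightarrow> 'm::complex_vector \<Rightarrow> 'm" and \<alpha> \<beta> :: complex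
  assumes \<rho>: "lie_module \<rho>"
begin

definition twist :: "'g \<Rightarrow> ('m, int \<Rightarrow>\<^sub>0 'g uea) tensor \<Rightarrow> ('m, int \<Rightarrow>\<^sub>0 'g uea) tensor"
  where "twist z N = tmap (\<rho> (av_g 0 z)) (\<lambda>q. q) N - tmap (\<lambda>w. w) (right_mult z) N"

definition shifted :: "'g affvir \<Rightarrow> ('m, int \<Rightarrow>\<^sub>0 'g uea) tensor \<Rightarrow> ('m, int \<Rightarrow>\<^sub>0 'g uea) tensor"
  where "shifted X = tmap (\<lambda>w. w) (loop_act \<alpha> \<beta> left_mult X)"

text \<open>The sum of two commuting actions: \<open>shifted\<close> concerns only the second
  factor, and \<open>twist\<close> is an action of \<open>g\<close> pulled back along the degree 0
  coefficient. In degree 0 the left multiplication in \<open>shifted\<close> and the right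
  multiplication in \<open>twist\<close> cancel on \<open>1\<close>; so an element of
  \<open>n_minus\<close> acts on \<open>w \<otimes> t^s\<close> through \<open>w\<close> alone, as
  the factor \<open>z\<close> in the definition of \<open>phi\<close> requires.\<close>

definition phi_act :: "'g affvir \<Rightarrow> ('m, int \<Rightarrow>\<^sub>0 'g uea) tensor \<Rightarrow> ('m, int \<Rightarrow>\<^sub>0 'g uea) tensor"
  where "phi_act X N = shifted X N + twist (Poly_Mapping.lookup (loop X) 0) N"

lemmas [simp] = lie_moduleD(1)[OF \<rho>] clinear_ident clinear_right_mult clinear_loop_act lie_module_left_mult tmap_tensor

lemma clinear_twist: "clinear (twist z)"
  unfolding twist_def by (intro clinear_minus clinear_tmap) simp_all

lemma clinear_shifted: "clinear (shifted X)"
  unfolding shifted_def by (intro clinear_tmap) simp_all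

lemma twist_tensor [simp]: "twist z (w \<otimes> q) = \<rho> (av_g 0 z) w \<otimes> q - w \<otimes> right_mult z q"
  by (simp add: twist_def)

lemma shifted_tensor [simp]: "shifted X (w \<otimes> q) = w \<otimes> loop_act \<alpha> \<beta> left_mult X q"
  by (simp add: shifted_def)

lemma clinear_twist_left: "clinear (\<lambda>z. twist z N)"
proof (induction N rule: tensor_induct)
  case (tensor w q)
  show ?case
    by (simp add: clinear_minus clinear_comp[OF clinear_tensor_left clinear_comp[OF lie_moduleD(2)[OF \<rho>] clinear_av_g]]
        clinear_comp[OF clinear_tensor_right clinear_right_mult_left])
qed (simp add: clinear_add[OF clinear_twist] clinear_plus)

lemma clinear_shifted_left: "clinear (\<lambda>X. shifted X N)"
proof (induction N rule: tensor_induct)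
  case (tensor w q)
  show ?case
    by (simp add: clinear_comp[OF clinear_tensor_right clinear_loop_act_left])
qed (simp add: clinear_add[OF clinear_shifted] clinear_plus)

lemma clinear_phi_act: "clinear (phi_act X)"
  unfolding phi_act_def by (intro clinear_plus clinear_twist clinear_shifted)

lemma clinear_phi_act_left: "clinear (\<lambda>X. phi_act X N)"
proof -
  have "clinear (\<lambda>X :: 'g affvir. Poly_Mapping.lookup (loop X) 0)"
    by (simp add: clinear_iff lookup_add lookup_scaleC)
  then show ?thesis
    unfolding phi_act_def by (intro clinear_plus clinear_shifted_left clinear_comp[OF clinear_twist_left])
qed

lemma twist_lie: "twist (lie x y) N = twist x (twist y N) - twist y (twist x N)"
  by (rule clinear_eq_tensor[OF clinear_twist clinear_minus[OF clinear_comp[OF clinear_twist clinear_twist]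
          clinear_comp[OF clinear_twist clinear_twist]]])
    (use lie_moduleD(3)[OF \<rho>, of "av_g 0 x" "av_g 0 y"] in
      \<open>simp add: lie_generators right_mult_lie clinear_diff[OF clinear_twist] tensor_diff_left tensor_diff_right\<close>)

lemma shifted_lie: "shifted (lie X Y) N = shifted X (shifted Y N) - shifted Y (shifted X N)"
  by (rule clinear_eq_tensor[OF clinear_shifted clinear_minus[OF clinear_comp[OF clinear_shifted clinear_shifted]
          clinear_comp[OF clinear_shifted clinear_shifted]]])
    (simp add: lie_moduleD(3)[OF lie_module_loop_act] tensor_diff_right)

lemma twist_shifted: "twist z (shifted X N) = shifted X (twist z N)"
  by (rule clinear_eq_tensor[OF clinear_comp[OF clinear_twist clinear_shifted] clinear_comp[OF clinear_shifted clinear_twist]])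
    (simp add: right_mult_loop_act clinear_diff[OF clinear_shifted])

text \<open>Among nonpositive degrees only a bracket of two elements of degree 0 reaches degree 0,
  so taking this coefficient is a homomorphism onto \<open>g\<close>.\<close>

lemma lookup_loop_lie:
  fixes X Y :: "'g affvir"
  assumes "X \<in> cvec.span nonpos_gens" "Y \<in> cvec.span nonpos_gens"
  shows "Poly_Mapping.lookup (loop (lie X Y)) 0 =
    lie (Poly_Mapping.lookup (loop X) 0) (Poly_Mapping.lookup (loop Y) (0::int))"
proof -
  have l: "clinear (\<lambda>X :: 'g affvir. Poly_Mapping.lookup (loop X) 0)"
    by (simp add: clinear_iff lookup_add lookup_scaleC)
  have z: "m + n = 0 \<Longrightarrow> m \<le> 0 \<Longrightarrow> n \<le> 0 \<Longrightarrow> m = 0 \<and> n = 0" for m n :: int by auto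
  show ?thesis
  proof (rule clinear_eq_on_span[OF clinear_comp[OF l clinear_lie] clinear_comp[OF clinear_lie l] _ assms(2)])
    fix Y' :: "'g affvir" assume Y': "Y' \<in> nonpos_gens"
    show "Poly_Mapping.lookup (loop (lie X Y')) 0 =
        lie (Poly_Mapping.lookup (loop X) 0) (Poly_Mapping.lookup (loop Y') 0)"
    proof (rule clinear_eq_on_span[OF clinear_comp[OF l clinear_lie_left] clinear_comp[OF clinear_lie_left l] _ assms(1)])
      fix X' :: "'g affvir" assume "X' \<in> nonpos_gens"
      from this Y' show "Poly_Mapping.lookup (loop (lie X' Y')) 0 =
          lie (Poly_Mapping.lookup (loop X') 0) (Poly_Mapping.lookup (loop Y') 0)"
        by (elim nonpos_gens_cases)
          (auto simp: lie_generators av_sel lookup_single lookup_scaleC lookup_add when_def dest: z)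
    qed
  qed
qed

lemma phi_act_lie:
  assumes "X \<in> cvec.span nonpos_gens" "Y \<in> cvec.span nonpos_gens"
  shows "phi_act (lie X Y) N = phi_act X (phi_act Y N) - phi_act Y (phi_act X N)"
  by (simp add: phi_act_def lookup_loop_lie[OF assms] shifted_lie twist_lie clinear_add[OF clinear_shifted]
      clinear_add[OF clinear_twist] twist_shifted)

lemma phi_act_gens:
  "i > 0 \<Longrightarrow> phi_act (av_g (- i) x) N = shifted (av_g (- i) x) N"
  "phi_act (av_d i) N = shifted (av_d i) N"
  "phi_act (av_g 0 z) (w \<otimes> Poly_Mapping.single s 1) = \<rho> (av_g 0 z) w \<otimes> Poly_Mapping.single s 1"
  by (simp_all add: phi_act_def av_sel lookup_single clinear_0[OF clinear_twist_left])

lemmas [simp del] = lie_moduleD(1)[OF \<rho>] clinear_ident clinear_right_mult clinear_loop_act lie_module_left_mult tmap_tensor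

end


definition embed_const :: "(int \<Rightarrow>\<^sub>0 complex) \<Rightarrow> int \<Rightarrow>\<^sub>0 'g::simple_lie_algebra uea"
  where "embed_const r = pm_sum (\<lambda>s c. Poly_Mapping.single s (c *\<^sub>C 1)) r"

lemma clinear_embed_const: "clinear embed_const"
  unfolding embed_const_def
  by (intro clinearI pm_sum_add pm_sum_scale)
    (simp_all add: single_add scaleC_add_left scaleC_single scaleC_scaleC scaleC_complex_def)

lemma embed_const_single [simp]: "embed_const (Poly_Mapping.single s c) = Poly_Mapping.single s (c *\<^sub>C 1)"
  by (simp add: embed_const_def pm_sum_single)

lemma coeff_sum_embed_const: "coeff_sum (embed_const r) = coeff_sum r *\<^sub>C 1"
  by (rule clinear_eq_pm[OF clinear_comp[OF clinear_coeff_sum clinear_embed_const]])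
    (simp_all add: clinear_iff clinear_simps[OF clinear_coeff_sum]
      scaleC_add_left scaleC_scaleC scaleC_complex_def)

text \<open>The constants \<open>c *\<^sub>C 1\<close> embed the loop module of the trivial module
  into that of \<open>U(g)\<close>. The embedding respects the \<open>d\<^sub>m\<close>, which act
  by the same scalars on both sides.\<close>

lemma coeff_sum_psi:
  fixes y :: "'g::simple_lie_algebra affvir uea"
  assumes y: "y \<in> uea_sub vir_minus"
  shows "coeff_sum (uea_act (loop_act (- a) (1 - b) left_mult) y (Poly_Mapping.single (- n) 1)) =
    psi a b n y *\<^sub>C (1 :: 'g uea)"
proof -
  let ?L = "loop_act (- a) (1 - b) (left_mult :: 'g \<Rightarrow> _)" and ?D = "loop_act (- a) (1 - b) (trivial_act :: 'g \<Rightarrow> _)"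
  note L = lie_module_loop_act[OF lie_module_left_mult, where \<alpha> = "- a" and \<beta> = "1 - b"]
  note D = lie_module_loop_act[OF lie_module_trivial, where \<alpha> = "- a" and \<beta> = "1 - b"]
  have 1: "?L (av_d m) (embed_const r) = embed_const (?D (av_d m) r)" for m r
    by (rule clinear_eq_pm[OF clinear_comp[OF lie_moduleD(1)[OF L] clinear_embed_const]
          clinear_comp[OF clinear_embed_const lie_moduleD(1)[OF D]]])
      (simp add: lie_module_left_mult lie_module_trivial scaleC_scaleC scaleC_complex_def)
  have "y \<in> uea_sub {av_d (- n) | n. n > 0}"
    using y by (simp add: vir_minus_def uea_sub_span_eq)
  then have "uea_act ?L y (embed_const r) = embed_const (uea_act ?D y r)" for r
  proof (induction arbitrary: r rule: uea_sub.induct)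
    case (gen x)
    then show ?case by (auto simp: uea_act_gen[OF L] uea_act_gen[OF D] 1)
  qed (simp_all add: uea_act_1[OF L] uea_act_1[OF D] uea_act_mult[OF L] uea_act_mult[OF D]
      clinear_simps[OF clinear_uea_act_left[OF L]] clinear_simps[OF clinear_uea_act_left[OF D]]
        clinear_simps[OF clinear_embed_const])
  from this[of "Poly_Mapping.single (- n) 1"] show ?thesis
    by (simp add: scaleC_one coeff_sum_embed_const psi_eq[OF y] psi_fun_def)
qed

text \<open>Products of generators of negative degree, in any order, with an element of
  \<open>U(n_minus)\<close> on the right. The degree is recorded because
  \<open>d\<^sub>-\<^sub>i\<close> acts under \<open>\<phi>\<^sub>n\<close> by a scalar that depends
  on it. These elements span \<open>U(L(g)\<^sub>-)\<close>, which permits induction by one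
  generator at a time.\<close>

inductive lowering :: "'g::simple_lie_algebra affvir uea \<Rightarrow> int \<Rightarrow> bool" where
  base: "z \<in> uea_sub (av_g 0 ` n_minus) \<Longrightarrow> lowering z 0"
| g: "lowering P p \<Longrightarrow> i > 0 \<Longrightarrow> lowering (ugen (av_g (- i) x) * P) (p - i)"
| d: "lowering P p \<Longrightarrow> i > 0 \<Longrightarrow> lowering (ugen (av_d (- i)) * P) (p - i)"

definition phi_out :: "('g \<Rightarrow> 'v::complex_vector \<Rightarrow> 'v) \<Rightarrow> 'v \<Rightarrow>
    ('m::complex_vector, int \<Rightarrow>\<^sub>0 'g::simple_lie_algebra uea) tensor \<Rightarrow> ('m, 'v) tensor"
  where "phi_out \<sigma> v = tmap (\<lambda>w. w) (\<lambda>q. uea_circ \<sigma> (coeff_sum q) v)"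

context
  fixes \<sigma> :: "'g::simple_lie_algebra \<Rightarrow> 'v::complex_vector \<Rightarrow> 'v"
  assumes \<sigma>: "lie_module \<sigma>"
begin

lemma phi_out_tensor [simp]: "phi_out \<sigma> v (w \<otimes> q) = w \<otimes> uea_circ \<sigma> (coeff_sum q) v"
  unfolding phi_out_def
  by (rule tmap_tensor[OF clinear_ident clinear_comp[OF clinear_uea_circ_left[OF \<sigma>] clinear_coeff_sum]])

lemma clinear_phi_out: "clinear (phi_out \<sigma> v)"
  unfolding phi_out_def
  by (rule clinear_tmap[OF clinear_ident clinear_comp[OF clinear_uea_circ_left[OF \<sigma>] clinear_coeff_sum]])

lemma clinear_phi_out_left: "clinear (\<lambda>v. phi_out \<sigma> v N)"
proof (induction N rule: tensor_induct)
  case (tensor w q)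
  show ?case by (simp add: clinear_comp[OF clinear_tensor_right clinear_uea_circ[OF \<sigma>]])
qed (simp add: clinear_add[OF clinear_phi_out] clinear_plus)

end

text \<open>\<open>f P\<close> is \<open>P\<close> applied to \<open>ubar \<otimes> t^(-n)\<close>,
  and \<open>phi_out\<close> evaluates the second factor on \<open>v\<close>. The last two
  properties are the ones used later: they describe left multiplication by a single generator
  without bringing the product into the order \<open>x y z\<close>.\<close>

theorem phi_exists:
  fixes \<rho> :: "'g::simple_lie_algebra affvir \<Rightarrow> 'm::complex_vector \<Rightarrow> 'm"
    and \<sigma> :: "'g \<Rightarrow> 'v::complex_vector \<Rightarrow> 'v"
  assumes \<rho>: "lie_module \<rho>" and \<sigma>: "lie_module \<sigma>"
  obtains F where "bilin F"
    "\<And>x y z v. x \<in> uea_sub loop_minus \<Longrightarrow> y \<in> uea_sub vir_minus \<Longrightarrow> z \<in> uea_sub (av_g 0 ` n_minus) \<Longrightarrow>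
      F (x * y * z) v = psi a b n y *\<^sub>C (uea_act \<rho> z ubar \<otimes> uea_circ \<sigma> (omit_t x) v)"
    "\<And>i x P v. i > 0 \<Longrightarrow> F (ugen (av_g (- i) x) * P) v = - F P (\<sigma> x v)"
    "\<And>i P p v. i > 0 \<Longrightarrow> lowering P p \<Longrightarrow>
      F (ugen (av_d (- i)) * P) v = (of_int p - a - of_int n - of_int i + b * of_int i) *\<^sub>C F P v"
proof -
  let ?L = "loop_act (- a) (1 - b) (left_mult :: 'g \<Rightarrow> _)"
  let ?T = "phi_act \<rho> (- a) (1 - b)" and ?S = "shifted (- a) (1 - b) :: 'g affvir \<Rightarrow> ('m, _) tensor \<Rightarrow> _"
  let ?t = "Poly_Mapping.single (- n) 1 :: int \<Rightarrow>\<^sub>0 'g uea"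
  note L = lie_module_loop_act[OF lie_module_left_mult, where 'g = 'g and \<alpha> = "- a" and \<beta> = "1 - b"]
  note act = phi_act_gens[OF \<rho>, where \<alpha> = "- a" and \<beta> = "1 - b"]
    shifted_tensor[OF \<rho>, where \<alpha> = "- a" and \<beta> = "1 - b"]
  obtain f where f: "clinear f" "f 1 = ubar \<otimes> ?t"
      "\<And>X P. X \<in> cvec.span nonpos_gens \<Longrightarrow> f (ugen X * P) = ?T X (f P)"
    using extend_nonpos_module[where \<nu> = ?T and w = "ubar \<otimes> ?t", OF clinear_phi_act[OF \<rho>]
          clinear_phi_act_left[OF \<rho>] phi_act_lie[OF \<rho>]] by auto
  have f_g: "f (ugen (av_g (- i) x) * P) = ?S (av_g (- i) x) (f P)" if "i > 0" for i x P
    using that by (simp add: f(3) nonpos_gensI act)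
  have f_d: "f (ugen (av_d (- i)) * P) = ?S (av_d (- i)) (f P)" if "i > 0" for i P
    using that by (simp add: f(3) nonpos_gensI act)
  have f_n: "f (ugen (av_g 0 z) * P) = \<rho> (av_g 0 z) w \<otimes> ?t" if "f P = w \<otimes> ?t" for z P w
    using that by (simp add: f(3) nonpos_gensI act)
  have nm: "f (z * Q) = uea_act \<rho> z w \<otimes> ?t"
    if "z \<in> uea_sub (av_g 0 ` n_minus)" "f Q = w \<otimes> ?t" for z Q w
    using that
  proof (induction arbitrary: Q w rule: uea_sub.induct)
    case (gen X)
    then show ?case by (auto simp: f_n uea_act_gen[OF \<rho>])
  next
    case (mult P P')
    then show ?case by (simp add: mult.assoc uea_act_mult[OF \<rho>])
  qed (simp_all add: uea_act_1[OF \<rho>] distrib_right uea_scale_mult clinear_simps[OF f(1)]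
    clinear_simps[OF clinear_uea_act_left[OF \<rho>]]
      tensor_add_left tensor_scale_left)
  have sub: "f (P * Q) = w \<otimes> uea_act ?L P q"
    if "P \<in> uea_sub A" "A \<subseteq> {av_g (- n) x | n x. n > 0} \<union> {av_d (- n) | n. n > 0}" "f Q = w \<otimes> q" for P Q w q A
    using that(1,3)
  proof (induction arbitrary: Q q rule: uea_sub.induct)
    case (gen X)
    then show ?case using that(2) by (auto simp: f_g f_d uea_act_gen[OF L] act)
  next
    case (mult P P')
    then show ?case by (simp add: mult.assoc uea_act_mult[OF L])
  qed (simp_all add: uea_act_1[OF L] distrib_right uea_scale_mult clinear_simps[OF f(1)]
    clinear_simps[OF clinear_uea_act_left[OF L]]
      tensor_add_right tensor_scale_right)
  let ?F = "\<lambda>P v. phi_out \<sigma> v (f P)"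
  show ?thesis
  proof (rule that[of ?F])
    show "bilin ?F"
      by (intro bilinI clinear_phi_out_left[OF \<sigma>] clinear_comp[OF clinear_phi_out[OF \<sigma>] f(1)])
    show "?F (x * y * z) v = psi a b n y *\<^sub>C (uea_act \<rho> z ubar \<otimes> uea_circ \<sigma> (omit_t x) v)"
      if "x \<in> uea_sub loop_minus" and y: "y \<in> uea_sub vir_minus" and "z \<in> uea_sub (av_g 0 ` n_minus)" for x y z v
    proof -
      have "f (z * 1) = uea_act \<rho> z ubar \<otimes> ?t"
        by (rule nm[OF that(3) f(2)])
      then have "f (y * z) = uea_act \<rho> z ubar \<otimes> uea_act ?L y ?t"
        using y by (intro sub[where A = "{av_d (- n) | n. n > 0}"]) (auto simp: vir_minus_def uea_sub_span_eq)
      then have "f (x * (y * z)) = uea_act \<rho> z ubar \<otimes> uea_act ?L x (uea_act ?L y ?t)"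
        by (rule sub[OF that(1)[unfolded loop_minus_eq] Un_upper1])
      then show ?thesis
        by (simp add: mult.assoc phi_out_tensor[OF \<sigma>] coeff_sum_omit[OF that(1)] coeff_sum_psi[OF y]
            uea_scale_mult clinear_scale[OF clinear_uea_circ_left[OF \<sigma>]] tensor_scale_right)
    qed
    show "?F (ugen (av_g (- i) x) * P) v = - ?F P (\<sigma> x v)" if "i > 0" for i x P v
    proof -
      have "phi_out \<sigma> v (?S (av_g (- i) x) N) = - phi_out \<sigma> (\<sigma> x v) N" for N
        by (rule clinear_eq_tensor[where f = "\<lambda>N. phi_out \<sigma> v (?S (av_g (- i) x) N)"
              and g = "\<lambda>N. - phi_out \<sigma> (\<sigma> x v) N"])
          (simp_all add: clinear_comp[OF clinear_phi_out[OF \<sigma>] clinear_shifted[OF \<rho>]] act phi_out_tensor[OF \<sigma>]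
            coeff_sum_loop_act[OF that] uea_circ_mult[OF \<sigma>] uea_circ_gen[OF \<sigma>] tensor_neg_right
            clinear_neg[OF clinear_uea_circ[OF \<sigma>]] clinear_iff clinear_simps[OF clinear_phi_out[OF \<sigma>]])
      then show ?thesis by (simp add: f_g that)
    qed
    show "?F (ugen (av_d (- i)) * P) v = (of_int p - a - of_int n - of_int i + b * of_int i) *\<^sub>C ?F P v"
      if i: "i > 0" and P: "lowering P p" for i P p v
    proof -
      \<comment> \<open>A product of degree \<open>p\<close> moves the initial exponent
        \<open>- n\<close> to \<open>p - n\<close>, so the next \<open>d\<^sub>-\<^sub>i\<close>
        acts by a single scalar.\<close>
      have "\<exists>w u. f P = w \<otimes> Poly_Mapping.single (p - n) u"
        using P
      proof induction
        case (base z)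
        show ?case using nm[OF base f(2)] by auto
      next
        case (g P p i x)
        then obtain w u where "f P = w \<otimes> Poly_Mapping.single (p - n) u" by blast
        then have "f (ugen (av_g (- i) x) * P) = w \<otimes> Poly_Mapping.single (p - i - n) (ugen x * u)"
          using g.hyps(2) by (simp add: f_g act lie_module_left_mult algebra_simps)
        then show ?case by blast
      next
        case (d P p i)
        then obtain w u where "f P = w \<otimes> Poly_Mapping.single (p - n) u" by blast
        then have "\<exists>u. f (ugen (av_d (- i)) * P) = w \<otimes> Poly_Mapping.single (p - i - n) u"
          using d.hyps(2) by (auto simp: f_d act lie_module_left_mult algebra_simps)
        then show ?case by blast
      qed
      then obtain w u where wu: "f P = w \<otimes> Poly_Mapping.single (p - n) u" by blast
      have "- a + (1 - b) * of_int (- i) + of_int (p - n) = of_int p - a - of_int n - of_int i + b * of_int i"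
        by (simp add: algebra_simps)
      then show ?thesis
        using i by (simp add: wu f_d act phi_out_tensor[OF \<sigma>] lie_module_left_mult
            clinear_scale[OF clinear_uea_circ_left[OF \<sigma>]] tensor_scale_right)
    qed
  qed
qed

section \<open>The triangular decomposition\<close>

text \<open>If \<open>v\<close> is written as a sum of eigenvectors of \<open>T\<close> and the
  terms are grouped by eigenvalue, each group lies in the invariant subspace \<open>E\<close> by
  \<open>eigen_components\<close>.\<close>

lemma diagonalizable_invariant:
  fixes T :: "'a::complex_vector \<Rightarrow> 'a"
  assumes T: "clinear T" "cvec.span {x. \<exists>e. T x = e *\<^sub>C x} = UNIV"
    and E: "cvec.subspace E" "\<And>x. x \<in> E \<Longrightarrow> T x \<in> E" and v: "v \<in> E"
  shows "v \<in> cvec.span {x \<in> E. \<exists>e. T x = e *\<^sub>C x}"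
proof -
  have "v \<in> cvec.span {x. \<exists>e. T x = e *\<^sub>C x}" using T(2) by simp
  then obtain F r where F: "finite F" "F \<subseteq> {x. \<exists>e. T x = e *\<^sub>C x}" "v = (\<Sum>x\<in>F. r x *\<^sub>C x)"
    unfolding cvec.span_explicit by blast
  have "\<forall>x\<in>F. \<exists>e. T x = e *\<^sub>C x" using F(2) by blast
  from bchoice[OF this] obtain ev where ev: "\<And>x. x \<in> F \<Longrightarrow> T x = ev x *\<^sub>C x" by blast
  define g where "g e = (\<Sum>x\<in>{x \<in> F. ev x = e}. r x *\<^sub>C x)" for e
  have v_eq: "v = (\<Sum>e\<in>ev ` F. g e)"
    unfolding F(3) g_def by (rule sum.image_gen[OF F(1)])
  have Tg: "T (g e) = e *\<^sub>C g e" for e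
    unfolding g_def clinear_sum[OF T(1)] cvec.scale_sum_right
    by (rule sum.cong) (auto simp: clinear_scale[OF T(1)] ev scaleC_scaleC mult.commute)
  have "g e \<in> E" if "e \<in> ev ` F" for e
    by (rule eigen_components[where F = "ev ` F" and D = T and e = "\<lambda>e. e"])
      (use F(1) T(1) E Tg v v_eq that in auto)
  then show ?thesis
    unfolding v_eq by (intro cvec.span_sum cvec.span_base) (use Tg in auto)
qed

context
  fixes H :: "'g::lie_algebra set"
  assumes H: "cartan_subalgebra H" and fin: "\<exists>B :: 'g set. finite B \<and> cvec.span B = UNIV"
begin

text \<open>As \<open>H\<close> is abelian, a further \<open>h\<close> preserves each joint
  eigenspace of \<open>F\<close>, and it stays diagonalizable there.\<close>

lemma joint_eigenvectors:
  assumes "finite F" "F \<subseteq> H"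
  shows "cvec.span {x. \<forall>h\<in>F. \<exists>e. lie h x = e *\<^sub>C x} = (UNIV :: 'g set)"
  using assms
proof (induction F)
  case empty
  then show ?case using cvec.span_UNIV by simp
next
  case (insert h F)
  let ?S = "{x. \<forall>h\<in>insert h F. \<exists>e. lie h x = e *\<^sub>C x}"
  have "v \<in> cvec.span ?S" if v: "\<forall>h\<in>F. \<exists>e. lie h v = e *\<^sub>C v" for v
  proof -
    obtain e where e: "\<And>h. h \<in> F \<Longrightarrow> lie h v = e h *\<^sub>C v"
      using v by metis
    let ?E = "{x. \<forall>h\<in>F. lie h x = e h *\<^sub>C x}"
    have "v \<in> cvec.span {x \<in> ?E. \<exists>e. lie h x = e *\<^sub>C x}"
    proof (rule diagonalizable_invariant[OF clinear_lie])
      show "cvec.span {x. \<exists>e. lie h x = e *\<^sub>C x} = UNIV"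
        using H insert.prems by (simp add: cartan_subalgebra_def cspan_eq)
      show "cvec.subspace ?E"
        by (auto simp: cvec.subspace_def lie_add_right lie_scale_right scaleC_add_right scaleC_scaleC mult.commute)
      show "lie h x \<in> ?E" if "x \<in> ?E" for x
      proof safe
        fix h' assume h': "h' \<in> F"
        then have "lie h' h = 0" using H insert.prems by (auto simp: cartan_subalgebra_def)
        then show "lie h' (lie h x) = e h' *\<^sub>C lie h x"
          using lie_jacobi'[of h' h x] that h' by (simp add: lie_scale_right)
      qed
      show "v \<in> ?E" using e by simp
    qed
    then show ?thesis by (rule cvec.span_mono[THEN subsetD, rotated]) auto
  qed
  then have "cvec.span {x. \<forall>h\<in>F. \<exists>e. lie h x = e *\<^sub>C x} \<subseteq> cvec.span ?S"
    by (intro cvec.span_minimal cvec.subspace_span) auto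
  with insert show ?case by auto
qed

definition weight_vectors :: "'g set"
  where "weight_vectors = (\<Union>\<alpha>\<in>dual_of H. root_space H \<alpha>)"

lemma joint_eigenvector_weight:
  assumes x: "\<forall>h\<in>H. \<exists>e. lie h x = e *\<^sub>C x"
  shows "x \<in> weight_vectors"
proof (cases "x = 0")
  case True
  have "(\<lambda>_. 0) \<in> dual_of H" "0 \<in> root_space H (\<lambda>_. 0)"
    by (simp_all add: root_space_def dual_of_def)
  with True show ?thesis unfolding weight_vectors_def by blast
next
  case False
  obtain e where e: "\<And>h. h \<in> H \<Longrightarrow> lie h x = e h *\<^sub>C x"
    using x by metis
  \<comment> \<open>By convention the members of \<open>dual_of H\<close> vanish outside
    \<open>H\<close>.\<close>
  let ?\<alpha> = "\<lambda>h. if h \<in> H then e h else 0"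
  have sub: "cvec.subspace H" using H by (simp add: cartan_subalgebra_def csubspace_eq)
  have "e (g + h) = e g + e h" if "g \<in> H" "h \<in> H" for g h
  proof -
    have "e (g + h) *\<^sub>C x = (e g + e h) *\<^sub>C x"
      using e[of "g + h"] e[OF that(1)] e[OF that(2)] cvec.subspace_add[OF sub that]
      by (simp add: lie_add_left scaleC_add_left)
    then show ?thesis using False by (simp add: cvec.scale_cancel_right)
  qed
  moreover have "e (c *\<^sub>C h) = c * e h" if "h \<in> H" for c h
  proof -
    have "e (c *\<^sub>C h) *\<^sub>C x = lie (c *\<^sub>C h) x"
      using e[OF cvec.subspace_scale[OF sub that]] by simp
    also have "\<dots> = (c * e h) *\<^sub>C x"
      by (simp add: lie_scale_left e[OF that] scaleC_scaleC)
    finally have "e (c *\<^sub>C h) *\<^sub>C x = (c * e h) *\<^sub>C x" .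
    then show ?thesis using False by (metis cvec.scale_cancel_right)
  qed
  ultimately have "?\<alpha> \<in> dual_of H"
    using sub by (auto simp: dual_of_def cvec.subspace_add cvec.subspace_scale)
  moreover have "x \<in> root_space H ?\<alpha>" using e by (simp add: root_space_def)
  ultimately show ?thesis by (auto simp: weight_vectors_def)
qed

lemma finite_independent: "cvec.independent C \<Longrightarrow> finite (C :: 'g set)"
  using fin cvec.independent_span_bound by auto

text \<open>The elements having \<open>x\<close> as an eigenvector form a subspace, so simultaneous
  diagonalization is needed only for a basis of \<open>H\<close>, which is finite.\<close>

lemma span_weight_vectors: "cvec.span weight_vectors = UNIV"
proof -
  obtain B where B: "B \<subseteq> H" "cvec.independent B" "H \<subseteq> cvec.span B"
    using cvec.maximal_independent_subset by blast
  have "x \<in> weight_vectors" if x: "\<forall>h\<in>B. \<exists>e. lie h x = e *\<^sub>C x" for x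
  proof (rule joint_eigenvector_weight, rule ballI)
    fix h assume "h \<in> H"
    have "cvec.subspace {h. \<exists>e. lie h x = e *\<^sub>C x}"
      unfolding cvec.subspace_def
      by (auto simp: lie_add_left lie_scale_left scaleC_scaleC intro: exI[of _ 0])
        (metis scaleC_add_left)
    from cvec.span_minimal[OF _ this, of B] show "\<exists>e. lie h x = e *\<^sub>C x"
      using x B(3) \<open>h \<in> H\<close> by auto
  qed
  then have "cvec.span {x. \<forall>h\<in>B. \<exists>e. lie h x = e *\<^sub>C x} \<subseteq> cvec.span weight_vectors"
    by (intro cvec.span_mono) auto
  then show ?thesis
    using joint_eigenvectors[OF finite_independent[OF B(2)] B(1)] by auto
qed

end

section \<open>Linear functionals and simple roots\<close>

text \<open>Induction on the number of functionals. If \<open>g\<close> is nonzero somewhere on the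
  common kernel of \<open>S\<close>, a point \<open>h1\<close> of this kernel is normalized to
  \<open>g h1 = 1\<close>, and \<open>f - f h1 * g\<close> falls under the induction hypothesis for
  \<open>S\<close>. Otherwise \<open>g\<close> receives the coefficient 0.\<close>

lemma functional_combination:
  fixes f :: "'a::complex_vector \<Rightarrow> complex"
  assumes "finite S" "cvec.subspace H"
    and lin: "\<And>g x y. g \<in> insert f S \<Longrightarrow> x \<in> H \<Longrightarrow> y \<in> H \<Longrightarrow> g (x + y) = g x + g y"
      "\<And>g c x. g \<in> insert f S \<Longrightarrow> x \<in> H \<Longrightarrow> g (c *\<^sub>C x) = c * g x"
    and "\<And>h. h \<in> H \<Longrightarrow> (\<And>g. g \<in> S \<Longrightarrow> g h = 0) \<Longrightarrow> f h = 0"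
  shows "\<exists>c. \<forall>h\<in>H. f h = (\<Sum>g\<in>S. c g * g h)"
  using assms(1,3-)
proof (induction S arbitrary: f)
  case empty
  then show ?case by simp
next
  case (insert g S)
  show ?case
  proof (cases "\<exists>h1\<in>H. (\<forall>g'\<in>S. g' h1 = 0) \<and> g h1 \<noteq> 0")
    case False
    have "\<exists>c. \<forall>h\<in>H. f h = (\<Sum>g\<in>S. c g * g h)"
    proof (rule insert.IH)
      fix h assume "h \<in> H" "\<And>g'. g' \<in> S \<Longrightarrow> g' h = 0"
      with False show "f h = 0" by (intro insert.prems(3)) auto
    qed (use insert.prems(1,2) in auto)
    then obtain c where c: "\<forall>h\<in>H. f h = (\<Sum>g\<in>S. c g * g h)" by blast
    show ?thesis
    proof (intro exI[of _ "c(g := 0)"] ballI)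
      fix h assume "h \<in> H"
      have "(\<Sum>g'\<in>S. (c(g := 0)) g' * g' h) = (\<Sum>g\<in>S. c g * g h)"
        using insert.hyps(2) by (intro sum.cong) auto
      then show "f h = (\<Sum>g'\<in>insert g S. (c(g := 0)) g' * g' h)"
        using c insert.hyps \<open>h \<in> H\<close> by simp
    qed
  next
    case True
    then obtain h0 where h0: "h0 \<in> H" "\<forall>g'\<in>S. g' h0 = 0" "g h0 \<noteq> 0" by blast
    define h1 where "h1 = (1 / g h0) *\<^sub>C h0"
 have sc: "g' h1 = (1 / g h0) * g' h0" if "g' \<in> insert g S" for g'
      unfolding h1_def using that h0(1) by (intro insert.prems(2)) auto
    have "h1 \<in> H" using h0(1) assms(2) by (simp add: h1_def cvec.subspace_scale)
    moreover have "g' h1 = 0" if "g' \<in> S" for g' using sc[of g'] that h0(2) by simp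
    moreover have "g h1 = 1" using sc[of g] h0(3) by simp
    ultimately have h1: "h1 \<in> H" "\<forall>g'\<in>S. g' h1 = 0" "g h1 = 1" by auto
    let ?f = "\<lambda>h. f h - f h1 * g h"
    have "\<exists>c. \<forall>h\<in>H. ?f h = (\<Sum>g\<in>S. c g * g h)"
    proof (rule insert.IH)
      fix g' x y assume "g' \<in> insert ?f S" "x \<in> H" "y \<in> H"
      then show "g' (x + y) = g' x + g' y"
        using insert.prems(1)[of f x y] insert.prems(1)[of g x y] insert.prems(1)[of g' x y]
        by (auto simp: algebra_simps)
    next
      fix g' c x assume "g' \<in> insert ?f S" "x \<in> H"
      then show "g' (c *\<^sub>C x) = c * g' x"
        using insert.prems(2)[of f x c] insert.prems(2)[of g x c] insert.prems(2)[of g' x c]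
        by (auto simp: algebra_simps)
    next
      fix h assume h: "h \<in> H" "\<And>g'. g' \<in> S \<Longrightarrow> g' h = 0"
      let ?h = "h + (- g h) *\<^sub>C h1"
      have s: "(- g h) *\<^sub>C h1 \<in> H" using h1(1) assms(2) by (simp only: cvec.subspace_scale)
      have ev: "g' ?h = g' h - g h * g' h1" if "g' \<in> insert f (insert g S)" for g'
        using insert.prems(1)[OF that h(1) s] insert.prems(2)[OF that h1(1), of "- g h"] by simp
      have "f ?h = 0"
      proof (rule insert.prems(3))
        show "?h \<in> H" using h(1) s assms(2) by (rule cvec.subspace_add[rotated])
        fix g' assume "g' \<in> insert g S"
        then show "g' ?h = 0" using ev[of g'] h(2) h1 by auto
      qed
      then show "?f h = 0" using ev[of f] by (simp add: mult.commute)
    qed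
    then obtain c where c: "\<forall>h\<in>H. ?f h = (\<Sum>g\<in>S. c g * g h)" by blast
    show ?thesis
    proof (intro exI[of _ "c(g := f h1)"] ballI)
      fix h assume "h \<in> H"
      have "(\<Sum>g'\<in>S. (c(g := f h1)) g' * g' h) = (\<Sum>g\<in>S. c g * g h)"
        using insert.hyps(2) by (intro sum.cong) auto
      also have "\<dots> = ?f h" using c \<open>h \<in> H\<close> by simp
      finally show "f h = (\<Sum>g'\<in>insert g S. (c(g := f h1)) g' * g' h)"
        using insert.hyps by simp
    qed
  qed
qed

text \<open>By independence no simple root is a combination of the others, so there are elements
  dual to the simple roots; \<open>h\<close> is their sum. It makes the value of a root at
  \<open>h\<close> its height.\<close>

lemma root_base_height:
  assumes H: "cvec.subspace H" and \<Pi>: "root_base H \<Pi>"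
  obtains h where "h \<in> H" "\<And>\<alpha>. \<alpha> \<in> \<Pi> \<Longrightarrow> \<alpha> h = 1"
proof -
  have fin: "finite \<Pi>" and dual: "\<Pi> \<subseteq> dual_of H"
    and indep: "\<And>c. (\<And>x. (\<Sum>\<alpha>\<in>\<Pi>. c \<alpha> * \<alpha> x) = 0) \<Longrightarrow> \<forall>\<alpha>\<in>\<Pi>. c \<alpha> = 0"
    using \<Pi> by (auto simp: root_base_def roots_def)
  have lin: "\<And>g x y. g \<in> \<Pi> \<Longrightarrow> x \<in> H \<Longrightarrow> y \<in> H \<Longrightarrow> g (x + y) = g x + g y"
    "\<And>g c x. g \<in> \<Pi> \<Longrightarrow> x \<in> H \<Longrightarrow> g (c *\<^sub>C x) = c * g x"
    "\<And>g x. g \<in> \<Pi> \<Longrightarrow> x \<notin> H \<Longrightarrow> g x = 0"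
    using dual by (auto simp: dual_of_def)
  have ex: "\<exists>h\<in>H. \<alpha> h = 1 \<and> (\<forall>\<beta>\<in>\<Pi> - {\<alpha>}. \<beta> h = 0)" if \<alpha>: "\<alpha> \<in> \<Pi>" for \<alpha>
  proof -
    have "\<exists>h\<in>H. (\<forall>\<beta>\<in>\<Pi> - {\<alpha>}. \<beta> h = 0) \<and> \<alpha> h \<noteq> 0"
    proof (rule ccontr)
      assume n: "\<not> ?thesis"
      have "\<exists>c. \<forall>h\<in>H. \<alpha> h = (\<Sum>g\<in>\<Pi> - {\<alpha>}. c g * g h)"
      proof (rule functional_combination[OF _ H])
        show "\<alpha> h = 0" if "h \<in> H" "\<And>g. g \<in> \<Pi> - {\<alpha>} \<Longrightarrow> g h = 0" for h
          using n that by blast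
      qed (use fin lin \<alpha> in auto)
      then obtain c where c: "\<And>h. h \<in> H \<Longrightarrow> \<alpha> h = (\<Sum>g\<in>\<Pi> - {\<alpha>}. c g * g h)" by blast
      have "(\<Sum>g\<in>\<Pi>. (c(\<alpha> := -1)) g * g x) = 0" for x
      proof (cases "x \<in> H")
        case True
        have "(\<Sum>g\<in>\<Pi>. (c(\<alpha> := -1)) g * g x) = - \<alpha> x + (\<Sum>g\<in>\<Pi> - {\<alpha>}. (c(\<alpha> := -1)) g * g x)"
          using sum.remove[OF fin \<alpha>, of "\<lambda>g. (c(\<alpha> := -1)) g * g x"] by simp
        also have "(\<Sum>g\<in>\<Pi> - {\<alpha>}. (c(\<alpha> := -1)) g * g x) = (\<Sum>g\<in>\<Pi> - {\<alpha>}. c g * g x)"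
          by (rule sum.cong) auto
        finally show ?thesis using c[OF True] by simp
      qed (simp add: lin(3))
      from indep[OF this] \<alpha> show False by auto
    qed
    then obtain h where h: "h \<in> H" "\<forall>\<beta>\<in>\<Pi> - {\<alpha>}. \<beta> h = 0" "\<alpha> h \<noteq> 0" by blast
    then show ?thesis
      by (intro bexI[of _ "(1 / \<alpha> h) *\<^sub>C h"]) (auto simp: lin(2) \<alpha> cvec.subspace_scale[OF H])
  qed
  then have "\<forall>\<alpha>\<in>\<Pi>. \<exists>h. h \<in> H \<and> \<alpha> h = 1 \<and> (\<forall>\<beta>\<in>\<Pi> - {\<alpha>}. \<beta> h = 0)" by blast
  from bchoice[OF this] obtain hh where
    "\<forall>\<alpha>\<in>\<Pi>. hh \<alpha> \<in> H \<and> \<alpha> (hh \<alpha>) = 1 \<and> (\<forall>\<beta>\<in>\<Pi> - {\<alpha>}. \<beta> (hh \<alpha>) = 0)" by blast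
  then have hh: "\<And>\<alpha>. \<alpha> \<in> \<Pi> \<Longrightarrow> hh \<alpha> \<in> H" "\<And>\<alpha>. \<alpha> \<in> \<Pi> \<Longrightarrow> \<alpha> (hh \<alpha>) = 1"
    "\<And>\<alpha> \<beta>. \<alpha> \<in> \<Pi> \<Longrightarrow> \<beta> \<in> \<Pi> \<Longrightarrow> \<beta> \<noteq> \<alpha> \<Longrightarrow> \<beta> (hh \<alpha>) = 0"
    by simp_all
  have sum: "\<beta> (\<Sum>\<alpha>\<in>A. hh \<alpha>) = (\<Sum>\<alpha>\<in>A. \<beta> (hh \<alpha>)) \<and> (\<Sum>\<alpha>\<in>A. hh \<alpha>) \<in> H" if "\<beta> \<in> \<Pi>" "A \<subseteq> \<Pi>" for \<beta> A
  proof -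
    have "finite A" using that(2) fin by (rule finite_subset)
    then show ?thesis using that(2)
      by (induction A) (use lin(1,2)[OF that(1)] lin(2)[OF that(1), of 0 0] hh(1) cvec.subspace_0[OF H] in
          \<open>auto simp: cvec.subspace_add[OF H]\<close>)
  qed
  show ?thesis
  proof (rule that[of "\<Sum>\<alpha>\<in>\<Pi>. hh \<alpha>"])
    show "(\<Sum>\<alpha>\<in>\<Pi>. hh \<alpha>) \<in> H"
      by (rule cvec.subspace_sum[OF H]) (rule hh(1))
    fix \<beta> assume \<beta>: "\<beta> \<in> \<Pi>"
    have "\<beta> (\<Sum>\<alpha>\<in>\<Pi>. hh \<alpha>) = (\<Sum>\<alpha>\<in>\<Pi>. if \<alpha> = \<beta> then 1 else 0)"
      using sum[OF \<beta>, of \<Pi>] hh(2,3) \<beta> by (auto intro!: sum.cong)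
    then show "\<beta> (\<Sum>\<alpha>\<in>\<Pi>. hh \<alpha>) = 1" using fin \<beta> by simp
  qed
qed

text \<open>Conjugation by the linear map between the two bases leaves the trace unchanged.\<close>

lemma lin_trace_eigenbasis:
  fixes T :: "'a::complex_vector \<Rightarrow> 'a"
  assumes T: "clinear T" and C: "finite C" "cvec.independent C" "cvec.span C = UNIV"
    and e: "\<And>c. c \<in> C \<Longrightarrow> T c = e c *\<^sub>C c"
  shows "lin_trace T = (\<Sum>c\<in>C. e c)"
proof -
  interpret pair: vector_space_pair "scaleC :: complex \<Rightarrow> 'a \<Rightarrow> 'a" "scaleC :: complex \<Rightarrow> 'a \<Rightarrow> 'a"
    by (rule vector_space_pair.intro) (rule cvec.vector_space_axioms)+
  let ?B = "some_basis :: 'a set"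
  note B = some_basis[where 'a = 'a]
  have "finite ?B" "card ?B \<le> card C"
    using cvec.independent_span_bound[OF C(1) B(1)] C(3) by auto
  moreover have "card C \<le> card ?B"
    using cvec.independent_span_bound[OF \<open>finite ?B\<close> C(2)] B(2) by auto
  ultimately obtain p where p: "bij_betw p ?B C"
    using C(1) finite_same_card_bij[of ?B C] by auto
  obtain S where S: "clinear S" "\<And>b. b \<in> ?B \<Longrightarrow> S b = p b"
    using pair.linear_independent_extend[OF B(1), of p] by auto
  obtain R where R: "clinear R" "\<And>c. c \<in> C \<Longrightarrow> R c = inv_into ?B p c"
    using pair.linear_independent_extend[OF C(2), of "inv_into ?B p"] by auto
  have SR: "S (R x) = x" for x
  proof (rule clinear_eq_on_span[OF clinear_comp[OF S(1) R(1)] clinear_ident])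
    show "x \<in> cvec.span C" using C(3) by simp
    show "S (R c) = c" if "c \<in> C" for c
      using that p S(2) R(2) by (metis bij_betw_def bij_betw_inv_into_right inv_into_into)
  qed
  have "lin_trace T = lin_trace (\<lambda>x. S (R (T x)))"
    by (simp add: SR)
  also have "\<dots> = lin_trace (\<lambda>x. R (T (S x)))"
    by (rule lin_trace_commute[OF S(1) clinear_comp[OF R(1) T]])
  also have "\<dots> = (\<Sum>b\<in>?B. e (p b))"
    unfolding lin_trace_def
  proof (rule sum.cong[OF refl])
    fix b assume b: "b \<in> ?B"
    then have pb: "p b \<in> C" using p by (auto simp: bij_betw_def)
    have "R (T (S b)) = e (p b) *\<^sub>C b"
      using b p by (simp add: S(2) e[OF pb] clinear_scale[OF R(1)] R(2)[OF pb] bij_betw_inv_into_left)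
    then show "cvec.representation ?B (R (T (S b))) b = e (p b)"
      using b B(2) by (simp add: cvec.representation_scale[OF B(1)] cvec.representation_basis[OF B(1)])
  qed
  also have "\<dots> = (\<Sum>c\<in>C. e c)"
    by (rule sum.reindex_bij_betw[OF p])
  finally show ?thesis .
qed

section \<open>Nondegeneracy of the Killing form and symmetry of the set of roots\<close>

lemma cartan_facts:
  "cvec.subspace (cartan :: 'g::simple_lie_algebra set)"
  "x \<in> cartan \<Longrightarrow> y \<in> cartan \<Longrightarrow> lie x y = (0 :: 'g)"
  "(\<And>h. h \<in> cartan \<Longrightarrow> lie h x = 0) \<Longrightarrow> (x :: 'g) \<in> cartan"
  using cartan[where 'a = 'g] by (auto simp: cartan_subalgebra_def csubspace_eq)

lemma finite_span: "\<exists>B. finite B \<and> cvec.span B = (UNIV :: 'g::simple_lie_algebra set)"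
  using finite_dimensional[where 'a = 'g] by (simp add: cspan_eq)

lemma span_weights:
  "cvec.span (\<Union>\<alpha>\<in>dual_of cartan. root_space cartan \<alpha>) = (UNIV :: 'g::simple_lie_algebra set)"
  using span_weight_vectors[OF cartan finite_span] weight_vectors_def[OF cartan finite_span] by metis

lemma weight_cases:
  assumes "x \<in> root_space cartan \<alpha>" "\<alpha> \<in> dual_of cartan"
  shows "(x :: 'g::simple_lie_algebra) \<in> cartan \<or> \<alpha> \<in> roots cartan"
proof (cases "\<alpha> = (\<lambda>_. 0) \<or> x = 0")
  case True
  then show ?thesis using assms(1) cartan_facts(3)[of x] cvec.subspace_0[OF cartan_facts(1)]
    by (auto simp: root_space_def)
next
  case False
  then show ?thesis using assms by (auto simp: roots_def)
qed

text \<open>The Killing form is positive on the element on which all simple roots take the value 1.\<close>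

lemma killing_nonzero: "\<exists>x y :: 'g::simple_lie_algebra. killing x y \<noteq> 0"
proof (rule ccontr)
  assume zero: "\<not> ?thesis"
  obtain \<Pi> where \<Pi>: "root_base (cartan :: 'g set) \<Pi>"
    using pos_roots[where 'a = 'g] by (auto simp: positive_system_def)
  obtain h :: 'g where h: "h \<in> cartan" "\<And>\<alpha>. \<alpha> \<in> \<Pi> \<Longrightarrow> \<alpha> h = 1"
    using root_base_height[OF cartan_facts(1) \<Pi>] by blast
  have root_int: "\<exists>j::int. \<beta> h = of_int j \<and> j \<noteq> 0" if \<beta>: "\<beta> \<in> roots cartan" for \<beta>
  proof -
    have fin: "finite \<Pi>" using \<Pi> by (simp add: root_base_def)
    obtain m :: "('g \<Rightarrow> complex) \<Rightarrow> nat" and s :: int where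
      m: "\<And>x. \<beta> x = of_int s * (\<Sum>\<alpha>\<in>\<Pi>. of_nat (m \<alpha>) * \<alpha> x)" and s: "s \<noteq> 0"
    proof -
      from \<Pi> \<beta> obtain m :: "('g \<Rightarrow> complex) \<Rightarrow> nat" where
        "(\<forall>x. \<beta> x = (\<Sum>\<alpha>\<in>\<Pi>. of_nat (m \<alpha>) * \<alpha> x)) \<or> (\<forall>x. \<beta> x = - (\<Sum>\<alpha>\<in>\<Pi>. of_nat (m \<alpha>) * \<alpha> x))"
        unfolding root_base_def by blast
      then show thesis using that[of 1 m] that[of "-1" m] by auto
    qed
    have "\<beta> h = of_int (s * int (\<Sum>\<alpha>\<in>\<Pi>. m \<alpha>))"
      by (simp add: m h(2))
    moreover have "(\<Sum>\<alpha>\<in>\<Pi>. m \<alpha>) \<noteq> 0"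
    proof
      assume "(\<Sum>\<alpha>\<in>\<Pi>. m \<alpha>) = 0"
      then have "\<And>\<alpha>. \<alpha> \<in> \<Pi> \<Longrightarrow> m \<alpha> = 0" using fin by simp
      then have "\<beta> = (\<lambda>_. 0)" using m by auto
      then show False using \<beta> by (simp add: roots_def)
    qed
    ultimately show ?thesis using s by (metis int_eq_iff_numeral mult_eq_0_iff of_nat_eq_0_iff)
  qed
  let ?W = "\<Union>\<alpha>\<in>dual_of cartan. root_space cartan \<alpha> :: 'g set"
  obtain C where C: "C \<subseteq> ?W" "cvec.independent C" "?W \<subseteq> cvec.span C"
    using cvec.maximal_independent_subset by blast
  have span: "cvec.span C = UNIV"
    using C(3) span_weights cvec.span_minimal[OF _ cvec.subspace_span] by blast
  have fin: "finite C"
    using finite_independent[OF cartan finite_span C(2)] .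
  have "\<exists>j::int. lie h c = of_int j *\<^sub>C c \<and> (j = 0 \<longrightarrow> c \<in> cartan)" if c: "c \<in> C" for c
  proof -
    obtain \<alpha> where \<alpha>: "\<alpha> \<in> dual_of cartan" "c \<in> root_space cartan \<alpha>" using C(1) c by blast
    from weight_cases[OF \<alpha>(2,1)] show ?thesis
    proof
      assume "c \<in> cartan"
      then show ?thesis by (intro exI[of _ 0]) (simp add: cartan_facts(2)[OF h(1)])
    next
      assume "\<alpha> \<in> roots cartan"
      with root_int obtain j :: int where "\<alpha> h = of_int j" "j \<noteq> 0" by blast
      then show ?thesis using \<alpha>(2) h(1) by (intro exI[of _ j]) (auto simp: root_space_def)
    qed
  qed
  then obtain j :: "'g \<Rightarrow> int" where j: "\<And>c. c \<in> C \<Longrightarrow> lie h c = of_int (j c) *\<^sub>C c"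
      "\<And>c. c \<in> C \<Longrightarrow> j c = 0 \<Longrightarrow> c \<in> cartan"
    by metis
  \<comment> \<open>The eigenvalues of \<open>ad h\<close> on the weight basis \<open>C\<close> are
    integers, so the trace of its square is a sum of squares. It vanishes only if all of them are 0,
    which puts the whole basis into the Cartan subalgebra and makes the algebra abelian.\<close>
  have "killing h h = (\<Sum>c\<in>C. of_int ((j c)\<^sup>2))"
    unfolding killing_def
    by (rule lin_trace_eigenbasis[OF clinear_comp[OF clinear_lie clinear_lie] fin C(2) span])
      (simp add: j(1) lie_scale_right scaleC_scaleC power2_eq_square)
  then have "of_int (\<Sum>c\<in>C. (j c)\<^sup>2) = (0 :: complex)" using zero by simp
  then have "(\<Sum>c\<in>C. (j c)\<^sup>2) = 0" by (simp only: of_int_eq_0_iff)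
  then have "\<And>c. c \<in> C \<Longrightarrow> j c = 0"
    using fin by (simp add: sum_nonneg_eq_0_iff)
  then have "C \<subseteq> cartan" using j(2) by blast
  then have "cartan = (UNIV :: 'g set)"
    using span cvec.span_minimal[OF _ cartan_facts(1)] by blast
  then show False
    using non_abelian[where 'a = 'g] cartan_facts(2)[where 'g = 'g] by (metis UNIV_I)
qed

lemma killing_add_right: "killing z (x + y) = killing z x + killing z y"
  and killing_scale_right: "killing z (c *\<^sub>C x) = c * killing z x"
  by (simp_all add: killing_commute[of z] killing_add_left killing_scale_left)

text \<open>By invariance the radical is an ideal, and it is proper because the form is not
  identically zero.\<close>

lemma killing_nondegenerate:
  assumes "\<And>y. killing x y = 0" shows "(x :: 'g::simple_lie_algebra) = 0"
proof -
  let ?I = "{x :: 'g. \<forall>y. killing x y = 0}"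
  have z: "killing 0 y = 0" for y :: 'g
    using killing_scale_left[of 0 0 y] by simp
  have "killing (lie x y) w = 0" if "\<And>w. killing y w = 0" for x y w :: 'g
    using that by (metis killing_commute killing_invariant)
  then have "lie_ideal ?I"
    by (auto simp: lie_ideal_def csubspace_eq cvec.subspace_def killing_add_left killing_scale_left z)
  then have "?I = {0} \<or> ?I = UNIV" by (rule ideal_trivial)
  moreover have "?I \<noteq> UNIV" using killing_nonzero by blast
  ultimately show ?thesis using assms by auto
qed

text \<open>By invariance, weight vectors of weights \<alpha> and \<beta> can pair to a nonzero
  number only if \<alpha> + \<beta> = 0. Since weight vectors span and the form is nondegenerate, a
  root vector \<open>x\<close> pairs nontrivially with some weight vector.\<close>

lemma uminus_root:
  assumes "\<alpha> \<in> roots (cartan :: 'g::simple_lie_algebra set)"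
  shows "(\<lambda>h. - \<alpha> h) \<in> roots (cartan :: 'g set)"
proof -
  obtain x where x: "x \<in> root_space cartan \<alpha>" "x \<noteq> 0" and \<alpha>: "\<alpha> \<in> dual_of cartan" "\<alpha> \<noteq> (\<lambda>_. 0)"
    using assms by (auto simp: roots_def)
  have "\<exists>\<beta>\<in>dual_of cartan. \<exists>y\<in>root_space cartan \<beta>. killing x y \<noteq> 0"
  proof (rule ccontr)
    assume n: "\<not> ?thesis"
    have "killing x y = 0" for y
    proof (rule clinear_eq_on_span[where f = "killing x" and g = "\<lambda>_. 0"])
      show "clinear (killing x)"
        by (simp add: clinear_iff killing_add_right killing_scale_right scaleC_complex_def)
      show "y \<in> cvec.span (\<Union>\<alpha>\<in>dual_of cartan. root_space cartan \<alpha>)"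
        by (simp add: span_weights)
    qed (use n clinear_const0 in auto)
    with killing_nondegenerate x(2) show False by blast
  qed
  then obtain \<beta> y where y: "\<beta> \<in> dual_of cartan" "y \<in> root_space cartan \<beta>" "killing x y \<noteq> 0" by blast
  have "\<beta> h = - \<alpha> h" for h
  proof (cases "h \<in> cartan")
    case True
    have "\<alpha> h * killing x y = killing (lie h x) y"
      using x(1) True by (simp add: root_space_def killing_scale_left)
    also have "\<dots> = - killing x (lie h y)"
      using killing_scale_left[of "-1" "lie x h" y] lie_antisym[of h x]
      by (simp add: killing_invariant cvec.scale_minus_left scaleC_one)
    also have "\<dots> = - \<beta> h * killing x y"
      using y(2) True by (simp add: root_space_def killing_scale_right)
    finally have "(\<alpha> h + \<beta> h) * killing x y = 0" by (simp add: algebra_simps)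
    then show ?thesis using y(3) by (simp add: eq_neg_iff_add_eq_0 add.commute)
  next
    case False
    then show ?thesis using y(1) \<alpha>(1) by (simp add: dual_of_def)
  qed
  then have \<beta>: "\<beta> = (\<lambda>h. - \<alpha> h)" by auto
  have "y \<noteq> 0" using y(3) killing_scale_right[of x 0 0] by auto
  moreover have "(\<lambda>h. - \<alpha> h) \<noteq> (\<lambda>_. 0)" using \<alpha>(2) by (simp add: fun_eq_iff)
  ultimately show ?thesis using y(1,2) unfolding \<beta> by (auto simp: roots_def)
qed

text \<open>\<open>n_minus\<close> is built from the negatives of positive roots. A root that is
  minus a combination of simple roots is accounted for there only because its negative is again a
  root.\<close>

theorem triangular_decomposition:
  "cvec.span (n_minus \<union> cartan \<union> n_plus) = (UNIV :: 'g::simple_lie_algebra set)"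
proof -
  obtain \<Pi> where \<Pi>: "root_base (cartan :: 'g set) \<Pi>"
    and pos: "pos_roots = {\<beta> \<in> roots (cartan :: 'g set). \<exists>m :: ('g \<Rightarrow> complex) \<Rightarrow> nat.
          \<forall>x. \<beta> x = (\<Sum>\<alpha>\<in>\<Pi>. of_nat (m \<alpha>) * \<alpha> x)}"
    using pos_roots[where 'a = 'g] unfolding positive_system_def by blast
  have "x \<in> n_minus \<union> cartan \<union> n_plus" if x: "x \<in> root_space cartan \<alpha>" "\<alpha> \<in> dual_of cartan" for x :: 'g and \<alpha>
    using weight_cases[OF x]
  proof
    assume \<alpha>: "\<alpha> \<in> roots cartan"
    obtain m :: "('g \<Rightarrow> complex) \<Rightarrow> nat" where
      "(\<forall>x. \<alpha> x = (\<Sum>\<alpha>\<in>\<Pi>. of_nat (m \<alpha>) * \<alpha> x)) \<or> (\<forall>x. \<alpha> x = - (\<Sum>\<alpha>\<in>\<Pi>. of_nat (m \<alpha>) * \<alpha> x))"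
      using \<Pi> \<alpha> unfolding root_base_def by blast
    then show ?thesis
    proof
      assume "\<forall>x. \<alpha> x = (\<Sum>\<alpha>\<in>\<Pi>. of_nat (m \<alpha>) * \<alpha> x)"
      with \<alpha> have "\<alpha> \<in> pos_roots" unfolding pos by blast
      then have "x \<in> n_plus" unfolding n_plus_def using x(1) by (intro cvec.span_base) blast
      then show ?thesis by blast
    next
      assume "\<forall>x. \<alpha> x = - (\<Sum>\<alpha>\<in>\<Pi>. of_nat (m \<alpha>) * \<alpha> x)"
      then have "\<forall>x. - \<alpha> x = (\<Sum>\<alpha>\<in>\<Pi>. of_nat (m \<alpha>) * \<alpha> x)" by simp
      with uminus_root[OF \<alpha>] have "(\<lambda>h. - \<alpha> h) \<in> pos_roots" unfolding pos by blast
      then have "x \<in> n_minus" unfolding n_minus_def using x(1) by (intro cvec.span_base UN_I[of "\<lambda>h. - \<alpha> h"]) simp_all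
      then show ?thesis by blast
    qed
  qed blast
  then have "(\<Union>\<alpha>\<in>dual_of cartan. root_space cartan \<alpha>) \<subseteq> n_minus \<union> cartan \<union> (n_plus :: 'g set)" by blast
  from cvec.span_mono[OF this] span_weights show ?thesis by auto
qed

section \<open>The irreducible highest weight module\<close>

definition av_minus_gens :: "'g::simple_lie_algebra affvir set"
  where "av_minus_gens = av_g 0 ` n_minus \<union> {av_g (- n) x | n x. n > 0} \<union> {av_d (- n) | n. n > 0}"

lemma uea_sub_av_minus: "uea_sub av_minus = uea_sub av_minus_gens"
  by (simp add: av_minus_def av_minus_gens_def uea_sub_span_eq)

lemma av_minus_mult:
  assumes "i > 0" "P \<in> uea_sub av_minus"
  shows "ugen (av_g (- i) x) * P \<in> uea_sub av_minus" "ugen (av_d (- i)) * P \<in> uea_sub av_minus"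
  using assms unfolding uea_sub_av_minus by (auto simp: av_minus_gens_def intro!: uea_sub.mult uea_sub.gen)

lemma uea_sub_zero: "0 \<in> uea_sub A"
  by (rule cvec.subspace_0[OF subspace_uea_sub])

lemma uea_sub_gen_scale: "x \<in> A \<Longrightarrow> ugen (c *\<^sub>C x) \<in> uea_sub A"
  by (simp add: ugen_scale uea_sub.intros)

text \<open>The spanning half of the PBW theorem: the span of the ordered products contains
  \<open>1\<close> and is stable under left multiplication by generators. A generator outside
  \<open>loop_minus\<close> is moved to its place through the factors before it, where the
  commutators stay inside the respective subalgebras.\<close>

lemma av_minus_ordered:
  assumes "P \<in> uea_sub (av_minus :: 'g::simple_lie_algebra affvir set)"
  shows "P \<in> cvec.span {x * y * z | x y z. x \<in> uea_sub loop_minus \<and> y \<in> uea_sub vir_minus \<and>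
    z \<in> uea_sub (av_g 0 ` n_minus)}" (is "_ \<in> cvec.span ?G")
proof -
  let ?A = "{av_g (- n) x | n x. n > 0} :: 'g affvir set" and ?B = "{av_d (- n) | n. n > 0} :: 'g affvir set"
  have B: "uea_sub vir_minus = uea_sub ?B" by (simp add: vir_minus_def uea_sub_span_eq)
  have A: "uea_sub loop_minus = uea_sub ?A" by (rule loop_minus_eq)
  have "P * 1 \<in> cvec.span ?G"
  proof (rule uea_sub_mult_stable[OF assms[unfolded uea_sub_av_minus] cvec.subspace_span])
    fix X :: "'g affvir" and Q assume X: "X \<in> av_minus_gens" and Q: "Q \<in> cvec.span ?G"
    show "ugen X * Q \<in> cvec.span ?G"
    proof (rule subspace_vimageD[OF clinear_uea_mult_right cvec.subspace_span Q])
      fix Q' assume "Q' \<in> ?G"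
      then obtain x y z where xyz: "Q' = x * y * z" "x \<in> uea_sub ?A" "y \<in> uea_sub ?B"
          "z \<in> uea_sub (av_g 0 ` n_minus)"
        unfolding A B by blast
      have G: "x * y * z \<in> cvec.span ?G" if "x \<in> uea_sub ?A" "y \<in> uea_sub ?B" "z \<in> uea_sub (av_g 0 ` n_minus)" for x y z
        by (rule cvec.span_base) (use that in \<open>unfold A B, blast\<close>)
      from X consider i x' where "X = av_g (- i) x'" "i > 0" | i where "X = av_d (- i)" "i > 0"
        | z' where "X = av_g 0 z'" "z' \<in> n_minus"
        by (auto simp: av_minus_gens_def)
      then show "ugen X * Q' \<in> cvec.span ?G"
      proof cases
        case 1
        then have "ugen X * x \<in> uea_sub ?A" using xyz(2) by (auto intro!: uea_sub.mult uea_sub.gen)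
        from G[OF this xyz(3,4)] show ?thesis by (simp add: xyz(1) mult.assoc)
      next
        case 2
        have "ugen X * x - x * ugen X \<in> uea_sub ?A"
        proof (rule uea_sub_commutator[OF xyz(2)])
          fix Y assume "Y \<in> ?A"
          then obtain n x' where Y: "Y = av_g (- n) x'" "n > 0" by blast
          then have e: "lie X Y = of_int (- n) *\<^sub>C av_g (- (n + i)) x'"
            using 2 by (simp add: lie_generators)
          have "av_g (- (n + i)) x' \<in> ?A"
            using Y(2) 2(2) by (intro CollectI exI[of _ "n + i"] exI[of _ x']) simp
          then show "ugen (lie X Y) \<in> uea_sub ?A"
            unfolding e by (rule uea_sub_gen_scale)
        qed
        moreover have "ugen X * y \<in> uea_sub ?B"
          using xyz(3) 2 by (auto intro!: uea_sub.mult uea_sub.gen)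
        ultimately have "(ugen X * x - x * ugen X) * y * z + x * (ugen X * y) * z \<in> cvec.span ?G"
          using xyz by (intro cvec.span_add G)
        then show ?thesis by (simp add: xyz(1) algebra_simps)
      next
        case 3
        have "ugen X * x - x * ugen X \<in> uea_sub ?A"
        proof (rule uea_sub_commutator[OF xyz(2)])
          fix Y assume "Y \<in> ?A"
          then obtain n x' where Y: "Y = av_g (- n) x'" "n > 0" by blast
          then have "lie X Y = av_g (- n) (lie z' x')"
            using 3 by (simp add: lie_generators)
          then show "ugen (lie X Y) \<in> uea_sub ?A"
            using Y(2) by (auto intro: uea_sub.gen)
        qed
        moreover have "ugen X * y - y * ugen X \<in> uea_sub ?B"
          by (rule uea_sub_commutator[OF xyz(3)])
            (use 3 in \<open>auto simp: lie_generators clinear_0[OF clinear_ugen] uea_sub_zero\<close>)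
        moreover have "ugen X * z \<in> uea_sub (av_g 0 ` n_minus)"
          using xyz(4) 3 by (auto intro!: uea_sub.mult uea_sub.gen)
        ultimately have "(ugen X * x - x * ugen X) * y * z + x * (ugen X * y - y * ugen X) * z + x * y * (ugen X * z)
            \<in> cvec.span ?G"
          using xyz by (intro cvec.span_add G)
        then show ?thesis by (simp add: xyz(1) algebra_simps)
      qed
    qed
  next
    have "1 * 1 * 1 \<in> ?G" by (blast intro: uea_sub.one)
    then show "1 \<in> cvec.span ?G" by (simp add: cvec.span_base)
  qed
  then show ?thesis by simp
qed

lemma av_minus_lowering:
  assumes "P \<in> uea_sub (av_minus :: 'g::simple_lie_algebra affvir set)"
  shows "P \<in> cvec.span {P. \<exists>p. lowering P p}"
proof -
  let ?S = "cvec.span {P. \<exists>p. lowering P p} :: 'g affvir uea set"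
  have step: "ugen X * Q \<in> ?S"
    if X: "(\<exists>i x. X = av_g (- i) x \<and> i > 0) \<or> (\<exists>i. X = av_d (- i) \<and> i > 0)" and Q: "Q \<in> ?S" for X :: "'g affvir" and Q
  proof (rule subspace_vimageD[OF clinear_uea_mult_right cvec.subspace_span Q])
    fix P :: "'g affvir uea" assume "P \<in> {P. \<exists>p. lowering P p}"
    then show "ugen X * P \<in> ?S"
      using X by (intro cvec.span_base) (auto intro: lowering.intros)
  qed
  have "x * y * z \<in> ?S"
    if "x \<in> uea_sub loop_minus" "y \<in> uea_sub vir_minus" "z \<in> uea_sub (av_g 0 ` n_minus)"
    for x y z :: "'g affvir uea"
  proof -
    have z: "z \<in> ?S" using lowering.base[OF that(3)] by (intro cvec.span_base) blast
    have "y * z \<in> ?S"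
      by (rule uea_sub_mult_stable[OF that(2)[unfolded vir_minus_def uea_sub_span_eq] cvec.subspace_span _ z])
        (rule step, auto)
    then have "x * (y * z) \<in> ?S"
      by (rule uea_sub_mult_stable[OF that(1)[unfolded loop_minus_eq] cvec.subspace_span, rotated])
        (rule step, auto)
    then show ?thesis by (simp add: mult.assoc)
  qed
  then have "cvec.span {x * y * z | x y z. x \<in> uea_sub loop_minus \<and> y \<in> uea_sub vir_minus \<and>
      z \<in> uea_sub (av_g 0 ` n_minus)} \<subseteq> ?S"
    by (intro cvec.span_minimal cvec.subspace_span) auto
  with av_minus_ordered[OF assms] show ?thesis by blast
qed

lemma lowering_av_minus: "lowering P p \<Longrightarrow> P \<in> uea_sub av_minus"
  unfolding uea_sub_av_minus
  by (induction rule: lowering.induct)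
    (auto simp: av_minus_gens_def intro!: uea_sub.mult uea_sub.gen elim!: uea_sub_mono)

lemma lowering_homogeneous: "lowering P p \<Longrightarrow> homogeneous P p"
proof (induction rule: lowering.induct)
  case (base z)
  have "ugen (av_d 0) * z = z * ugen (av_d 0)"
    using base
  proof (induction rule: uea_sub.induct)
    case (gen X)
    then obtain x where "X = av_g 0 x" by blast
    then show ?case using ugen_lie[of "av_d 0" X] by (simp add: lie_generators clinear_0[OF clinear_ugen])
  next
    case (mult P Q)
    then show ?case by (metis mult.assoc)
  qed (simp_all add: distrib_left distrib_right uea_scale_mult)
  then show ?case by (simp add: homogeneous_def)
next
  case (g P p i x)
  have "ugen (av_d 0) * (ugen (av_g (- i) x) * P) - ugen (av_g (- i) x) * P * ugen (av_d 0)
      = ugen (lie (av_d 0) (av_g (- i) x)) * P + ugen (av_g (- i) x) * (ugen (av_d 0) * P - P * ugen (av_d 0))"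
    by (simp add: ugen_lie algebra_simps)
  then show ?case using g.IH
    by (simp add: homogeneous_def lie_generators ugen_scale uea_scale_mult cvec.scale_left_diff_distrib
        cvec.scale_minus_left clinear_neg[OF clinear_ugen])
next
  case (d P p i)
  have "ugen (av_d 0) * (ugen (av_d (- i)) * P) - ugen (av_d (- i)) * P * ugen (av_d 0)
      = ugen (lie (av_d 0) (av_d (- i))) * P + ugen (av_d (- i)) * (ugen (av_d 0) * P - P * ugen (av_d 0))"
    by (simp add: ugen_lie algebra_simps)
  then show ?case using d
    by (simp add: homogeneous_def lie_generators ugen_scale uea_scale_mult cvec.scale_left_diff_distrib
        cvec.scale_minus_left clinear_neg[OF clinear_ugen])
qed

text \<open>Every generator of negative degree strictly lowers the degree, so only the base case can
  have degree 0.\<close>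

lemma lowering_degree_0:
  assumes "lowering P 0" shows "P \<in> uea_sub (av_g 0 ` n_minus)"
proof -
  have le: "lowering P p \<Longrightarrow> p \<le> 0" for P :: "'a affvir uea" and p
    by (induction rule: lowering.induct) auto
  show ?thesis
    using assms by (rule lowering.cases) (auto dest: le)
qed

section \<open>Structure of the irreducible quotient of the Verma module\<close>

locale highest_weight_quotient =
  fixes lam :: "'g::simple_lie_algebra \<Rightarrow> complex" and l k c :: complex
    and \<rho> :: "'g affvir \<Rightarrow> 'm::complex_vector \<Rightarrow> 'm" and ubar :: 'm
  assumes quotient: "irreducible_verma_quotient lam l k c \<rho> ubar"
begin

lemma irreducible: "irreducible_module \<rho>"
  and mod: "lie_module \<rho>"
  using quotient by (simp_all add: irreducible_verma_quotient_def irreducible_module_def)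

lemmas lin = lie_moduleD(1)[OF mod] and lin_left = lie_moduleD(2)[OF mod]
  and act_mult = uea_act_mult[OF mod] and act_gen [simp] = uea_act_gen[OF mod]
  and act_one [simp] = uea_act_1[OF mod]
  and act_lin = clinear_uea_act[OF mod] and act_lin_left = clinear_uea_act_left[OF mod]

text \<open>The quotient map sends the class of \<open>P\<close> to \<open>P ubar\<close>, by
  induction on \<open>P\<close>. Its surjectivity gives the first claim; the second holds since an
  element of the ideal has the class of \<open>0\<close>.\<close>

lemma act_generates: "\<exists>P. w = uea_act \<rho> P ubar"
  and verma_ideal_act: "R \<in> verma_ideal lam l k c \<Longrightarrow> uea_act \<rho> R ubar = 0"
proof -
  let ?C = "verma_class lam l k c"
  obtain \<pi> where "\<pi> ` verma_module lam l k c = UNIV \<and>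
      (\<forall>P Q. \<pi> (?C (P + Q)) = \<pi> (?C P) + \<pi> (?C Q)) \<and> (\<forall>s P. \<pi> (?C (s *\<^sub>C P)) = s *\<^sub>C \<pi> (?C P)) \<and>
      (\<forall>X P. \<pi> (?C (ugen X * P)) = \<rho> X (\<pi> (?C P))) \<and> \<pi> (?C 1) = ubar"
    using quotient unfolding irreducible_verma_quotient_def by blast
  then have \<pi>: "\<pi> ` verma_module lam l k c = UNIV" "\<And>P Q. \<pi> (?C (P + Q)) = \<pi> (?C P) + \<pi> (?C Q)"
    "\<And>s P. \<pi> (?C (s *\<^sub>C P)) = s *\<^sub>C \<pi> (?C P)" "\<And>X P. \<pi> (?C (ugen X * P)) = \<rho> X (\<pi> (?C P))" "\<pi> (?C 1) = ubar"
    by blast+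
  have act: "\<pi> (?C P) = uea_act \<rho> P ubar" for P
    by (induction P rule: uea_induct)
      (simp_all add: \<pi> act_mult clinear_simps[OF act_lin_left])
  have "w \<in> \<pi> ` range ?C" using \<pi>(1) by (simp add: verma_module_def)
  then show "\<exists>P. w = uea_act \<rho> P ubar" using act by auto
  assume R: "R \<in> verma_ideal lam l k c"
  have sub: "cvec.subspace (verma_ideal lam l k c)" by (simp add: verma_ideal_def cvec.subspace_span)
  have "?C R = ?C 0"
    unfolding verma_class_def using subspace_diff_iff[OF sub] R cvec.subspace_add[OF sub _ R] cvec.subspace_diff[OF sub _ R]
    by (auto, metis diff_add_cancel)
  then show "uea_act \<rho> R ubar = 0"
    by (metis act clinear_0[OF act_lin_left])
qed

lemma verma_idealI:
  "h \<in> cartan \<Longrightarrow> ugen (av_g 0 h) - lam h *\<^sub>C 1 \<in> verma_ideal lam l k c"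
  "X \<in> av_plus \<Longrightarrow> ugen X \<in> verma_ideal lam l k c"
  "ugen (av_d 0) - l *\<^sub>C 1 \<in> verma_ideal lam l k c"
  "ugen av_k - k *\<^sub>C 1 \<in> verma_ideal lam l k c"
  "ugen av_c - c *\<^sub>C 1 \<in> verma_ideal lam l k c"
proof -
  have *: "R \<in> verma_ideal lam l k c"
    if "R \<in> {ugen (av_g 0 h) - lam h *\<^sub>C 1 | h. h \<in> cartan} \<union> ugen ` av_plus \<union>
      {ugen (av_d 0) - l *\<^sub>C 1, ugen av_k - k *\<^sub>C 1, ugen av_c - c *\<^sub>C 1}" for R
  proof -
    have "R = 1 * R" by simp
    with that show ?thesis unfolding verma_ideal_def by (intro cvec.span_base) blast
  qed
  show "h \<in> cartan \<Longrightarrow> ugen (av_g 0 h) - lam h *\<^sub>C 1 \<in> verma_ideal lam l k c"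
    "X \<in> av_plus \<Longrightarrow> ugen X \<in> verma_ideal lam l k c"
    "ugen (av_d 0) - l *\<^sub>C 1 \<in> verma_ideal lam l k c"
    "ugen av_k - k *\<^sub>C 1 \<in> verma_ideal lam l k c"
    "ugen av_c - c *\<^sub>C 1 \<in> verma_ideal lam l k c"
    by (rule *, blast)+
qed

lemma ubar:
  "h \<in> cartan \<Longrightarrow> \<rho> (av_g 0 h) ubar = lam h *\<^sub>C ubar"
  "X \<in> av_plus \<Longrightarrow> \<rho> X ubar = 0"
  "\<rho> (av_d 0) ubar = l *\<^sub>C ubar" "\<rho> av_k ubar = k *\<^sub>C ubar" "\<rho> av_c ubar = c *\<^sub>C ubar"
  using verma_ideal_act[OF verma_idealI(1), of h] verma_ideal_act[OF verma_idealI(2), of X]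
    verma_ideal_act[OF verma_idealI(3)] verma_ideal_act[OF verma_idealI(4)] verma_ideal_act[OF verma_idealI(5)]
  by (simp_all add: clinear_simps[OF act_lin_left])

lemma ubar_plus: "n > 0 \<Longrightarrow> \<rho> (av_g n x) ubar = 0" "n > 0 \<Longrightarrow> \<rho> (av_d n) ubar = 0"
  "z \<in> n_plus \<Longrightarrow> \<rho> (av_g 0 z) ubar = 0"
  by (rule ubar(2), unfold av_plus_def, rule cvec.span_base, blast)+

lemma central: "\<rho> av_k w = k *\<^sub>C w" "\<rho> av_c w = c *\<^sub>C w"
proof -
  obtain P where w: "w = uea_act \<rho> P ubar" using act_generates by blast
  have comm: "\<rho> av_k (\<rho> X w) = \<rho> X (\<rho> av_k w)" "\<rho> av_c (\<rho> X w) = \<rho> X (\<rho> av_c w)" for X w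
    using lie_module_swap[OF mod, of av_k X w] lie_module_swap[OF mod, of av_c X w]
    by (simp_all add: lie_generators clinear_0[OF lin_left])
  have "\<rho> av_k (uea_act \<rho> P ubar) = k *\<^sub>C uea_act \<rho> P ubar \<and> \<rho> av_c (uea_act \<rho> P ubar) = c *\<^sub>C uea_act \<rho> P ubar"
  proof (induction P rule: uea_induct)
    case (gen x P)
    then show ?case by (simp add: act_mult comm clinear_scale[OF lin])
  qed (simp_all add: ubar clinear_simps[OF act_lin_left] clinear_simps[OF lin]
      scaleC_add_right scaleC_scaleC mult.commute)
  then show "\<rho> av_k w = k *\<^sub>C w" "\<rho> av_c w = c *\<^sub>C w" by (simp_all add: w)
qed

text \<open>The subspace \<open>U(L(g)\<^sub>-) ubar\<close> is stable under the whole algebra: by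
  \<open>X y = y X + [X, y]\<close> and induction on words, with \<open>X\<close> arbitrary, only
  \<open>X ubar\<close> has to be examined. In degree 0 the triangular decomposition of
  \<open>g\<close> settles this.\<close>

lemma generated_av_minus: "\<exists>P\<in>uea_sub av_minus. w = uea_act \<rho> P ubar"
proof -
  let ?S = "(\<lambda>P. uea_act \<rho> P ubar) ` uea_sub av_minus"
  have S: "cvec.subspace ?S"
    unfolding cvec.subspace_def
  proof (intro conjI ballI allI)
    show "0 \<in> ?S" using uea_sub_zero clinear_0[OF act_lin_left] by (metis image_eqI)
    show "x + y \<in> ?S" if "x \<in> ?S" "y \<in> ?S" for x y
      using that by (auto simp: uea_sub.add image_iff simp flip: clinear_add[OF act_lin_left])
    show "s *\<^sub>C x \<in> ?S" if "x \<in> ?S" for s x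
      using that by (auto simp: uea_sub.scale image_iff simp flip: clinear_scale[OF act_lin_left])
  qed
  have low: "\<rho> X w \<in> ?S" if "X \<in> av_minus" "w \<in> ?S" for X w
    using that by (auto simp: image_iff act_mult simp flip: act_gen intro!: bexI[of _ "ugen X * _"] uea_sub.mult uea_sub.gen)
  have one: "ubar \<in> ?S" by (metis act_one uea_sub.one image_eqI)
  have base: "\<rho> X ubar \<in> ?S" for X
  proof (induction X rule: affvir_induct)
    case (g n x)
    consider "n < 0" | "n > 0" | "n = 0" by linarith
    then show ?case
    proof cases
      case 1
      then have "av_g (- (- n)) x \<in> av_minus"
        unfolding av_minus_def by (intro cvec.span_base UnI1 UnI2 CollectI exI[of _ "- n"] exI[of _ x]) simp
      then show ?thesis using low one by simp
    next
      case 2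
      then show ?thesis by (simp add: ubar_plus cvec.subspace_0[OF S])
    next
      case 3
      have "x \<in> cvec.span (n_minus \<union> cartan \<union> n_plus)" by (simp add: triangular_decomposition)
      then have "\<rho> (av_g 0 x) ubar \<in> ?S"
      proof (rule subspace_vimageD[OF clinear_comp[OF lin_left clinear_av_g] S])
        fix y :: 'g assume "y \<in> n_minus \<union> cartan \<union> n_plus"
        then consider "y \<in> n_minus" | "y \<in> cartan" | "y \<in> n_plus" by blast
        then show "\<rho> (av_g 0 y) ubar \<in> ?S"
        proof cases
          case 1
          then have "av_g 0 y \<in> av_minus" unfolding av_minus_def by (intro cvec.span_base) blast
          then show ?thesis using low one by blast
        qed (simp_all add: ubar ubar_plus cvec.subspace_0[OF S] cvec.subspace_scale[OF S one])
      qed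
      with 3 show ?thesis by simp
    qed
  next
    case (d n)
    consider "n < 0" | "n > 0" | "n = 0" by linarith
    then show ?case
    proof cases
      case 1
      then have "av_d (- (- n)) \<in> av_minus"
        unfolding av_minus_def by (intro cvec.span_base UnI2 CollectI exI[of _ "- n"]) simp
      then show ?thesis using low one by simp
    qed (simp_all add: ubar ubar_plus cvec.subspace_0[OF S] cvec.subspace_scale[OF S one])
  qed (simp_all add: ubar cvec.subspace_scale[OF S] one clinear_simps[OF lin_left]
      cvec.subspace_add[OF S])
  have words: "\<rho> X (uea_act \<rho> (uea_word ys) ubar) \<in> ?S" if "set ys \<subseteq> av_minus" for X ys
    using that
  proof (induction ys arbitrary: X)
    case (Cons y ys)
    then have "\<rho> y (\<rho> X (uea_act \<rho> (uea_word ys) ubar)) + \<rho> (lie X y) (uea_act \<rho> (uea_word ys) ubar) \<in> ?S"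
      using cvec.subspace_add[OF S low[OF _ Cons.IH[of X]] Cons.IH[of "lie X y"]] by simp
    then show ?case by (simp add: act_mult lie_module_swap[OF mod, of X y])
  qed (simp add: base)
  have stable: "\<rho> X w \<in> ?S" if "w \<in> ?S" for X w
  proof -
    obtain P where P: "P \<in> uea_sub av_minus" "w = uea_act \<rho> P ubar" using \<open>w \<in> ?S\<close> by blast
    show ?thesis unfolding P(2)
      by (rule subspace_vimageD[OF clinear_comp[OF lin act_lin_left] S uea_sub_words[OF P(1)]]) (use words in auto)
  qed
  obtain P where "w = uea_act \<rho> P ubar" using act_generates by blast
  moreover have "uea_act \<rho> P ubar \<in> ?S"
    by (induction P rule: uea_induct)
      (use one stable in \<open>simp_all add: act_mult clinear_simps[OF act_lin_left]
        subspace_closed[OF S]\<close>)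
  ultimately show ?thesis by blast
qed

lemma lowering_induct [case_names lowering add scale]:
  assumes "\<And>P p. lowering P p \<Longrightarrow> Q (uea_act \<rho> P ubar)" "\<And>w w'. Q w \<Longrightarrow> Q w' \<Longrightarrow> Q (w + w')"
    "\<And>s w. Q w \<Longrightarrow> Q (s *\<^sub>C w)"
  shows "Q w"
proof -
  obtain P where P: "P \<in> uea_sub av_minus" "w = uea_act \<rho> P ubar" using generated_av_minus by blast
  have "lowering 1 0" by (rule lowering.base[OF uea_sub.one])
  then have "Q (0 *\<^sub>C uea_act \<rho> 1 ubar)" using assms(1,3) by blast
  then have "cvec.subspace {w. Q w}" using assms(2,3) by (simp add: cvec.subspace_def)
  from subspace_vimageD[OF act_lin_left this av_minus_lowering[OF P(1)]] assms(1) show ?thesis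
    by (auto simp: P(2))
qed

lemma d0_homogeneous: "homogeneous P p \<Longrightarrow> \<rho> (av_d 0) (uea_act \<rho> P ubar) = (l + of_int p) *\<^sub>C uea_act \<rho> P ubar"
proof -
  assume "homogeneous P p"
  then have "ugen (av_d 0) * P = P * ugen (av_d 0) + of_int p *\<^sub>C P"
    by (simp add: homogeneous_def algebra_simps)
  then have "uea_act \<rho> (ugen (av_d 0) * P) ubar = uea_act \<rho> (P * ugen (av_d 0) + of_int p *\<^sub>C P) ubar" by simp
  then show ?thesis
    by (simp add: act_mult clinear_simps[OF act_lin_left] ubar clinear_scale[OF act_lin]
        scaleC_add_left)
qed

lemma d0_lowering: "lowering P p \<Longrightarrow> \<rho> (av_d 0) (uea_act \<rho> P ubar) = (l + of_int p) *\<^sub>C uea_act \<rho> P ubar"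
  by (rule d0_homogeneous[OF lowering_homogeneous])

text \<open>Beyond the decomposition into eigenvectors of \<open>d\<^sub>0\<close> it is recorded
  that the component of degree 0 comes from \<open>U(n_minus)\<close>; this is the part that
  identifies the top space.\<close>

lemma degree_decomposition:
  "\<exists>q :: int \<Rightarrow>\<^sub>0 'm. w = pm_sum (\<lambda>_ x. x) q \<and>
    (\<forall>p. \<rho> (av_d 0) (Poly_Mapping.lookup q p) = (l + of_int p) *\<^sub>C Poly_Mapping.lookup q p) \<and>
    (\<exists>z\<in>uea_sub (av_g 0 ` n_minus). Poly_Mapping.lookup q 0 = uea_act \<rho> z ubar)"
proof (induction w rule: lowering_induct)
  case (lowering P p)
  show ?case
  proof (rule exI[of _ "Poly_Mapping.single p (uea_act \<rho> P ubar)"], intro conjI allI)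
    show "\<exists>z\<in>uea_sub (av_g 0 ` n_minus).
        Poly_Mapping.lookup (Poly_Mapping.single p (uea_act \<rho> P ubar)) 0 = uea_act \<rho> z ubar"
      using lowering lowering_degree_0 clinear_0[OF act_lin_left]
      by (cases "p = 0") (auto simp: lookup_single intro: bexI[of _ 0] uea_sub_zero)
  qed (simp_all add: pm_sum_single lookup_single when_def d0_lowering[OF lowering] clinear_0[OF lin])
next
  case (add w w')
  then obtain q q' z z' where "w = pm_sum (\<lambda>_ x. x) q" "w' = pm_sum (\<lambda>_ x. x) q'"
    "\<forall>p::int. \<rho> (av_d 0) (Poly_Mapping.lookup q p) = (l + of_int p) *\<^sub>C Poly_Mapping.lookup q p"
    "\<forall>p::int. \<rho> (av_d 0) (Poly_Mapping.lookup q' p) = (l + of_int p) *\<^sub>C Poly_Mapping.lookup q' p"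
    "z \<in> uea_sub (av_g 0 ` n_minus)" "Poly_Mapping.lookup q 0 = uea_act \<rho> z ubar"
    "z' \<in> uea_sub (av_g 0 ` n_minus)" "Poly_Mapping.lookup q' 0 = uea_act \<rho> z' ubar"
    by blast
  then show ?case
    by (intro exI[of _ "q + q'"])
      (auto simp: pm_sum_add lookup_add clinear_add[OF lin] scaleC_add_right clinear_add[OF act_lin_left]
        intro!: bexI[of _ "z + z'"] uea_sub.add)
next
  case (scale s w)
  then obtain q z where "w = pm_sum (\<lambda>_ x. x) q"
    "\<forall>p::int. \<rho> (av_d 0) (Poly_Mapping.lookup q p) = (l + of_int p) *\<^sub>C Poly_Mapping.lookup q p"
    "z \<in> uea_sub (av_g 0 ` n_minus)" "Poly_Mapping.lookup q 0 = uea_act \<rho> z ubar"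
    by blast
  then show ?case
    by (intro exI[of _ "s *\<^sub>C q"])
      (auto simp: pm_sum_scale lookup_scaleC clinear_scale[OF lin] clinear_scale[OF act_lin_left] scaleC_scaleC
        mult.commute intro!: bexI[of _ "s *\<^sub>C z"] uea_sub.scale)
qed

text \<open>The eigenvalues \<open>l + p\<close> of \<open>d\<^sub>0\<close> are distinct. So each
  homogeneous component of a vector in the top space is again in the top space, and for
  \<open>p \<noteq> 0\<close> it belongs to two eigenvalues and vanishes.\<close>

lemma top_space_eq: "top_space l \<rho> = (\<lambda>z. uea_act \<rho> z ubar) ` uea_sub (av_g 0 ` n_minus)"
proof (intro equalityI subsetI)
  fix w assume "w \<in> (\<lambda>z. uea_act \<rho> z ubar) ` uea_sub (av_g 0 ` n_minus)"
  then show "w \<in> top_space l \<rho>"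
    using d0_lowering[OF lowering.base] by (auto simp: top_space_def)
next
  fix w assume w: "w \<in> top_space l \<rho>"
  obtain q :: "int \<Rightarrow>\<^sub>0 'm" and z where q: "w = pm_sum (\<lambda>_ x. x) q"
    "\<And>p. \<rho> (av_d 0) (Poly_Mapping.lookup q p) = (l + of_int p) *\<^sub>C Poly_Mapping.lookup q p"
    "z \<in> uea_sub (av_g 0 ` n_minus)" "Poly_Mapping.lookup q 0 = uea_act \<rho> z ubar"
    using degree_decomposition[of w] by blast
  have sub: "cvec.subspace (top_space l \<rho>)"
    by (auto simp: top_space_def cvec.subspace_def clinear_simps[OF lin]
        scaleC_add_right scaleC_scaleC mult.commute)
  have "Poly_Mapping.lookup q p = 0" if "p \<in> Poly_Mapping.keys q" "p \<noteq> 0" for p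
  proof -
    have "Poly_Mapping.lookup q p \<in> top_space l \<rho>"
    proof (rule eigen_components[where F = "Poly_Mapping.keys q" and D = "\<rho> (av_d 0)" and e = "\<lambda>p. l + of_int p"
          and g = "Poly_Mapping.lookup q", OF finite_keys lin sub])
      show "\<rho> (av_d 0) w \<in> top_space l \<rho>" if "w \<in> top_space l \<rho>" for w
        using that cvec.subspace_scale[OF sub that, of l] by (simp add: top_space_def)
    qed (use q(2) w that in \<open>auto simp: inj_on_def q(1) pm_sum_def\<close>)
    then have "(l + of_int p) *\<^sub>C Poly_Mapping.lookup q p = l *\<^sub>C Poly_Mapping.lookup q p"
      using q(2) by (simp add: top_space_def)
    then show ?thesis using that(2) by (simp add: cvec.scale_cancel_right)
  qed
  then have "Poly_Mapping.keys q \<subseteq> {0}" by (auto simp: in_keys_iff)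
  then have "w = Poly_Mapping.lookup q 0"
    unfolding q(1) pm_sum_def
    by (subst sum.mono_neutral_left[where T = "{0}"]) (auto simp: in_keys_iff)
  then show "w \<in> (\<lambda>z. uea_act \<rho> z ubar) ` uea_sub (av_g 0 ` n_minus)" using q(3,4) by auto
qed

text \<open>All positive degrees annihilate \<open>ubar\<close>, and the application of a further
  element changes the bound only by a finite amount, through the degrees of the commutators.\<close>

lemma locally_finite: "\<exists>N. \<forall>m\<ge>N. (\<forall>x. \<rho> (av_g m x) w = 0) \<and> \<rho> (av_d m) w = 0"
proof -
  have step: "\<exists>N. \<forall>m\<ge>N. (\<forall>x. \<rho> (av_g m x) (\<rho> X w) = 0) \<and> \<rho> (av_d m) (\<rho> X w) = 0"
    if "\<forall>m\<ge>N. (\<forall>x. \<rho> (av_g m x) w = 0) \<and> \<rho> (av_d m) w = 0" for X w and N :: int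
  proof (induction X rule: affvir_induct)
    case (g j y)
    \<comment> \<open>\<open>N\<close> takes care of the operator of degree \<open>m\<close> itself,
      \<open>N - j\<close> of the commutator in degree \<open>m + j\<close>, and
      \<open>1 - j\<close> excludes \<open>m + j = 0\<close>, where a central term would
      appear.\<close>
    show ?case
      by (rule exI[of _ "max N (max (N - j) (1 - j))"])
        (use that in \<open>auto simp: lie_module_swap[OF mod, of _ "av_g j y"] lie_generators clinear_0[OF lin]
          clinear_scale[OF lin_left] add.commute[of j]\<close>)
  next
    case (d j)
    show ?case
      by (rule exI[of _ "max N (max (N - j) (1 - j))"])
        (use that in \<open>auto simp: lie_module_swap[OF mod, of _ "av_d j"] lie_generators clinear_0[OF lin]
          clinear_simps[OF lin_left]\<close>)
  next
    case (add X Y)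
    then obtain N1 N2 where "\<forall>m\<ge>N1. (\<forall>x. \<rho> (av_g m x) (\<rho> X w) = 0) \<and> \<rho> (av_d m) (\<rho> X w) = 0"
      "\<forall>m\<ge>N2. (\<forall>x. \<rho> (av_g m x) (\<rho> Y w) = 0) \<and> \<rho> (av_d m) (\<rho> Y w) = 0" by blast
    then show ?case
      by (intro exI[of _ "max N1 N2"]) (simp add: clinear_add[OF lin] clinear_add[OF lin_left])
  next
    case (scale s X)
    then show ?case by (auto simp: clinear_scale[OF lin] clinear_scale[OF lin_left])
  qed (use that in \<open>auto simp: central clinear_scale[OF lin]\<close>)
  obtain P where "w = uea_act \<rho> P ubar" using act_generates by blast
  moreover have "\<exists>N. \<forall>m\<ge>N. (\<forall>x. \<rho> (av_g m x) (uea_act \<rho> P ubar) = 0) \<and> \<rho> (av_d m) (uea_act \<rho> P ubar) = 0"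
  proof (induction P rule: uea_induct)
    case one
    show ?case by (rule exI[of _ 1]) (simp add: ubar_plus)
  next
    case (gen X P)
    then show ?case using step by (auto simp: act_mult)
  next
    case (add P P')
    then obtain N1 N2 where "\<forall>m\<ge>N1. (\<forall>x. \<rho> (av_g m x) (uea_act \<rho> P ubar) = 0) \<and> \<rho> (av_d m) (uea_act \<rho> P ubar) = 0"
      "\<forall>m\<ge>N2. (\<forall>x. \<rho> (av_g m x) (uea_act \<rho> P' ubar) = 0) \<and> \<rho> (av_d m) (uea_act \<rho> P' ubar) = 0" by blast
    then show ?case
      by (intro exI[of _ "max N1 N2"]) (simp add: clinear_add[OF lin] clinear_add[OF act_lin_left])
  next
    case (scale s P)
    then show ?case by (auto simp: clinear_scale[OF lin] clinear_scale[OF act_lin_left])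
  qed
  ultimately show ?thesis by simp
qed

end

section \<open>Tensor products of irreducible modules\<close>

lemma irreducible_moduleD:
  assumes "irreducible_module \<rho>" "cvec.subspace W" "\<And>x w. w \<in> W \<Longrightarrow> \<rho> x w \<in> W" "w \<in> W" "w \<noteq> 0"
  shows "u \<in> W"
proof -
  have "W = {0} \<or> W = UNIV" using assms(1-3) by (simp add: irreducible_module_def)
  with assms(4,5) show ?thesis by auto
qed

lemma irreducible_cyclic:
  assumes "irreducible_module \<sigma>" "v \<noteq> 0"
  shows "\<exists>P. u = uea_act \<sigma> P v"
proof -
  have \<sigma>: "lie_module \<sigma>" using assms(1) by (simp add: irreducible_module_def)
  let ?W = "range (\<lambda>P. uea_act \<sigma> P v)"
  note lin = clinear_uea_act_left[OF \<sigma>]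
  have "u \<in> ?W"
  proof (rule irreducible_moduleD[OF assms(1) _ _ _ assms(2)])
    show "cvec.subspace ?W"
      unfolding cvec.subspace_def
      by (auto simp flip: clinear_add[OF lin] clinear_scale[OF lin]) (metis clinear_0[OF lin] rangeI)
    show "\<sigma> x w \<in> ?W" if "w \<in> ?W" for x w
      using that by (auto simp flip: uea_act_gen[OF \<sigma>] uea_act_mult[OF \<sigma>])
    show "v \<in> ?W" by (metis rangeI uea_act_1[OF \<sigma>])
  qed
  then show ?thesis by auto
qed

text \<open>A nonzero tensor of least rank in a submodule is decomposable, by Schur's lemma for the second
  factor.\<close>

lemma tensor_irreducible:
  fixes \<rho> :: "'l::lie_algebra \<Rightarrow> 'm::complex_vector \<Rightarrow> 'm" and \<sigma> :: "'h::lie_algebra \<Rightarrow> 'v::complex_vector \<Rightarrow> 'v"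
  assumes \<rho>: "irreducible_module \<rho>" and \<sigma>: "irreducible_module \<sigma>"
    and fin: "finite (BV :: 'v set)" "cvec.span BV = UNIV"
    and X: "cvec.subspace X" "\<And>x s. s \<in> X \<Longrightarrow> tmap (\<rho> x) (\<lambda>v. v) s \<in> X"
      "\<And>x s. s \<in> X \<Longrightarrow> tmap (\<lambda>w. w) (\<sigma> x) s \<in> X"
    and s: "s \<in> X" "s \<noteq> 0"
  shows "X = UNIV"
proof -
  have mod: "lie_module \<rho>" "lie_module \<sigma>" using \<rho> \<sigma> by (simp_all add: irreducible_module_def)
  note \<sigma>lin = lie_moduleD(1)[OF mod(2)] and act = clinear_uea_act[OF mod(2)] and act_left = clinear_uea_act_left[OF mod(2)]
  let ?P = "\<lambda>n. \<exists>B g s. finite B \<and> s = (\<Sum>w\<in>B. w \<otimes> g w) \<and> s \<in> X \<and> s \<noteq> 0 \<and> card (B :: 'm set) = n"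
  have "\<exists>n. ?P n" using s by (metis tensor_finite_sum)
  then obtain n where n: "?P n" "\<And>m. m < n \<Longrightarrow> \<not> ?P m" using exists_least_iff[of ?P] by blast
  then obtain B g s where B: "finite B" "s = (\<Sum>w\<in>B. w \<otimes> g w)" "s \<in> X" "s \<noteq> 0" "card B = n" by blast
  have least: "t = 0" if "t = (\<Sum>w\<in>B'. w \<otimes> h w)" "t \<in> X" "finite B'" "card B' < n" for B' h t
    using n(2)[OF that(4)] that(1-3) by blast
  have indep: "cvec.independent B"
    using tensor_shrink[OF B(1,2)] least B(3-5) by metis
  from B(2,4) obtain w0 where w0: "w0 \<in> B" by fastforce
  have card: "card (B - {w0}) < n" using card_Diff1_less[OF B(1) w0] B(5) by simp
  have smap: "tmap (\<lambda>w. w) (uea_act \<sigma> P) t \<in> X" if "t \<in> X" for P t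
  proof (induction P rule: uea_induct)
    case one
    have "tmap (\<lambda>w. w) (uea_act \<sigma> 1) t = t"
      by (rule clinear_eq_tensor[OF clinear_tmap[OF clinear_ident act] clinear_ident])
        (simp add: tmap_tensor clinear_ident act uea_act_1[OF mod(2)])
    then show ?case using that by simp
  next
    case (gen x P)
    have "tmap (\<lambda>w. w) (uea_act \<sigma> (ugen x * P)) t = tmap (\<lambda>w. w) (\<sigma> x) (tmap (\<lambda>w. w) (uea_act \<sigma> P) t)"
      by (rule clinear_eq_tensor[OF clinear_tmap[OF clinear_ident act]
            clinear_comp[OF clinear_tmap[OF clinear_ident \<sigma>lin] clinear_tmap[OF clinear_ident act]]])
        (simp add: tmap_tensor clinear_ident act \<sigma>lin uea_act_mult[OF mod(2)] uea_act_gen[OF mod(2)])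
    then show ?case using gen X(3) by simp
  next
    case (add P P')
    have "tmap (\<lambda>w. w) (uea_act \<sigma> (P + P')) t = tmap (\<lambda>w. w) (uea_act \<sigma> P) t + tmap (\<lambda>w. w) (uea_act \<sigma> P') t"
      by (rule clinear_eq_tensor[OF clinear_tmap[OF clinear_ident act]
            clinear_plus[OF clinear_tmap[OF clinear_ident act] clinear_tmap[OF clinear_ident act]]])
        (simp add: tmap_tensor clinear_ident act clinear_add[OF act_left] tensor_add_right)
    then show ?case using add cvec.subspace_add[OF X(1)] by simp
  next
    case (scale r P)
    have "tmap (\<lambda>w. w) (uea_act \<sigma> (r *\<^sub>C P)) t = r *\<^sub>C tmap (\<lambda>w. w) (uea_act \<sigma> P) t"
      by (rule clinear_eq_tensor[OF clinear_tmap[OF clinear_ident act]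
            clinear_scaled[OF clinear_tmap[OF clinear_ident act]]])
        (simp add: tmap_tensor clinear_ident act clinear_scale[OF act_left] tensor_scale_right)
    then show ?case using scale cvec.subspace_scale[OF X(1)] by simp
  qed
  have g0: "g w0 \<noteq> 0"
  proof
    assume "g w0 = 0"
    then have "s = (\<Sum>w\<in>B - {w0}. w \<otimes> g w)"
      using sum.remove[OF B(1) w0, of "\<lambda>w. w \<otimes> g w"] B(2) by simp
    then show False using least[OF _ B(3) _ card] B(1,4) by blast
  qed
  \<comment> \<open>If \<open>P\<close> annihilates \<open>g w0\<close>, then \<open>P\<close>
    applied to the second factors of \<open>s\<close> leaves fewer terms. By minimality the result
    is 0, and independence of the first factors gives the claim.\<close>
  have key: "uea_act \<sigma> P (g w) = 0" if "uea_act \<sigma> P (g w0) = 0" "w \<in> B" for P w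
  proof (cases "w = w0")
    case False
    have "tmap (\<lambda>w. w) (uea_act \<sigma> P) s = (\<Sum>w\<in>B. w \<otimes> uea_act \<sigma> P (g w))"
      by (simp add: B(2) clinear_sum[OF clinear_tmap[OF clinear_ident act]] tmap_tensor clinear_ident act)
    also have "\<dots> = (\<Sum>w\<in>B - {w0}. w \<otimes> uea_act \<sigma> P (g w))"
      using sum.remove[OF B(1) w0, of "\<lambda>w. w \<otimes> uea_act \<sigma> P (g w)"] that(1) by simp
    finally have e: "tmap (\<lambda>w. w) (uea_act \<sigma> P) s = (\<Sum>w\<in>B - {w0}. w \<otimes> uea_act \<sigma> P (g w))" .
    from least[OF e smap[OF B(3)] _ card] have z: "(\<Sum>w\<in>B - {w0}. w \<otimes> uea_act \<sigma> P (g w)) = 0"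
      using B(1) e by simp
    show ?thesis
      by (rule tensor_independent_sum[OF cvec.independent_mono[OF indep] _ z]) (use B(1) that(2) False in auto)
  qed (use that in simp)
  have "\<exists>r. g w = r *\<^sub>C g w0" if w: "w \<in> B" for w
  proof -
    \<comment> \<open>The endomorphism of \<open>V\<close> taking \<open>P (g w0)\<close> to
      \<open>P (g w)\<close>; by \<open>key\<close> it does not depend on the chosen
      \<open>P\<close>. It commutes with \<sigma>, so an eigenspace is a submodule and
      \<open>f\<close> is a scalar.\<close>
    define f where "f y = uea_act \<sigma> (SOME P. uea_act \<sigma> P (g w0) = y) (g w)" for y
    have f: "f (uea_act \<sigma> P (g w0)) = uea_act \<sigma> P (g w)" for P
    proof -
      let ?Q = "SOME Q. uea_act \<sigma> Q (g w0) = uea_act \<sigma> P (g w0)"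
      have "uea_act \<sigma> ?Q (g w0) = uea_act \<sigma> P (g w0)" by (rule someI) (rule refl)
      then have "uea_act \<sigma> (?Q - P) (g w0) = 0" by (simp add: clinear_diff[OF act_left])
      from key[OF this w] show ?thesis by (simp add: f_def clinear_diff[OF act_left])
    qed
    have cyc: "\<exists>P. y = uea_act \<sigma> P (g w0)" for y by (rule irreducible_cyclic[OF \<sigma> g0])
    have lin: "clinear f"
    proof (rule clinearI)
      fix x y r
      obtain P Q where PQ: "x = uea_act \<sigma> P (g w0)" "y = uea_act \<sigma> Q (g w0)" using cyc by metis
      show "f (x + y) = f x + f y"
        using f[of "P + Q"] by (simp add: PQ f clinear_add[OF act_left])
      show "f (r *\<^sub>C x) = r *\<^sub>C f x"
        using f[of "r *\<^sub>C P"] by (simp add: PQ f clinear_scale[OF act_left])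
    qed
    have comm: "f (\<sigma> x y) = \<sigma> x (f y)" for x y
    proof -
      obtain P where "y = uea_act \<sigma> P (g w0)" using cyc by blast
      then show ?thesis
        using f[of "ugen x * P"] f[of P] by (simp add: uea_act_mult[OF mod(2)] uea_act_gen[OF mod(2)])
    qed
    obtain r y where y: "y \<noteq> 0" "f y = r *\<^sub>C y"
      by (rule exists_eigenvector[OF lin fin g0])
    have "g w0 \<in> {y. f y = r *\<^sub>C y}"
    proof (rule irreducible_moduleD[OF \<sigma> _ _ _ y(1)])
      show "cvec.subspace {y. f y = r *\<^sub>C y}"
        by (auto simp: cvec.subspace_def clinear_simps[OF lin] scaleC_add_right
            scaleC_scaleC mult.commute)
    qed (use y comm clinear_scale[OF \<sigma>lin] in auto)
    then show ?thesis using f[of 1] by (intro exI[of _ r]) (simp add: uea_act_1[OF mod(2)])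
  qed
  then obtain r where r: "\<And>w. w \<in> B \<Longrightarrow> g w = r w *\<^sub>C g w0" by metis
  define w' where "w' = (\<Sum>w\<in>B. r w *\<^sub>C w)"
  have s_eq: "s = w' \<otimes> g w0"
    unfolding B(2) w'_def clinear_sum[OF clinear_tensor_left]
    by (rule sum.cong) (auto simp: r tensor_scale_left tensor_scale_right)
  then have w': "w' \<noteq> 0" using B(4) by auto
  have 1: "w' \<otimes> v \<in> X" for v
  proof -
    have "v \<in> {v. w' \<otimes> v \<in> X}"
      by (rule irreducible_moduleD[OF \<sigma> subspace_vimage[OF clinear_tensor_right X(1)] _ _ g0])
        (use X(3) B(3) s_eq in \<open>auto simp: tmap_tensor[OF clinear_ident \<sigma>lin, symmetric]\<close>)
    then show ?thesis by simp
  qed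
  have 2: "w \<otimes> v \<in> X" for w v
  proof -
    have "w \<in> {w. \<forall>v. w \<otimes> v \<in> X}"
    proof (rule irreducible_moduleD[OF \<rho> _ _ _ w'])
      show "cvec.subspace {w. \<forall>v. w \<otimes> v \<in> X}"
        using subspace_closed[OF X(1)]
        by (auto simp: cvec.subspace_def tensor_add_left tensor_scale_left)
    qed (use 1 X(2) in \<open>auto simp: tmap_tensor[OF lie_moduleD(1)[OF mod(1)] clinear_ident, symmetric]\<close>)
    then show ?thesis by simp
  qed
  have "t \<in> X" for t
    by (induction t rule: tensor_induct) (use 2 cvec.subspace_add[OF X(1)] in auto)
  then show ?thesis by blast
qed

section \<open>Tensors with Laurent polynomials as polynomials with vector coefficients\<close>

definition laurent_coeff :: "int \<Rightarrow> ('a::complex_vector, int \<Rightarrow>\<^sub>0 complex) tensor \<Rightarrow> 'a"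
  where "laurent_coeff n = tensor_lift (\<lambda>x r. Poly_Mapping.lookup r n *\<^sub>C x)"

definition laurent_poly :: "('a::complex_vector, int \<Rightarrow>\<^sub>0 complex) tensor \<Rightarrow> int \<Rightarrow>\<^sub>0 'a"
  where "laurent_poly = tensor_lift (\<lambda>x r. pm_sum (\<lambda>n s. Poly_Mapping.single n (s *\<^sub>C x)) r)"

definition of_laurent_poly :: "(int \<Rightarrow>\<^sub>0 'a) \<Rightarrow> ('a::complex_vector, int \<Rightarrow>\<^sub>0 complex) tensor"
  where "of_laurent_poly p = pm_sum (\<lambda>n x. x \<otimes> laurent_t n) p"

lemma laurent_induct [case_names monomial add]:
  assumes "\<And>x n. P (x \<otimes> laurent_t n)" "\<And>u u'. P u \<Longrightarrow> P u' \<Longrightarrow> P (u + u')"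
  shows "P u"
proof (induction u rule: tensor_induct)
  case (tensor x r)
  show ?case
  proof (induction r rule: pm_induct)
    case (single n s)
    have "x \<otimes> Poly_Mapping.single n s = (s *\<^sub>C x) \<otimes> laurent_t n"
      by (simp add: laurent_t_def tensor_scale_left scaleC_single scaleC_complex_def flip: tensor_scale_right)
    then show ?case using assms(1) by simp
  qed (simp add: tensor_add_right assms(2))
qed (rule assms(2))

lemma clinear_eq_laurent:
  "clinear f \<Longrightarrow> clinear g \<Longrightarrow> (\<And>x n. f (x \<otimes> laurent_t n) = g (x \<otimes> laurent_t n)) \<Longrightarrow> f u = g u"
  by (induction u rule: laurent_induct) (simp_all add: clinear_add)

lemma bilin_laurent_poly: "bilin (\<lambda>x r. pm_sum (\<lambda>n s. Poly_Mapping.single n (s *\<^sub>C x)) r :: int \<Rightarrow>\<^sub>0 'a::complex_vector)"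
proof (rule bilinI)
  fix x :: 'a
  show "clinear (\<lambda>r. pm_sum (\<lambda>n s. Poly_Mapping.single n (s *\<^sub>C x)) r)"
    by (intro clinearI pm_sum_add pm_sum_scale)
      (simp_all add: scaleC_add_left single_add scaleC_single scaleC_scaleC scaleC_complex_def)
next
  fix r :: "int \<Rightarrow>\<^sub>0 complex"
  show "clinear (\<lambda>x :: 'a. pm_sum (\<lambda>n s. Poly_Mapping.single n (s *\<^sub>C x)) r)"
    by (simp add: clinear_iff scaleC_add_right single_add pm_sum_fun_add scaleC_scaleC mult.commute
        flip: pm_sum_fun_scale scaleC_single)
qed

lemma clinear_laurent_poly: "clinear laurent_poly"
  unfolding laurent_poly_def by (rule clinear_tensor_lift[OF bilin_laurent_poly])

lemma laurent_poly_monomial [simp]: "laurent_poly (x \<otimes> laurent_t n) = Poly_Mapping.single n x"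
  by (simp add: laurent_poly_def tensor_lift_tensor[OF bilin_laurent_poly] laurent_t_def pm_sum_single scaleC_one)

lemma clinear_of_laurent_poly: "clinear of_laurent_poly"
  unfolding of_laurent_poly_def
  by (intro clinearI pm_sum_add pm_sum_scale) (simp_all add: tensor_add_left tensor_scale_left)

lemma of_laurent_poly_single [simp]: "of_laurent_poly (Poly_Mapping.single n x) = x \<otimes> laurent_t n"
  by (simp add: of_laurent_poly_def pm_sum_single)

lemma of_laurent_poly_inverse: "of_laurent_poly (laurent_poly u) = u"
  by (rule clinear_eq_laurent[OF clinear_comp[OF clinear_of_laurent_poly clinear_laurent_poly] clinear_ident]) simp

lemma bilin_laurent_coeff: "bilin (\<lambda>x r. Poly_Mapping.lookup r n *\<^sub>C x)"
  by (intro bilinI) (simp_all add: clinear_iff lookup_add lookup_scaleC scaleC_add_left scaleC_add_right scaleC_scaleC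
      scaleC_complex_def mult.commute)

lemma clinear_laurent_coeff: "clinear (laurent_coeff n)"
  unfolding laurent_coeff_def by (rule clinear_tensor_lift[OF bilin_laurent_coeff])

lemma laurent_coeff_monomial [simp]: "laurent_coeff n (x \<otimes> laurent_t m) = (if m = n then x else 0)"
  by (simp add: laurent_coeff_def tensor_lift_tensor[OF bilin_laurent_coeff] laurent_t_def lookup_single scaleC_one)

lemma lookup_laurent_poly: "Poly_Mapping.lookup (laurent_poly u) n = laurent_coeff n u"
proof (rule clinear_eq_laurent[OF _ clinear_laurent_coeff])
  show "clinear (\<lambda>u. Poly_Mapping.lookup (laurent_poly u) n)"
    by (simp add: clinear_iff clinear_simps[OF clinear_laurent_poly] lookup_add lookup_scaleC)
qed (simp add: lookup_single when_def)

lemma laurent_expansion: "u = (\<Sum>n\<in>Poly_Mapping.keys (laurent_poly u). laurent_coeff n u \<otimes> laurent_t n)"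
  using of_laurent_poly_inverse[of u] by (simp add: of_laurent_poly_def pm_sum_def lookup_laurent_poly)

section \<open>Construction of the tensor product module\<close>

locale tensor_module = highest_weight_quotient lam l k c \<rho> ubar
  for lam :: "'g::simple_lie_algebra \<Rightarrow> complex" and l k c :: complex
    and \<rho> :: "'g affvir \<Rightarrow> 'm::complex_vector \<Rightarrow> 'm" and ubar :: 'm +
  fixes \<mu> :: "'g \<Rightarrow> complex" and \<sigma> :: "'g \<Rightarrow> 'v::complex_vector \<Rightarrow> 'v" and a b :: complex
  assumes \<mu>: "\<mu> \<in> dual_of cartan" "\<mu> \<noteq> (\<lambda>_. 0)" and \<sigma>_irr: "fin_dim_irreducible \<mu> \<sigma>"
begin

lemma irreducible_\<sigma>: "irreducible_module \<sigma>" and \<sigma>_mod: "lie_module \<sigma>"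
  using \<sigma>_irr by (simp_all add: fin_dim_irreducible_def irreducible_module_def)

lemmas \<sigma>_lin = lie_moduleD(1)[OF \<sigma>_mod] and \<sigma>_lin_left = lie_moduleD(2)[OF \<sigma>_mod]

text \<open>The invariants form a submodule. If it were not zero, the action would be trivial and
  the highest weight would vanish.\<close>

lemma \<sigma>_invariants: assumes "\<And>x. \<sigma> x v = 0" shows "v = 0"
proof (rule ccontr)
  assume v: "v \<noteq> 0"
  have W: "u \<in> {v. \<forall>x. \<sigma> x v = 0}" for u
    by (rule irreducible_moduleD[OF irreducible_\<sigma> _ _ _ v])
      (use assms in \<open>auto simp: cvec.subspace_def clinear_simps[OF \<sigma>_lin]\<close>)
  obtain u where u: "u \<noteq> 0" "\<forall>h\<in>cartan. \<sigma> h u = \<mu> h *\<^sub>C u"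
    using \<sigma>_irr by (auto simp: fin_dim_irreducible_def)
  have "\<mu> h = 0" for h
    using W[of u] u \<mu>(1) by (cases "h \<in> cartan") (auto simp: dual_of_def)
  with \<mu>(2) show False by auto
qed

text \<open>The defining formula of the module contains the degree of \<open>P\<close>, which is not
  a function of a general element of \<open>L\<close>. As \<open>d\<^sub>0\<close> acts on
  \<open>P ubar\<close> by \<open>l + deg(P)\<close>, the operator \<open>l - d\<^sub>0\<close>
  replaces \<open>- deg(P)\<close>, and the formula becomes linear in \<open>w\<close>.\<close>

definition shift_d :: "int \<Rightarrow> 'm \<Rightarrow> 'm"
  where "shift_d m w = \<rho> (av_d m) w - \<rho> (av_d 0) w + (l + a + b * of_int m) *\<^sub>C w"

lemma clinear_shift_d: "clinear (shift_d m)"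
  unfolding shift_d_def by (intro clinear_plus clinear_minus clinear_scaled lin clinear_ident)

definition tensor_g :: "int \<Rightarrow> 'g \<Rightarrow> ('m, 'v) tensor \<Rightarrow> ('m, 'v) tensor"
  where "tensor_g m x s = tmap (\<rho> (av_g m x)) (\<lambda>v. v) s + tmap (\<lambda>w. w) (\<sigma> x) s"

definition tensor_d :: "int \<Rightarrow> int \<Rightarrow> ('m, 'v) tensor \<Rightarrow> ('m, 'v) tensor"
  where "tensor_d m n s = tmap (shift_d m) (\<lambda>v. v) s + of_int n *\<^sub>C s"

lemma tensor_g_tensor [simp]: "tensor_g m x (w \<otimes> v) = \<rho> (av_g m x) w \<otimes> v + w \<otimes> \<sigma> x v"
  by (simp add: tensor_g_def tmap_tensor lin clinear_ident \<sigma>_lin)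

lemma tensor_d_tensor [simp]: "tensor_d m n (w \<otimes> v) = (shift_d m w + of_int n *\<^sub>C w) \<otimes> v"
  by (simp add: tensor_d_def tmap_tensor clinear_shift_d clinear_ident tensor_add_left tensor_scale_left)

lemma clinear_tensor_g: "clinear (tensor_g m x)"
  unfolding tensor_g_def by (intro clinear_plus clinear_tmap lin clinear_ident \<sigma>_lin)

lemma clinear_tensor_d: "clinear (tensor_d m n)"
  unfolding tensor_d_def by (intro clinear_plus clinear_tmap clinear_shift_d clinear_ident clinear_scaled)

lemma clinear_tensor_g_left: "clinear (\<lambda>x. tensor_g m x s)"
proof (induction s rule: tensor_induct)
  case (tensor w v)
  show ?case
    by (simp add: clinear_plus clinear_comp[OF clinear_tensor_left clinear_comp[OF lin_left clinear_av_g]]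
        clinear_comp[OF clinear_tensor_right \<sigma>_lin_left])
qed (simp add: clinear_add[OF clinear_tensor_g] clinear_plus)

definition graded_act :: "'g affvir \<Rightarrow> (int \<Rightarrow>\<^sub>0 ('m, 'v) tensor) \<Rightarrow> (int \<Rightarrow>\<^sub>0 ('m, 'v) tensor)"
  where "graded_act X p = graded_ext (\<lambda>m n x s. tensor_g m x s) (loop X) p
    + graded_ext (\<lambda>m n r s. r *\<^sub>C tensor_d m n s) (vir X) p + (k * kcoeff X + c * ccoeff X) *\<^sub>C p"

lemma clinear_graded_act: "clinear (graded_act X)"
  by (rule clinearI)
    (simp_all add: graded_act_def graded_ext_add_right graded_ext_scale_right scaleC_add_right
      clinear_simps[OF clinear_tensor_g] clinear_simps[OF clinear_tensor_d]
      scaleC_scaleC mult.commute)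

lemma clinear_graded_act_left: "clinear (\<lambda>X. graded_act X p)"
  by (rule clinearI)
    (simp_all add: graded_act_def graded_ext_add_left graded_ext_scale_left scaleC_add_right scaleC_add_left
      clinear_simps[OF clinear_tensor_g_left]
      scaleC_scaleC scaleC_complex_def algebra_simps)

definition tau :: "'g affvir \<Rightarrow> (('m, 'v) tensor, int \<Rightarrow>\<^sub>0 complex) tensor \<Rightarrow> (('m, 'v) tensor, int \<Rightarrow>\<^sub>0 complex) tensor"
  where "tau X u = of_laurent_poly (graded_act X (laurent_poly u))"

lemma clinear_tau: "clinear (tau X)"
  unfolding tau_def by (intro clinear_comp[OF clinear_of_laurent_poly] clinear_comp[OF clinear_graded_act] clinear_laurent_poly)

lemma clinear_tau_left: "clinear (\<lambda>X. tau X u)"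
  unfolding tau_def by (intro clinear_comp[OF clinear_of_laurent_poly] clinear_graded_act_left)

lemma tau_simps [simp]:
  "tau (av_g m x) (s \<otimes> laurent_t n) = tensor_g m x s \<otimes> laurent_t (m + n)"
  "tau (av_d m) (s \<otimes> laurent_t n) = tensor_d m n s \<otimes> laurent_t (m + n)"
  by (simp_all add: tau_def graded_act_def av_sel graded_ext_single clinear_0[OF clinear_tensor_g]
      clinear_0[OF clinear_tensor_d] clinear_0[OF clinear_tensor_g_left] scaleC_one)

lemma tau_central [simp]: "tau av_k u = k *\<^sub>C u" "tau av_c u = c *\<^sub>C u"
  by (simp_all add: tau_def graded_act_def av_sel clinear_scale[OF clinear_of_laurent_poly] of_laurent_poly_inverse)

lemma \<rho>_lie_simps:
  "\<rho> (av_g m x) (\<rho> (av_g n y) w) = \<rho> (av_g n y) (\<rho> (av_g m x) w) + \<rho> (av_g (m + n) (lie x y)) w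
    + (if m + n = 0 then (of_int m * inv_form x y * k) *\<^sub>C w else 0)"
  "\<rho> (av_d m) (\<rho> (av_g n y) w) = \<rho> (av_g n y) (\<rho> (av_d m) w) + of_int n *\<^sub>C \<rho> (av_g (n + m) y) w"
  "\<rho> (av_d m) (\<rho> (av_d n) w) = \<rho> (av_d n) (\<rho> (av_d m) w) + of_int (n - m) *\<^sub>C \<rho> (av_d (m + n)) w
    + (if m + n = 0 then (of_int (m ^ 3 - m) / 12 * c) *\<^sub>C w else 0)"
  using lie_module_swap[OF mod, of "av_g m x" "av_g n y" w] lie_module_swap[OF mod, of "av_d m" "av_g n y" w]
    lie_module_swap[OF mod, of "av_d m" "av_d n" w]
  by (simp_all add: lie_generators clinear_simps[OF lin_left]
      central scaleC_scaleC del: of_int_diff)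

text \<open>In degree \<open>n\<close> the operator is \<open>A m + K m\<close> with
  \<open>A m = d\<^sub>m - d\<^sub>0\<close> and a scalar \<open>K m\<close>. The terms
  \<open>m d\<^sub>m - r d\<^sub>r\<close> in the commutator of \<open>A m\<close> and
  \<open>A r\<close> cancel against the shift of the degree, and the scalars match by
  \<open>r K r - m K m = (r - m) K (m + r)\<close>.\<close>

lemma shift_d_lie:
  "shift_d m (shift_d r w + of_int n *\<^sub>C w) + of_int (r + n) *\<^sub>C (shift_d r w + of_int n *\<^sub>C w)
    - (shift_d r (shift_d m w + of_int n *\<^sub>C w) + of_int (m + n) *\<^sub>C (shift_d m w + of_int n *\<^sub>C w))
    = of_int (r - m) *\<^sub>C (shift_d (m + r) w + of_int n *\<^sub>C w)
      + (if m + r = 0 then (of_int (m ^ 3 - m) / 12 * c) *\<^sub>C w else 0)"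
proof -
  let ?d = "\<lambda>m. \<rho> (av_d m)" and ?K = "\<lambda>m. l + a + b * of_int m + of_int n"
  define A where "A m w = ?d m w - ?d 0 w" for m w
  have A: "clinear (A m)" for m unfolding A_def by (intro clinear_minus lin)
  have shift: "shift_d m w + of_int n *\<^sub>C w = A m w + ?K m *\<^sub>C w" for m w
    by (simp add: shift_d_def A_def scaleC_add_left add.assoc)
  have shift': "shift_d m u + of_int (r + n) *\<^sub>C u = A m u + (?K m + of_int r) *\<^sub>C u" for m r u
    by (simp add: shift_d_def A_def scaleC_add_left add.assoc add.left_commute add.commute)
  have z: "?d 0 (?d j w) = ?d j (?d 0 w) + of_int j *\<^sub>C ?d j w" for j
    using \<rho>_lie_simps(3)[of 0 j w] by simp
  let ?C = "if m + r = 0 then (of_int (m ^ 3 - m) / 12 * c) *\<^sub>C w else 0"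
  have comm: "A m (A r w) - A r (A m w) = of_int (r - m) *\<^sub>C ?d (m + r) w + ?C
      + of_int m *\<^sub>C ?d m w - of_int r *\<^sub>C ?d r w"
    unfolding A_def clinear_diff[OF lin] z[of m] z[of r] \<rho>_lie_simps(3)[of m r w]
    by (simp add: algebra_simps del: of_int_diff)
  have alg: "(u1 + Kr *\<^sub>C am + (Km + r') *\<^sub>C (ar + Kr *\<^sub>C w)) - (u2 + Km *\<^sub>C ar + (Kr + m') *\<^sub>C (am + Km *\<^sub>C w))
      = (u1 - u2) + r' *\<^sub>C ar - m' *\<^sub>C am + (r' * Kr - m' * Km) *\<^sub>C w" for u1 u2 am ar :: 'm and Kr Km r' m'
    by (simp add: scaleC_add_right scaleC_add_left scaleC_scaleC cvec.scale_left_diff_distrib mult.commute distrib_left)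
  have K: "of_int r * ?K r - of_int m * ?K m = of_int (r - m) * ?K (m + r)"
    by (simp add: algebra_simps)
  have "shift_d m (shift_d r w + of_int n *\<^sub>C w) + of_int (r + n) *\<^sub>C (shift_d r w + of_int n *\<^sub>C w)
    - (shift_d r (shift_d m w + of_int n *\<^sub>C w) + of_int (m + n) *\<^sub>C (shift_d m w + of_int n *\<^sub>C w))
    = (A m (A r w) - A r (A m w)) + of_int r *\<^sub>C A r w - of_int m *\<^sub>C A m w + (of_int (r - m) * ?K (m + r)) *\<^sub>C w"
    unfolding shift shift' clinear_simps[OF A] K[symmetric] by (rule alg)
  also have "\<dots> = of_int (r - m) *\<^sub>C (A (m + r) w + ?K (m + r) *\<^sub>C w) + ?C"
    unfolding comm unfolding A_def
    by (simp add: scaleC_add_right cvec.scale_right_diff_distrib cvec.scale_left_diff_distrib scaleC_scaleC)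
  finally show ?thesis unfolding shift .
qed

lemma lie_module_tau: "lie_module tau"
proof (rule affvir_moduleI[OF clinear_tau clinear_tau_left])
  note lins = clinear_tau clinear_comp[OF clinear_tau clinear_tau]
    clinear_minus[OF clinear_comp[OF clinear_tau clinear_tau] clinear_comp[OF clinear_tau clinear_tau]]
  note left = clinear_simps[OF clinear_tau_left]
  fix m n :: int and x y :: 'g and u :: "(('m, 'v) tensor, int \<Rightarrow>\<^sub>0 complex) tensor"
  have cyc: "n + (m + j) = m + (n + j)" for j :: int by simp
  have gg: "tensor_g m x (tensor_g n y s) - tensor_g n y (tensor_g m x s) = tensor_g (m + n) (lie x y) s
      + (if m + n = 0 then (of_int m * inv_form x y * k) *\<^sub>C s else 0)" for s
  proof (rule clinear_eq_tensor[where f = "\<lambda>s. tensor_g m x (tensor_g n y s) - tensor_g n y (tensor_g m x s)"])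
    show "clinear (\<lambda>s. tensor_g m x (tensor_g n y s) - tensor_g n y (tensor_g m x s))"
      by (intro clinear_minus clinear_comp[OF clinear_tensor_g clinear_tensor_g])
    show "clinear (\<lambda>s. tensor_g (m + n) (lie x y) s + (if m + n = 0 then (of_int m * inv_form x y * k) *\<^sub>C s else 0))"
      by (cases "m + n = 0") (simp_all add: clinear_plus clinear_tensor_g clinear_scaled clinear_ident clinear_const0)
    fix w v
    show "tensor_g m x (tensor_g n y (w \<otimes> v)) - tensor_g n y (tensor_g m x (w \<otimes> v)) = tensor_g (m + n) (lie x y) (w \<otimes> v)
        + (if m + n = 0 then (of_int m * inv_form x y * k) *\<^sub>C (w \<otimes> v) else 0)"
      by (simp add: clinear_add[OF clinear_tensor_g] \<rho>_lie_simps(1)[of m x n y] tensor_add_left lie_moduleD(3)[OF \<sigma>_mod]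
          tensor_diff_right tensor_scale_left)
  qed
  show "tau (lie (av_g m x) (av_g n y)) u = tau (av_g m x) (tau (av_g n y) u) - tau (av_g n y) (tau (av_g m x) u)"
  proof (rule clinear_eq_laurent[OF lins(1,3)])
    fix s j
    have "tau (av_g m x) (tau (av_g n y) (s \<otimes> laurent_t j)) - tau (av_g n y) (tau (av_g m x) (s \<otimes> laurent_t j)) =
        (tensor_g m x (tensor_g n y s) - tensor_g n y (tensor_g m x s)) \<otimes> laurent_t (m + (n + j))"
      by (simp add: cyc tensor_diff_left)
    also have "\<dots> = tau (lie (av_g m x) (av_g n y)) (s \<otimes> laurent_t j)"
      unfolding gg by (simp add: lie_generators left add.assoc tensor_add_left tensor_scale_left scaleC_scaleC)
        (simp flip: add.assoc)
    finally show "tau (lie (av_g m x) (av_g n y)) (s \<otimes> laurent_t j) =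
        tau (av_g m x) (tau (av_g n y) (s \<otimes> laurent_t j)) - tau (av_g n y) (tau (av_g m x) (s \<otimes> laurent_t j))" by simp
  qed
  have dg: "tensor_d m (n + j) (tensor_g n y s) - tensor_g n y (tensor_d m j s) = of_int n *\<^sub>C tensor_g (n + m) y s" for s j
  proof (rule clinear_eq_tensor[OF clinear_minus[OF clinear_comp[OF clinear_tensor_d clinear_tensor_g]
          clinear_comp[OF clinear_tensor_g clinear_tensor_d]] clinear_scaled[OF clinear_tensor_g]])
    fix w v
    have "\<rho> (av_d 0) (\<rho> (av_g n y) w) = \<rho> (av_g n y) (\<rho> (av_d 0) w) + of_int n *\<^sub>C \<rho> (av_g n y) w"
      using \<rho>_lie_simps(2)[of 0 n y w] by simp
    then show "tensor_d m (n + j) (tensor_g n y (w \<otimes> v)) - tensor_g n y (tensor_d m j (w \<otimes> v)) =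
        of_int n *\<^sub>C tensor_g (n + m) y (w \<otimes> v)"
      by (simp add: clinear_add[OF clinear_tensor_d] clinear_simps[OF clinear_tensor_g] shift_d_def \<rho>_lie_simps(2)[of m n y] clinear_simps[OF lin] tensor_add_left tensor_diff_left tensor_scale_left
          scaleC_add_right scaleC_add_left)
  qed
  show "tau (lie (av_d m) (av_g n y)) u = tau (av_d m) (tau (av_g n y) u) - tau (av_g n y) (tau (av_d m) u)"
  proof (rule clinear_eq_laurent[OF lins(1,3)])
    fix s j
    have "tau (av_d m) (tau (av_g n y) (s \<otimes> laurent_t j)) - tau (av_g n y) (tau (av_d m) (s \<otimes> laurent_t j)) =
        (tensor_d m (n + j) (tensor_g n y s) - tensor_g n y (tensor_d m j s)) \<otimes> laurent_t (m + (n + j))"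
      by (simp add: cyc tensor_diff_left)
    also have "\<dots> = tau (lie (av_d m) (av_g n y)) (s \<otimes> laurent_t j)"
      unfolding dg by (simp add: lie_generators left cyc add.assoc tensor_scale_left)
    finally show "tau (lie (av_d m) (av_g n y)) (s \<otimes> laurent_t j) =
        tau (av_d m) (tau (av_g n y) (s \<otimes> laurent_t j)) - tau (av_g n y) (tau (av_d m) (s \<otimes> laurent_t j))" by simp
  qed
  have dd: "tensor_d m (n + j) (tensor_d n j s) - tensor_d n (m + j) (tensor_d m j s) = of_int (n - m) *\<^sub>C tensor_d (m + n) j s
      + (if m + n = 0 then (of_int (m ^ 3 - m) / 12 * c) *\<^sub>C s else 0)" for s j
  proof (rule clinear_eq_tensor[where f = "\<lambda>s. tensor_d m (n + j) (tensor_d n j s) - tensor_d n (m + j) (tensor_d m j s)"])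
    show "clinear (\<lambda>s. tensor_d m (n + j) (tensor_d n j s) - tensor_d n (m + j) (tensor_d m j s))"
      by (intro clinear_minus clinear_comp[OF clinear_tensor_d clinear_tensor_d])
    show "clinear (\<lambda>s. of_int (n - m) *\<^sub>C tensor_d (m + n) j s
        + (if m + n = 0 then (of_int (m ^ 3 - m) / 12 * c) *\<^sub>C s else 0))"
      by (cases "m + n = 0") (simp_all add: clinear_plus clinear_tensor_d clinear_scaled clinear_ident clinear_const0)
    fix w v
    have "tensor_d m (n + j) (tensor_d n j (w \<otimes> v)) - tensor_d n (m + j) (tensor_d m j (w \<otimes> v)) =
        (shift_d m (shift_d n w + of_int j *\<^sub>C w) + of_int (n + j) *\<^sub>C (shift_d n w + of_int j *\<^sub>C w)
        - (shift_d n (shift_d m w + of_int j *\<^sub>C w) + of_int (m + j) *\<^sub>C (shift_d m w + of_int j *\<^sub>C w))) \<otimes> v"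
      unfolding tensor_d_tensor tensor_diff_left ..
    then show "tensor_d m (n + j) (tensor_d n j (w \<otimes> v)) - tensor_d n (m + j) (tensor_d m j (w \<otimes> v)) =
        of_int (n - m) *\<^sub>C tensor_d (m + n) j (w \<otimes> v)
        + (if m + n = 0 then (of_int (m ^ 3 - m) / 12 * c) *\<^sub>C (w \<otimes> v) else 0)"
      unfolding shift_d_lie by (simp add: tensor_add_left tensor_scale_left del: of_int_diff)
  qed
  show "tau (lie (av_d m) (av_d n)) u = tau (av_d m) (tau (av_d n) u) - tau (av_d n) (tau (av_d m) u)"
  proof (rule clinear_eq_laurent[OF lins(1,3)])
    fix s j
    have "tau (av_d m) (tau (av_d n) (s \<otimes> laurent_t j)) - tau (av_d n) (tau (av_d m) (s \<otimes> laurent_t j)) =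
        (tensor_d m (n + j) (tensor_d n j s) - tensor_d n (m + j) (tensor_d m j s)) \<otimes> laurent_t (m + (n + j))"
      by (simp add: cyc tensor_diff_left)
    also have "\<dots> = tau (lie (av_d m) (av_d n)) (s \<otimes> laurent_t j)"
      unfolding dd by (simp add: lie_generators left add.assoc tensor_add_left tensor_scale_left scaleC_scaleC del: of_int_diff)
        (simp flip: add.assoc)
    finally show "tau (lie (av_d m) (av_d n)) (s \<otimes> laurent_t j) =
        tau (av_d m) (tau (av_d n) (s \<otimes> laurent_t j)) - tau (av_d n) (tau (av_d m) (s \<otimes> laurent_t j))" by simp
  qed
qed (simp_all add: clinear_scale[OF clinear_tau])

end

context tensor_module
begin

text \<open>The conditions determine the action because the vectors \<open>P ubar\<close> with
  \<open>P\<close> homogeneous span \<open>L\<close>; that they can be met is shown by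
  \<open>tau\<close>.\<close>

lemma tensor_act_eq: "tensor_act \<rho> ubar \<sigma> k c a b = tau"
proof -
  let ?spec = "\<lambda>\<tau>. (\<forall>X. clinear (\<tau> X)) \<and> (\<forall>w. clinear (\<lambda>X. \<tau> X w)) \<and>
    (\<forall>P\<in>uea_sub av_minus. \<forall>p v m n. homogeneous P p \<longrightarrow>
      (let w = uea_act \<rho> P ubar in
        \<tau> (av_d m) (w \<otimes> v \<otimes> laurent_t n) =
          (\<rho> (av_d m) w + (a + of_int n - of_int p + b * of_int m) *\<^sub>C w) \<otimes> v \<otimes> laurent_t (m + n))) \<and>
    (\<forall>P\<in>uea_sub av_minus. \<forall>p x v m n. homogeneous P p \<longrightarrow>
      (let w = uea_act \<rho> P ubar in
        \<tau> (av_g m x) (w \<otimes> v \<otimes> laurent_t n) =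
          (\<rho> (av_g m x) w \<otimes> v + w \<otimes> \<sigma> x v) \<otimes> laurent_t (m + n))) \<and>
    (\<forall>w. \<tau> av_k w = k *\<^sub>C w) \<and> (\<forall>w. \<tau> av_c w = c *\<^sub>C w)"
  have shift: "shift_d m (uea_act \<rho> P ubar) + of_int n *\<^sub>C uea_act \<rho> P ubar =
      \<rho> (av_d m) (uea_act \<rho> P ubar) + (a + of_int n - of_int p + b * of_int m) *\<^sub>C uea_act \<rho> P ubar"
    if "homogeneous P p" for P p m n
    unfolding shift_d_def d0_homogeneous[OF that]
    by (simp add: scaleC_add_left cvec.scale_left_diff_distrib algebra_simps)
  have "?spec tau"
    by (auto simp: Let_def shift clinear_tau clinear_tau_left)
  moreover have "\<tau> = tau" if \<tau>: "?spec \<tau>" for \<tau>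
  proof (intro ext)
    fix X u
    have lin: "clinear (\<tau> X)" "clinear (\<lambda>X. \<tau> X u)" for X u using \<tau> by blast+
    have ext: "\<tau> X u = tau X u"
      if "\<And>P p v n. lowering P p \<Longrightarrow>
        \<tau> X (uea_act \<rho> P ubar \<otimes> v \<otimes> laurent_t n) = tau X (uea_act \<rho> P ubar \<otimes> v \<otimes> laurent_t n)" for X u
    proof (rule clinear_eq_laurent[OF lin(1) clinear_tau])
      fix s n
      show "\<tau> X (s \<otimes> laurent_t n) = tau X (s \<otimes> laurent_t n)"
      proof (rule clinear_eq_tensor[OF clinear_comp[OF lin(1) clinear_tensor_left] clinear_comp[OF clinear_tau clinear_tensor_left]])
        show "\<tau> X (w \<otimes> v \<otimes> laurent_t n) = tau X (w \<otimes> v \<otimes> laurent_t n)" for w v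
          by (induction w rule: lowering_induct)
            (simp_all only: that tensor_add_left tensor_scale_left clinear_simps[OF lin(1)]
              clinear_simps[OF clinear_tau])
      qed
    qed
    show "\<tau> X u = tau X u"
    proof (induction X rule: affvir_induct)
      case (g m x)
      show ?case
      proof (rule ext)
        fix P :: "'g affvir uea" and p v n assume P: "lowering P p"
        have "\<tau> (av_g m x) (uea_act \<rho> P ubar \<otimes> v \<otimes> laurent_t n) =
            (\<rho> (av_g m x) (uea_act \<rho> P ubar) \<otimes> v + uea_act \<rho> P ubar \<otimes> \<sigma> x v) \<otimes> laurent_t (m + n)"
          using \<tau> lowering_av_minus[OF P] lowering_homogeneous[OF P] unfolding Let_def by blast
        then show "\<tau> (av_g m x) (uea_act \<rho> P ubar \<otimes> v \<otimes> laurent_t n) =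
            tau (av_g m x) (uea_act \<rho> P ubar \<otimes> v \<otimes> laurent_t n)" by simp
      qed
    next
      case (d m)
      show ?case
      proof (rule ext)
        fix P :: "'g affvir uea" and p v n assume P: "lowering P p"
        have "\<tau> (av_d m) (uea_act \<rho> P ubar \<otimes> v \<otimes> laurent_t n) =
            (\<rho> (av_d m) (uea_act \<rho> P ubar) + (a + of_int n - of_int p + b * of_int m) *\<^sub>C uea_act \<rho> P ubar)
              \<otimes> v \<otimes> laurent_t (m + n)"
          using \<tau> lowering_av_minus[OF P] lowering_homogeneous[OF P] unfolding Let_def by blast
        then show "\<tau> (av_d m) (uea_act \<rho> P ubar \<otimes> v \<otimes> laurent_t n) =
            tau (av_d m) (uea_act \<rho> P ubar \<otimes> v \<otimes> laurent_t n)" by (simp add: shift[OF lowering_homogeneous[OF P]])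
      qed
    qed (use \<tau> in \<open>simp_all add: clinear_simps[OF lin(2)] clinear_simps[OF clinear_tau_left]\<close>)
  qed
  ultimately show ?thesis unfolding tensor_act_def by (rule the_equality)
qed

section \<open>Irreducibility and coinvariants\<close>

text \<open>\<open>lower_image n\<close> is the space \<open>R\<^sub>n\<close> of the introduction.\<close>

definition lower_gens :: "int \<Rightarrow> ('m, 'v) tensor set"
  where "lower_gens n = {tensor_g (- i) x (w \<otimes> v) | i x w v. i > 0} \<union>
    {tensor_d (- i) (n + i) (w \<otimes> v) | i w v. i > 0}"

definition lower_image :: "int \<Rightarrow> ('m, 'v) tensor set"
  where "lower_image n = cvec.span (lower_gens n)"

lemma subspace_lower_image: "cvec.subspace (lower_image n)"
  by (simp add: lower_image_def cvec.subspace_span)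

lemma lower_imageI:
  assumes "i > 0"
  shows "tensor_g (- i) x s \<in> lower_image n" "tensor_d (- i) (n + i) s \<in> lower_image n"
proof -
  have "tensor_g (- i) x (w \<otimes> v) \<in> lower_image n" "tensor_d (- i) (n + i) (w \<otimes> v) \<in> lower_image n" for w v
    unfolding lower_image_def lower_gens_def using assms by (blast intro: cvec.span_base)+
  then show "tensor_g (- i) x s \<in> lower_image n" "tensor_d (- i) (n + i) s \<in> lower_image n"
    by (induction s rule: tensor_induct)
      (simp_all only: clinear_add[OF clinear_tensor_g] clinear_add[OF clinear_tensor_d] cvec.subspace_add[OF subspace_lower_image])
qed

text \<open>Closure is demanded only under generators of negative degree. Full stability is a
  consequence, while in this form the degree \<open>n\<close> coefficient of an element can be seen
  to come from lowering.\<close>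

inductive_set above_module :: "int \<Rightarrow> (('m, 'v) tensor, int \<Rightarrow>\<^sub>0 complex) tensor set" for n where
  above: "m > n \<Longrightarrow> s \<otimes> laurent_t m \<in> above_module n"
| add: "u \<in> above_module n \<Longrightarrow> u' \<in> above_module n \<Longrightarrow> u + u' \<in> above_module n"
| scale: "u \<in> above_module n \<Longrightarrow> r *\<^sub>C u \<in> above_module n"
| lower_g: "u \<in> above_module n \<Longrightarrow> i > 0 \<Longrightarrow> tau (av_g (- i) x) u \<in> above_module n"
| lower_d: "u \<in> above_module n \<Longrightarrow> i > 0 \<Longrightarrow> tau (av_d (- i)) u \<in> above_module n"

lemma subspace_above_module: "cvec.subspace (above_module n)"
proof -
  have "0 *\<^sub>C (0 \<otimes> laurent_t (n + 1)) \<in> above_module n"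
    by (intro above_module.scale above_module.above) simp
  then show ?thesis by (simp add: cvec.subspace_def above_module.add above_module.scale)
qed

text \<open>A lowering generator \<open>Y\<close> is passed by
  \<open>X Y u = Y X u + [X, Y] u\<close>; the induction hypothesis holds for \<open>X\<close> and
  \<open>[X, Y]\<close> alike. On the initial elements, \<open>X\<close> of nonnegative degree stays
  above \<open>n\<close>, and \<open>X\<close> of negative degree is one of the closure
  rules.\<close>

lemma above_module_stable: "u \<in> above_module n \<Longrightarrow> tau X u \<in> above_module n"
proof (induction arbitrary: X rule: above_module.induct)
  case (above m s)
  note s = subspace_above_module[of n]
  show ?case
  proof (induction X rule: affvir_induct)
    case (g j x)
    show ?case
    proof (cases "j < 0")
      case True
      then show ?thesis
        using above_module.lower_g[OF above_module.above[OF above, of s], of "- j" x] by simp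
    next
      case False
      then show ?thesis using above by (simp add: above_module.above)
    qed
  next
    case (d j)
    show ?case
    proof (cases "j < 0")
      case True
      then show ?thesis
        using above_module.lower_d[OF above_module.above[OF above, of s], of "- j"] by simp
    next
      case False
      then show ?thesis using above by (simp add: above_module.above)
    qed
  qed (simp_all add: above above_module.above above_module.scale above_module.add
      clinear_simps[OF clinear_tau_left])
next
  case (lower_g u i x)
  then show ?case
    by (simp add: lie_module_swap[OF lie_module_tau, of X "av_g (- i) x"] above_module.add above_module.lower_g)
next
  case (lower_d u i)
  then show ?case
    by (simp add: lie_module_swap[OF lie_module_tau, of X "av_d (- i)"] above_module.add above_module.lower_d)
qed (simp_all add: clinear_simps[OF clinear_tau] above_module.add above_module.scale)

text \<open>The coefficient at \<open>t^n\<close> of a lowered element comes from that of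
  \<open>u\<close> at \<open>t^(n + i)\<close> and has the form of a generator of
  \<open>lower_image n\<close>. The initial elements have no coefficient there.\<close>

lemma above_module_coeff: "u \<in> above_module n \<Longrightarrow> laurent_coeff n u \<in> lower_image n"
proof (induction rule: above_module.induct)
  case (lower_g u i x)
  have "laurent_coeff n (tau (av_g (- i) x) u) \<in> lower_image n"
  proof (induction u rule: laurent_induct)
    case (monomial s m)
    show ?case using lower_g.hyps(2) by (simp add: lower_imageI cvec.subspace_0[OF subspace_lower_image])
  qed (simp add: clinear_add[OF clinear_tau] clinear_add[OF clinear_laurent_coeff] cvec.subspace_add[OF subspace_lower_image])
  then show ?case .
next
  case (lower_d u i)
  have "laurent_coeff n (tau (av_d (- i)) u) \<in> lower_image n"
  proof (induction u rule: laurent_induct)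
    case (monomial s m)
    show ?case
    proof (cases "- i + m = n")
      case True
      then have "m = n + i" by simp
      then show ?thesis using lower_d.hyps(2) by (simp add: lower_imageI)
    qed (simp add: cvec.subspace_0[OF subspace_lower_image])
  qed (simp add: clinear_add[OF clinear_tau] clinear_add[OF clinear_laurent_coeff] cvec.subspace_add[OF subspace_lower_image])
  then show ?case .
qed (simp_all add: clinear_simps[OF clinear_laurent_coeff]
    subspace_closed[OF subspace_lower_image])

lemma irreducible_imp_lower_image:
  assumes "irreducible_module tau"
  shows "lower_image n = UNIV"
proof -
  have "s \<in> lower_image n" for s
  proof (cases "s = 0")
    case False
    have nz: "s \<otimes> laurent_t (n + 1) \<noteq> 0"
      using laurent_coeff_monomial[of "n + 1" s "n + 1"] False clinear_0[OF clinear_laurent_coeff] by metis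
    have "s \<otimes> laurent_t n \<in> above_module n"
      by (rule irreducible_moduleD[OF assms subspace_above_module above_module_stable above_module.above nz]) simp_all
    from above_module_coeff[OF this] show ?thesis by simp
  qed (simp add: cvec.subspace_0[OF subspace_lower_image])
  then show ?thesis by blast
qed

lemma locally_finite_tensor:
  "\<exists>N. \<forall>m\<ge>N. (\<forall>x. tmap (\<rho> (av_g m x)) (\<lambda>v. v) s = 0) \<and> tmap (\<rho> (av_d m)) (\<lambda>v. v) (s :: ('m, 'v) tensor) = 0"
proof (induction s rule: tensor_induct)
  case (tensor w v)
  obtain N where "\<forall>m\<ge>N. (\<forall>x. \<rho> (av_g m x) w = 0) \<and> \<rho> (av_d m) w = 0" using locally_finite[of w] by blast
  then show ?case by (intro exI[of _ N]) (simp add: tmap_tensor[OF lin clinear_ident])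
next
  case (add s s')
  then obtain N1 N2 where
    "\<forall>m\<ge>N1. (\<forall>x. tmap (\<rho> (av_g m x)) (\<lambda>v. v) s = 0) \<and> tmap (\<rho> (av_d m)) (\<lambda>v. v) s = 0"
    "\<forall>m\<ge>N2. (\<forall>x. tmap (\<rho> (av_g m x)) (\<lambda>v. v) s' = 0) \<and> tmap (\<rho> (av_d m)) (\<lambda>v. v) s' = 0" by blast
  then show ?case
    by (intro exI[of _ "max N1 N2"]) (simp add: clinear_add[OF clinear_tmap[OF lin clinear_ident]])
qed

lemma tensor_d_alt: "tensor_d m n s = tmap (\<rho> (av_d m)) (\<lambda>v. v) s - tmap (\<rho> (av_d 0)) (\<lambda>v. v) s
    + (l + a + b * of_int m + of_int n) *\<^sub>C s"
  by (rule clinear_eq_tensor[OF clinear_tensor_d clinear_plus[OF clinear_minus[OF clinear_tmap[OF lin clinear_ident]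
          clinear_tmap[OF lin clinear_ident]] clinear_scaled[OF clinear_ident]]])
    (simp add: tmap_tensor[OF lin clinear_ident] shift_d_def tensor_add_left tensor_diff_left tensor_scale_left scaleC_add_left)

lemma clinear_tmap_\<rho>: "clinear (\<lambda>X. tmap (\<rho> X) (\<lambda>v. v) (s :: ('m, 'v) tensor))"
proof (induction s rule: tensor_induct)
  case (tensor w v)
  show ?case by (simp add: tmap_tensor[OF lin clinear_ident] clinear_comp[OF clinear_tensor_left lin_left])
qed (simp add: clinear_add[OF clinear_tmap[OF lin clinear_ident]] clinear_plus)

section \<open>Nonzero submodules of the tensor product\<close>

context
  fixes W :: "(('m, 'v) tensor, int \<Rightarrow>\<^sub>0 complex) tensor set"
  assumes W: "cvec.subspace W" "\<And>X w. w \<in> W \<Longrightarrow> tau X w \<in> W"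
begin

text \<open>In \<open>tau\<close> the two occurrences of \<open>d\<^sub>0\<close> cancel, so
  \<open>tau (av_d 0)\<close> is the scalar \<open>l + a + n\<close> on the component of degree
  \<open>n\<close>. These scalars are distinct.\<close>

lemma submodule_graded:
  assumes "u \<in> W" shows "laurent_coeff n u \<otimes> laurent_t n \<in> W"
proof (cases "n \<in> Poly_Mapping.keys (laurent_poly u)")
  case True
  show ?thesis
  proof (rule eigen_components[where F = "Poly_Mapping.keys (laurent_poly u)" and D = "tau (av_d 0)"
        and e = "\<lambda>n. l + a + of_int n" and g = "\<lambda>n. laurent_coeff n u \<otimes> laurent_t n", OF finite_keys clinear_tau W])
    show "(\<Sum>n\<in>Poly_Mapping.keys (laurent_poly u). laurent_coeff n u \<otimes> laurent_t n) \<in> W"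
      using assms laurent_expansion[of u] by simp
  qed (use True in \<open>auto simp: inj_on_def tensor_d_alt tensor_scale_left\<close>)
next
  case False
  then show ?thesis by (simp add: in_keys_iff lookup_laurent_poly cvec.subspace_0[OF W(1)])
qed

definition stable_part :: "('m, 'v) tensor set"
  where "stable_part = {s. \<exists>N. \<forall>n\<ge>N. s \<otimes> laurent_t n \<in> W}"

lemma subspace_stable_part: "cvec.subspace stable_part"
  unfolding cvec.subspace_def
proof (intro conjI ballI allI)
  show "0 \<in> stable_part" by (simp add: stable_part_def cvec.subspace_0[OF W(1)])
  show "s + s' \<in> stable_part" if s: "s \<in> stable_part" "s' \<in> stable_part" for s s'
  proof -
    obtain N1 N2 where "\<forall>n\<ge>N1. s \<otimes> laurent_t n \<in> W" "\<forall>n\<ge>N2. s' \<otimes> laurent_t n \<in> W"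
      using s by (auto simp: stable_part_def)
    then show ?thesis unfolding stable_part_def
      by (intro CollectI exI[of _ "max N1 N2"]) (simp add: tensor_add_left cvec.subspace_add[OF W(1)])
  qed
  show "r *\<^sub>C s \<in> stable_part" if s: "s \<in> stable_part" for r s
  proof -
    obtain N where "\<forall>n\<ge>N. s \<otimes> laurent_t n \<in> W"
      using s by (auto simp: stable_part_def)
    then show ?thesis unfolding stable_part_def
      by (intro CollectI exI[of _ N]) (simp add: tensor_scale_left cvec.subspace_scale[OF W(1)])
  qed
qed

text \<open>A single degree \<open>n\<close> suffices: for large \<open>m\<close> the element
  \<open>x(m)\<close> acts on \<open>s \<otimes> t^n\<close> only through the second factor, and
  \<open>m = j - n\<close> reaches every large degree \<open>j\<close>.\<close>

lemma stable_part_\<sigma>':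
  assumes "s \<otimes> laurent_t n \<in> W" shows "tmap (\<lambda>w. w) (\<sigma> x) s \<in> stable_part"
proof -
  obtain N where N: "\<forall>m\<ge>N. \<forall>x. tmap (\<rho> (av_g m x)) (\<lambda>v. v) s = 0" using locally_finite_tensor[of s] by blast
  have "tmap (\<lambda>w. w) (\<sigma> x) s \<otimes> laurent_t j \<in> W" if "j \<ge> N + n" for j
    using W(2)[OF assms, of "av_g (j - n) x"] that N by (simp add: tensor_g_def)
  then show ?thesis by (auto simp: stable_part_def)
qed

lemma stable_part_\<sigma>: "s \<in> stable_part \<Longrightarrow> tmap (\<lambda>w. w) (\<sigma> x) s \<in> stable_part"
  using stable_part_\<sigma>' by (auto simp: stable_part_def)

text \<open>For \<open>x(m)\<close> the part already obtained from \<sigma> is subtracted. For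
  \<open>d\<^sub>m\<close> the multiple of \<open>s\<close> that depends on the degree lies in
  \<open>W\<close>, which leaves \<open>d\<^sub>m - d\<^sub>0\<close>; a large \<open>m\<close> with
  \<open>d\<^sub>m s = 0\<close> isolates \<open>d\<^sub>0\<close>, and then every
  \<open>d\<^sub>m\<close> follows.\<close>

lemma stable_part_\<rho>:
  assumes "s \<in> stable_part" shows "tmap (\<rho> X) (\<lambda>v. v) s \<in> stable_part"
proof -
  note sub = subspace_stable_part
  obtain N where N: "\<forall>n\<ge>N. s \<otimes> laurent_t n \<in> W" using assms by (auto simp: stable_part_def)
  have g: "tensor_g m x s \<in> stable_part" for m x
  proof -
    have "tensor_g m x s \<otimes> laurent_t n \<in> W" if "n \<ge> N + m" for n
      using W(2)[of "s \<otimes> laurent_t (n - m)" "av_g m x"] N that by simp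
    then show ?thesis by (auto simp: stable_part_def)
  qed
  have d: "tmap (\<rho> (av_d m)) (\<lambda>v. v) s - tmap (\<rho> (av_d 0)) (\<lambda>v. v) s \<in> stable_part" for m
  proof -
    have "(tmap (\<rho> (av_d m)) (\<lambda>v. v) s - tmap (\<rho> (av_d 0)) (\<lambda>v. v) s) \<otimes> laurent_t n \<in> W" if n: "n \<ge> max N (N + m)" for n
    proof -
      let ?r = "l + a + b * of_int m + of_int (n - m)"
      have "tensor_d m (n - m) s \<otimes> laurent_t n \<in> W"
        using W(2)[of "s \<otimes> laurent_t (n - m)" "av_d m"] N n by simp
      moreover have "?r *\<^sub>C (s \<otimes> laurent_t n) \<in> W"
        using N n by (intro cvec.subspace_scale[OF W(1)]) simp
      ultimately have "tensor_d m (n - m) s \<otimes> laurent_t n - ?r *\<^sub>C (s \<otimes> laurent_t n) \<in> W"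
        by (rule cvec.subspace_diff[OF W(1)])
      then show ?thesis
        unfolding tensor_d_alt by (simp add: tensor_add_left tensor_scale_left del: of_int_diff)
    qed
    then show ?thesis unfolding stable_part_def by blast
  qed
  obtain m where "tmap (\<rho> (av_d m)) (\<lambda>v. v) s = 0" using locally_finite_tensor[of s] by blast
  with d[of m] have d0: "tmap (\<rho> (av_d 0)) (\<lambda>v. v) s \<in> stable_part"
    using cvec.subspace_neg[OF sub] by fastforce
  show ?thesis
  proof (induction X rule: affvir_induct)
    case (g m x)
    have "tensor_g m x s - tmap (\<lambda>w. w) (\<sigma> x) s \<in> stable_part"
      by (rule cvec.subspace_diff[OF sub \<open>\<And>m x. tensor_g m x s \<in> stable_part\<close> stable_part_\<sigma>[OF assms]])
    then show ?case by (simp add: tensor_g_def)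
  next
    case (d m)
    then show ?case using cvec.subspace_add[OF sub \<open>\<And>m. tmap (\<rho> (av_d m)) (\<lambda>v. v) s - tmap (\<rho> (av_d 0)) (\<lambda>v. v) s \<in> stable_part\<close> d0, of m] by simp
  next
    case k
    have "tmap (\<rho> av_k) (\<lambda>v. v) s = k *\<^sub>C s"
      by (rule clinear_eq_tensor[OF clinear_tmap[OF lin clinear_ident] clinear_scaled[OF clinear_ident]])
        (simp add: tmap_tensor[OF lin clinear_ident] central tensor_scale_left)
    then show ?case using assms by (simp add: cvec.subspace_scale[OF sub])
  next
    case c
    have "tmap (\<rho> av_c) (\<lambda>v. v) s = c *\<^sub>C s"
      by (rule clinear_eq_tensor[OF clinear_tmap[OF lin clinear_ident] clinear_scaled[OF clinear_ident]])
        (simp add: tmap_tensor[OF lin clinear_ident] central tensor_scale_left)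
    then show ?case using assms by (simp add: cvec.subspace_scale[OF sub])
  qed (simp_all add: clinear_simps[OF clinear_tmap_\<rho>] subspace_closed[OF sub])
qed

text \<open>Some homogeneous component is nonzero. If every \<open>x\<close> annihilated it through
  the second factor, then in a form with independent first factors all second factors would be
  invariants of \<open>V\<close>.\<close>

lemma stable_part_nonzero:
  assumes "u \<in> W" "u \<noteq> 0"
  obtains s where "s \<in> stable_part" "s \<noteq> 0"
proof -
  have "\<exists>n. laurent_coeff n u \<noteq> 0"
  proof (rule ccontr)
    assume "\<not> ?thesis"
    then have "u = 0" using laurent_expansion[of u] by simp
    with assms(2) show False by simp
  qed
  then obtain n where n: "laurent_coeff n u \<noteq> 0" by blast
  obtain B :: "'m set" and g where B: "finite B" "cvec.independent B" "laurent_coeff n u = (\<Sum>w\<in>B. w \<otimes> g w)"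
    using tensor_independent_form by blast
  have "\<exists>x. tmap (\<lambda>w. w) (\<sigma> x) (laurent_coeff n u) \<noteq> 0"
  proof (rule ccontr)
    assume z: "\<not> ?thesis"
    have "g w = 0" if "w \<in> B" for w
    proof (rule \<sigma>_invariants)
      fix x
      have "(\<Sum>w\<in>B. w \<otimes> \<sigma> x (g w)) = tmap (\<lambda>w. w) (\<sigma> x) (laurent_coeff n u)"
        by (simp add: B(3) clinear_sum[OF clinear_tmap[OF clinear_ident \<sigma>_lin]] tmap_tensor[OF clinear_ident \<sigma>_lin])
      also have "\<dots> = 0" using z by blast
      finally show "\<sigma> x (g w) = 0"
        by (rule tensor_independent_sum[OF B(2,1) _ that])
    qed
    then show False using n B(3) by simp
  qed
  then show ?thesis using that stable_part_\<sigma>'[OF submodule_graded[OF assms(1)]] by blast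
qed

text \<open>So far the bound depends on the tensor. A basis of \<open>V\<close> gives one bound for
  all \<open>ubar \<otimes> v\<close>, and the operators generating \<open>L\<close> from
  \<open>ubar\<close> preserve this bound: they start in degree \<open>n + i \<ge> N\<close>, and
  the other terms they produce in degree \<open>n\<close> lie in \<open>W\<close> already.\<close>

lemma submodule_bounded_below:
  assumes "u \<in> W" "u \<noteq> 0"
  obtains N where "\<And>n s. n \<ge> N \<Longrightarrow> s \<otimes> laurent_t n \<in> W"
proof -
  obtain BV :: "'v set" where BV: "finite BV" "cvec.span BV = UNIV"
    using \<sigma>_irr by (auto simp: fin_dim_irreducible_def)
  obtain s0 where s0: "s0 \<in> stable_part" "s0 \<noteq> 0" using stable_part_nonzero[OF assms] by blast
  have "stable_part = UNIV"
    by (rule tensor_irreducible[OF irreducible irreducible_\<sigma> BV subspace_stable_part stable_part_\<rho> stable_part_\<sigma> s0])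
  then have "\<forall>v. \<exists>N. \<forall>n\<ge>N. ubar \<otimes> v \<otimes> laurent_t n \<in> W" by (auto simp: stable_part_def)
  then obtain Nv where Nv: "\<And>v n. n \<ge> Nv v \<Longrightarrow> ubar \<otimes> v \<otimes> laurent_t n \<in> W" by metis
  \<comment> \<open>The element 0 keeps the maximum defined without a case distinction on
    \<open>BV\<close>.\<close>
  define N where "N = Max (insert 0 (Nv ` BV))"
  have ubar_W: "ubar \<otimes> v \<otimes> laurent_t n \<in> W" if "n \<ge> N" for n v
  proof (rule subspace_vimageD[OF clinear_comp[OF clinear_tensor_left clinear_tensor_right] W(1)])
    show "v \<in> cvec.span BV" using BV(2) by simp
    fix b assume "b \<in> BV"
    then have "Nv b \<le> N" unfolding N_def using BV(1) by (intro Max_ge) auto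
    then show "ubar \<otimes> b \<otimes> laurent_t n \<in> W" using that Nv by simp
  qed
  let ?Q = "{w. \<forall>n\<ge>N. \<forall>v. w \<otimes> v \<otimes> laurent_t n \<in> W}"
  have Q: "cvec.subspace ?Q"
    using subspace_closed[OF W(1)]
    by (auto simp: cvec.subspace_def tensor_add_left tensor_scale_left)
  have g: "\<rho> (av_g (- i) x) w \<in> ?Q" if w: "w \<in> ?Q" and i: "i \<ge> 0" for i x w
  proof safe
    fix n v assume n: "n \<ge> N"
    have "tau (av_g (- i) x) (w \<otimes> v \<otimes> laurent_t (n + i)) - w \<otimes> \<sigma> x v \<otimes> laurent_t n \<in> W"
      using w n i by (intro cvec.subspace_diff[OF W(1)] W(2)) auto
    then show "\<rho> (av_g (- i) x) w \<otimes> v \<otimes> laurent_t n \<in> W" by (simp add: tensor_add_left)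
  qed
  have nm: "uea_act \<rho> z w \<in> ?Q" if "z \<in> uea_sub (av_g 0 ` n_minus)" "w \<in> ?Q" for z w
    using that
  proof (induction arbitrary: w rule: uea_sub.induct)
    case (gen X)
    then obtain x where "X = av_g (- 0) x" by auto
    then show ?case unfolding act_gen using g[OF gen(2), of 0 x] by simp
  next
    case (add P P')
    show ?case unfolding clinear_add[OF act_lin_left] by (rule cvec.subspace_add[OF Q add.IH(1,2)[OF add.prems]])
  next
    case (scale P r)
    show ?case unfolding clinear_scale[OF act_lin_left] by (rule cvec.subspace_scale[OF Q scale.IH[OF scale.prems]])
  next
    case (mult P P')
    show ?case unfolding act_mult by (rule mult.IH(1)[OF mult.IH(2)[OF mult.prems]])
  qed (simp only: act_one)
  have low: "uea_act \<rho> P ubar \<in> ?Q" if "lowering P p" for P p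
    using that
  proof induction
    case (base z)
    show ?case by (rule nm[OF base]) (use ubar_W in blast)
  next
    case (g P p i x)
    show ?case unfolding act_mult act_gen
      by (rule \<open>\<And>w i x. w \<in> ?Q \<Longrightarrow> i \<ge> 0 \<Longrightarrow> \<rho> (av_g (- i) x) w \<in> ?Q\<close>[OF g.IH]) (use g.hyps(2) in simp)
  next
    case (d P p i)
    let ?w = "uea_act \<rho> P ubar"
    show ?case unfolding act_mult act_gen
    proof safe
      fix n v assume n: "n \<ge> N"
      have "tau (av_d (- i)) (?w \<otimes> v \<otimes> laurent_t (n + i))
          - (a - b * of_int i + of_int (n + i) - of_int p) *\<^sub>C (?w \<otimes> v \<otimes> laurent_t n) \<in> W"
        using d.IH n d.hyps(2) by (intro subspace_closed[OF W(1)] W(2)) auto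
      then show "\<rho> (av_d (- i)) ?w \<otimes> v \<otimes> laurent_t n \<in> W"
        by (simp add: shift_d_def d0_lowering[OF d.hyps(1)] tensor_add_left tensor_diff_left tensor_scale_left
            scaleC_add_left cvec.scale_left_diff_distrib cvec.scale_minus_left)
    qed
  qed
  have all: "w \<in> ?Q" for w
  proof (induction w rule: lowering_induct)
    case (lowering P p)
    then show ?case by (rule low)
  next
    case (add w w')
    then show ?case by (rule cvec.subspace_add[OF Q])
  next
    case (scale r w)
    then show ?case by (rule cvec.subspace_scale[OF Q])
  qed
  show ?thesis
  proof (rule that)
    fix n s assume n: "n \<ge> N"
    show "s \<otimes> laurent_t n \<in> W"
      by (induction s rule: tensor_induct) (use all n in \<open>auto simp: tensor_add_left cvec.subspace_add[OF W(1)]\<close>)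
  qed
qed

lemma submodule_UNIV:
  assumes low: "\<And>n. lower_image n = UNIV" and u: "u \<in> W" "u \<noteq> 0"
  shows "W = UNIV"
proof -
  obtain N where N: "\<And>n s. n \<ge> N \<Longrightarrow> s \<otimes> laurent_t n \<in> W" using submodule_bounded_below[OF u] by blast
  have "\<forall>n\<ge>N - int j. \<forall>s. s \<otimes> laurent_t n \<in> W" for j
  proof (induction j)
    case 0
    then show ?case using N by simp
  next
    case (Suc j)
    show ?case
    proof (intro allI impI)
      fix n s assume "n \<ge> N - int (Suc j)"
      then have up: "s \<otimes> laurent_t (n + i) \<in> W" if "i > 0" for i s
        using Suc that by simp
      have "s \<in> cvec.span (lower_gens n)" using low[of n] by (simp add: lower_image_def)
      then show "s \<otimes> laurent_t n \<in> W"
      proof (rule subspace_vimageD[OF clinear_tensor_left W(1)])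
        fix s' assume "s' \<in> lower_gens n"
        then consider i x w v where "s' = tensor_g (- i) x (w \<otimes> v)" "i > 0"
          | i w v where "s' = tensor_d (- i) (n + i) (w \<otimes> v)" "i > 0"
          unfolding lower_gens_def by blast
        then show "s' \<otimes> laurent_t n \<in> W"
        proof cases
          case 1
          then show ?thesis using W(2)[OF up[OF 1(2), of "w \<otimes> v"], of "av_g (- i) x"] by simp
        next
          case 2
          then show ?thesis using W(2)[OF up[OF 2(2), of "w \<otimes> v"], of "av_d (- i)"] by simp
        qed
      qed
    qed
  qed
  note down = this
  have mono: "s \<otimes> laurent_t n \<in> W" for n s
    using down[of "nat (N - n)"] by (cases "n \<ge> N") (auto simp: N)
  have "u \<in> W" for u
    by (induction u rule: laurent_induct) (simp_all add: mono cvec.subspace_add[OF W(1)])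
  then show ?thesis by blast
qed

end

theorem irreducible_tau_iff: "irreducible_module tau \<longleftrightarrow> (\<forall>n. lower_image n = UNIV)"
proof
  assume "irreducible_module tau"
  then show "\<forall>n. lower_image n = UNIV" using irreducible_imp_lower_image by blast
next
  assume low: "\<forall>n. lower_image n = UNIV"
  obtain w :: 'm and v :: 'v where "w \<noteq> 0" "v \<noteq> 0"
    using irreducible irreducible_\<sigma> by (auto simp: irreducible_module_def)
  moreover have "laurent_t 0 \<noteq> 0" by (simp add: laurent_t_def)
  ultimately have "w \<otimes> v \<otimes> laurent_t 0 \<noteq> 0" by (intro tensor_nonzero)
  moreover have "W = {0} \<or> W = UNIV" if "cvec.subspace W" "\<forall>x. \<forall>w\<in>W. tau x w \<in> W" for W
    using submodule_UNIV[of W] that low cvec.subspace_0[OF that(1)] by blast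
  ultimately show "irreducible_module tau"
    using lie_module_tau unfolding irreducible_module_def by blast
qed

end

section \<open>Coinvariants and the maps \<open>\<phi>\<^sub>n\<close>\<close>

lemma subspace_image: "clinear f \<Longrightarrow> cvec.subspace S \<Longrightarrow> cvec.subspace (f ` S)"
proof -
  assume f: "clinear f" and S: "cvec.subspace S"
  show ?thesis
    unfolding cvec.subspace_def
  proof (intro conjI ballI allI)
    show "0 \<in> f ` S" using cvec.subspace_0[OF S] clinear_0[OF f] by (metis imageI)
    show "x + y \<in> f ` S" if "x \<in> f ` S" "y \<in> f ` S" for x y
      using that cvec.subspace_add[OF S] by (auto simp flip: clinear_add[OF f])
    show "r *\<^sub>C x \<in> f ` S" if "x \<in> f ` S" for r x
      using that cvec.subspace_scale[OF S] by (auto simp flip: clinear_scale[OF f])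
  qed
qed

text \<open>Second factors are expanded in a basis of \<open>V\<close>. The coefficients stay in the
  subspace \<open>A\<close>, and the vanishing of the image forces \<open>f\<close> to vanish on
  each of them.\<close>

lemma tensor_sub_kernel:
  fixes f :: "'a::complex_vector \<Rightarrow> 'b::complex_vector" and V :: "'v::complex_vector set"
  assumes f: "clinear f" and A: "cvec.subspace A" and V: "finite V" "cvec.span V = UNIV"
    and s: "s \<in> tensor_sub A (UNIV :: 'v set)" "tmap f (\<lambda>v. v) s = 0"
  shows "s \<in> tensor_sub {x \<in> A. f x = 0} UNIV"
proof -
  obtain B where B: "B \<subseteq> V" "cvec.independent B" "V \<subseteq> cvec.span B"
    using cvec.maximal_independent_subset by blast
  have fin: "finite B" using B(1) V(1) by (rule finite_subset)
  have span: "cvec.span B = UNIV"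
    using cvec.span_minimal[OF B(3) cvec.subspace_span] V(2) by auto
  let ?S = "{s. \<exists>g. (\<forall>e. g e \<in> A) \<and> s = (\<Sum>e\<in>B. g e \<otimes> e)}"
  have "s \<in> ?S"
  proof (rule tensor_sub_image[OF clinear_ident _ _ s(1)])
    show "cvec.subspace ?S"
      unfolding cvec.subspace_def
    proof (intro conjI ballI allI)
      show "0 \<in> ?S" using cvec.subspace_0[OF A] by (intro CollectI exI[of _ "\<lambda>_. 0"]) simp
      fix s s' assume "s \<in> ?S" "s' \<in> ?S"
      then obtain g g' where "\<forall>e. g e \<in> A" "s = (\<Sum>e\<in>B. g e \<otimes> e)" "\<forall>e. g' e \<in> A" "s' = (\<Sum>e\<in>B. g' e \<otimes> e)"
        by blast
      then show "s + s' \<in> ?S"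
        by (intro CollectI exI[of _ "\<lambda>e. g e + g' e"]) (simp add: tensor_add_left sum.distrib cvec.subspace_add[OF A])
    next
      fix r s assume "s \<in> ?S"
      then obtain g where "\<forall>e. g e \<in> A" "s = (\<Sum>e\<in>B. g e \<otimes> e)" by blast
      then show "r *\<^sub>C s \<in> ?S"
        by (intro CollectI exI[of _ "\<lambda>e. r *\<^sub>C g e"])
          (simp add: tensor_scale_left cvec.scale_sum_right cvec.subspace_scale[OF A])
    qed
  next
    fix x :: 'a and v :: 'v assume x: "x \<in> A"
    have "v = (\<Sum>e\<in>B. cvec.representation B v e *\<^sub>C e)"
      using cvec.sum_representation_eq[OF B(2) _ fin order_refl, of v] span by simp
    then have "x \<otimes> v = x \<otimes> (\<Sum>e\<in>B. cvec.representation B v e *\<^sub>C e)" by simp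
    also have "\<dots> = (\<Sum>e\<in>B. (cvec.representation B v e *\<^sub>C x) \<otimes> e)"
      by (simp add: clinear_sum[OF clinear_tensor_right] tensor_scale_left tensor_scale_right)
    finally show "x \<otimes> v \<in> ?S"
      using cvec.subspace_scale[OF A x] by (intro CollectI exI[of _ "\<lambda>e. cvec.representation B v e *\<^sub>C x"]) simp
  qed
  then obtain g where g: "\<And>e. g e \<in> A" "s = (\<Sum>e\<in>B. g e \<otimes> e)" by blast
  \<comment> \<open>The basis vectors stand on the right, whereas
    \<open>tensor_independent_sum\<close> wants independent first factors.\<close>
  have swap: "bilin (\<lambda>x y. y \<otimes> x)"
    by (intro bilinI clinear_tensor_left clinear_tensor_right)
  have "0 = tensor_lift (\<lambda>x y. y \<otimes> x) (tmap f (\<lambda>v. v) s)"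
    by (simp add: s(2) clinear_0[OF clinear_tensor_lift[OF swap]])
  also have "\<dots> = (\<Sum>e\<in>B. e \<otimes> f (g e))"
    by (simp add: g(2) clinear_sum[OF clinear_tmap[OF f clinear_ident]] clinear_sum[OF clinear_tensor_lift[OF swap]]
        tmap_tensor[OF f clinear_ident] tensor_lift_tensor[OF swap])
  finally have z: "(\<Sum>e\<in>B. e \<otimes> f (g e)) = 0" by simp
  have "f (g e) = 0" if "e \<in> B" for e
    by (rule tensor_independent_sum[OF B(2) fin z that])
  then show ?thesis
    unfolding g(2) by (intro cvec.subspace_sum[OF subspace_tensor_sub] tensor_subI) (use g(1) in auto)
qed

context tensor_module
begin

context
  fixes n :: int
begin

abbreviation "phi_map \<equiv> phi \<rho> ubar \<sigma> a b n"

text \<open>Ordered products span \<open>U(L(g)\<^sub>-)\<close>, so the chosen \<open>phi\<close>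
  agrees there with the map from \<open>phi_exists\<close> and inherits its rules for single
  generators.\<close>

lemma phi_facts:
  shows clinear_phi: "clinear phi_map"
    and phi_xyz: "\<And>x y z v. x \<in> uea_sub loop_minus \<Longrightarrow> y \<in> uea_sub vir_minus \<Longrightarrow> z \<in> uea_sub (av_g 0 ` n_minus) \<Longrightarrow>
      phi_map ((x * y * z) \<otimes> v) = psi a b n y *\<^sub>C (uea_act \<rho> z ubar \<otimes> uea_circ \<sigma> (omit_t x) v)"
    and phi_g: "\<And>i x P v. i > 0 \<Longrightarrow> P \<in> uea_sub av_minus \<Longrightarrow>
      phi_map ((ugen (av_g (- i) x) * P) \<otimes> v) = - phi_map (P \<otimes> \<sigma> x v)"
    and phi_d: "\<And>i P p v. i > 0 \<Longrightarrow> lowering P p \<Longrightarrow>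
      phi_map ((ugen (av_d (- i)) * P) \<otimes> v) = (of_int p - a - of_int n - of_int i + b * of_int i) *\<^sub>C phi_map (P \<otimes> v)"
proof -
  obtain F where F: "bilin F"
    "\<And>x y z v. x \<in> uea_sub loop_minus \<Longrightarrow> y \<in> uea_sub vir_minus \<Longrightarrow> z \<in> uea_sub (av_g 0 ` n_minus) \<Longrightarrow>
      F (x * y * z) v = psi a b n y *\<^sub>C (uea_act \<rho> z ubar \<otimes> uea_circ \<sigma> (omit_t x) v)"
    "\<And>i x P v. i > 0 \<Longrightarrow> F (ugen (av_g (- i) x) * P) v = - F P (\<sigma> x v)"
    "\<And>i P p v. i > 0 \<Longrightarrow> lowering P p \<Longrightarrow>
      F (ugen (av_d (- i)) * P) v = (of_int p - a - of_int n - of_int i + b * of_int i) *\<^sub>C F P v"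
    using phi_exists[OF mod \<sigma>_mod, of a b n ubar] by blast
  let ?spec = "\<lambda>f. clinear f \<and>
    (\<forall>x\<in>uea_sub loop_minus. \<forall>y\<in>uea_sub vir_minus. \<forall>z\<in>uea_sub (av_g 0 ` n_minus). \<forall>v.
      f ((x * y * z) \<otimes> v) = psi a b n y *\<^sub>C (uea_act \<rho> z ubar \<otimes> uea_circ \<sigma> (omit_t x) v))"
  have "?spec (tensor_lift F)"
    using F(2) by (simp add: clinear_tensor_lift[OF F(1)] tensor_lift_tensor[OF F(1)])
  from someI[of ?spec, OF this] have spec: "?spec phi_map" unfolding phi_def .
  then show lin: "clinear phi_map" by blast
  show xyz: "\<And>x y z v. x \<in> uea_sub loop_minus \<Longrightarrow> y \<in> uea_sub vir_minus \<Longrightarrow> z \<in> uea_sub (av_g 0 ` n_minus) \<Longrightarrow>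
      phi_map ((x * y * z) \<otimes> v) = psi a b n y *\<^sub>C (uea_act \<rho> z ubar \<otimes> uea_circ \<sigma> (omit_t x) v)"
    using spec by blast
  have phi_F: "phi_map (P \<otimes> v) = F P v" if "P \<in> uea_sub av_minus" for P v
    by (rule clinear_eq_on_span[OF clinear_comp[OF lin clinear_tensor_left] bilinD(2)[OF F(1)] _ av_minus_ordered[OF that]])
      (use xyz F(2) in auto)
  show "phi_map ((ugen (av_g (- i) x) * P) \<otimes> v) = - phi_map (P \<otimes> \<sigma> x v)"
    if "i > 0" "P \<in> uea_sub av_minus" for i x P v
    using that by (simp add: phi_F av_minus_mult F(3))
  show "phi_map ((ugen (av_d (- i)) * P) \<otimes> v) = (of_int p - a - of_int n - of_int i + b * of_int i) *\<^sub>C phi_map (P \<otimes> v)"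
    if "i > 0" "lowering P p" for i P p v
    using that lowering_av_minus[OF that(2)] by (simp add: phi_F av_minus_mult F(4))
qed

lemma phi_n_minus: "z \<in> uea_sub (av_g 0 ` n_minus) \<Longrightarrow> phi_map (z \<otimes> v) = uea_act \<rho> z ubar \<otimes> v"
proof -
  assume z: "z \<in> uea_sub (av_g 0 ` n_minus)"
  have "psi a b n (1 :: 'g affvir uea) = 1"
    using psi_spec[of a b n] by (metis (no_types, lifting) empty_iff empty_set length_0_conv lessThan_0 list.simps(8)
        list.size(3) prod.empty prod_list.Nil rev.simps(1))
  moreover have "omit_t (1 :: 'g affvir uea) = 1"
    using omit_t_spec by (metis (no_types, lifting) empty_iff empty_set list.simps(8) prod_list.Nil)
  ultimately show ?thesis
    using phi_xyz[OF uea_sub.one uea_sub.one z, of v] by (simp add: uea_circ_1[OF \<sigma>_mod] scaleC_one)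
qed

lemma phi_top: "P \<in> uea_sub av_minus \<Longrightarrow> phi_map (P \<otimes> v) \<in> tensor_sub (top_space l \<rho>) UNIV"
  by (rule subspace_vimageD[OF clinear_comp[OF clinear_phi clinear_tensor_left] subspace_tensor_sub av_minus_ordered])
    (auto simp: phi_xyz top_space_eq intro!: cvec.subspace_scale[OF subspace_tensor_sub] tensor_subI)

text \<open>The factor by which \<open>d\<^sub>-\<^sub>i\<close> acts under \<open>\<phi>\<^sub>n\<close> is the one by which it acts on coinvariants.\<close>

lemma tensor_d_lowering:
  assumes "lowering P p"
  shows "tensor_d (- i) (n + i) (uea_act \<rho> P ubar \<otimes> v) = \<rho> (av_d (- i)) (uea_act \<rho> P ubar) \<otimes> v
    - (of_int p - a - of_int n - of_int i + b * of_int i) *\<^sub>C (uea_act \<rho> P ubar \<otimes> v)"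
  by (simp add: shift_d_def d0_lowering[OF assms] tensor_add_left tensor_diff_left tensor_scale_left scaleC_add_left
      cvec.scale_left_diff_distrib cvec.scale_minus_left)

lemma phi_lower_image:
  assumes "P \<in> uea_sub av_minus"
  shows "uea_act \<rho> P ubar \<otimes> v - phi_map (P \<otimes> v) \<in> lower_image n"
proof -
  note S = subspace_lower_image[of n]
  have "uea_act \<rho> P ubar \<otimes> v - phi_map (P \<otimes> v) \<in> lower_image n" if "lowering P p" for P p v
    using that
  proof (induction arbitrary: v)
    case (base z)
    then show ?case by (simp add: phi_n_minus cvec.subspace_0[OF S])
  next
    case (g P p i x)
    let ?w = "uea_act \<rho> P ubar"
    have "tensor_g (- i) x (?w \<otimes> v) - (?w \<otimes> \<sigma> x v - phi_map (P \<otimes> \<sigma> x v)) \<in> lower_image n"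
      by (intro cvec.subspace_diff[OF S] lower_imageI g.hyps g.IH)
    then show ?case
      by (simp add: act_mult phi_g[OF g.hyps(2) lowering_av_minus[OF g.hyps(1)]])
  next
    case (d P p i)
    let ?w = "uea_act \<rho> P ubar" and ?r = "of_int p - a - of_int n - of_int i + b * of_int i"
    have "tensor_d (- i) (n + i) (?w \<otimes> v) + ?r *\<^sub>C (?w \<otimes> v - phi_map (P \<otimes> v)) \<in> lower_image n"
      by (intro subspace_closed[OF S] lower_imageI d.hyps d.IH)
    then show ?case
      unfolding tensor_d_lowering[OF d.hyps(1)]
      by (simp add: act_mult phi_d[OF d.hyps(2,1)] cvec.scale_right_diff_distrib)
  qed
  then show ?thesis
    by (intro subspace_vimageD[OF clinear_minus[OF clinear_comp[OF clinear_tensor_left act_lin_left]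
          clinear_comp[OF clinear_phi clinear_tensor_left]] S av_minus_lowering[OF assms]]) auto
qed

abbreviation "eval_map \<equiv> tmap (\<lambda>P. uea_act \<rho> P ubar) (\<lambda>v :: 'v. v)"

lemma eval_tensor: "eval_map (P \<otimes> v) = uea_act \<rho> P ubar \<otimes> v"
  by (rule tmap_tensor[OF act_lin_left clinear_ident])

lemma clinear_eval: "clinear eval_map"
  by (rule clinear_tmap[OF act_lin_left clinear_ident])

text \<open>The lifts are \<open>x(-i) P \<otimes> v + P \<otimes> x v\<close> and
  \<open>d\<^sub>-\<^sub>i P \<otimes> v - r (P \<otimes> v)\<close>, with \<open>r\<close> the
  scalar from \<open>phi_d\<close>. Since \<open>r\<close> depends on the degree, in the second case
  \<open>P\<close> has to run through homogeneous elements.\<close>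

lemma lower_image_lift:
  assumes "s \<in> lower_image n"
  shows "\<exists>t\<in>tensor_sub (uea_sub av_minus) UNIV. eval_map t = s \<and> phi_map t = 0"
proof -
  let ?K = "{t \<in> tensor_sub (uea_sub av_minus) UNIV. phi_map t = 0}"
  have T: "cvec.subspace (tensor_sub (uea_sub av_minus) (UNIV :: 'v set) :: ('g affvir uea, 'v) tensor set)"
    by (rule subspace_tensor_sub)
  have K: "cvec.subspace ?K"
    using T by (auto simp: cvec.subspace_def clinear_simps[OF clinear_phi])
  note S = subspace_image[OF clinear_eval K]
  have "s \<in> eval_map ` ?K"
  proof (rule subspace_vimageD[OF clinear_ident S assms[unfolded lower_image_def]])
    fix s' assume "s' \<in> lower_gens n"
    then consider i x w v where "s' = tensor_g (- i) x (w \<otimes> v)" "i > 0"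
      | i w v where "s' = tensor_d (- i) (n + i) (w \<otimes> v)" "i > 0"
      unfolding lower_gens_def by blast
    then show "s' \<in> eval_map ` ?K"
    proof cases
      case 1
      obtain P where P: "P \<in> uea_sub av_minus" "w = uea_act \<rho> P ubar" using generated_av_minus by blast
      let ?t = "(ugen (av_g (- i) x) * P) \<otimes> v + P \<otimes> \<sigma> x v"
      have "?t \<in> ?K"
        using av_minus_mult[OF 1(2) P(1)] P(1) 1(2)
        by (simp add: phi_g clinear_add[OF clinear_phi] cvec.subspace_add[OF T] tensor_subI)
      moreover have "eval_map ?t = s'"
        by (simp add: clinear_add[OF clinear_eval] eval_tensor act_mult 1(1) P(2))
      ultimately show ?thesis by blast
    next
      case 2
      have "tensor_d (- i) (n + i) (w \<otimes> v) \<in> eval_map ` ?K"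
      proof (induction w rule: lowering_induct)
        case (lowering P p)
        let ?t = "(ugen (av_d (- i)) * P) \<otimes> v - (of_int p - a - of_int n - of_int i + b * of_int i) *\<^sub>C (P \<otimes> v)"
        have "?t \<in> ?K"
          using av_minus_mult[OF 2(2) lowering_av_minus[OF lowering]] lowering_av_minus[OF lowering]
          by (simp add: phi_d[OF 2(2) lowering] clinear_simps[OF clinear_phi]
              subspace_closed[OF T] tensor_subI)
        moreover have "eval_map ?t = tensor_d (- i) (n + i) (uea_act \<rho> P ubar \<otimes> v)"
          unfolding tensor_d_lowering[OF lowering]
          by (simp add: clinear_simps[OF clinear_eval] eval_tensor act_mult)
        ultimately show ?case by (metis (no_types, lifting) imageI)
      next
        case (add w w')
        then show ?case
          by (simp only: tensor_add_left clinear_add[OF clinear_tensor_d] cvec.subspace_add[OF S])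
      next
        case (scale r w)
        then show ?case
          by (simp only: tensor_scale_left clinear_scale[OF clinear_tensor_d] cvec.subspace_scale[OF S])
      qed
      with 2(1) show ?thesis by simp
    qed
  qed
  then show ?thesis by blast
qed

text \<open>For \<open>z\<close> in \<open>U(n_minus)\<close> evaluation and
  \<open>\<phi>\<^sub>n\<close> agree on \<open>z \<otimes> v\<close>, and the vectors
  \<open>z ubar\<close> fill the top space.\<close>

lemma top_lift:
  assumes "s \<in> tensor_sub (top_space l \<rho>) UNIV"
  shows "\<exists>t\<in>tensor_sub (uea_sub av_minus) UNIV. eval_map t = s \<and> phi_map t = s"
proof -
  let ?K = "{t \<in> tensor_sub (uea_sub av_minus) UNIV. eval_map t = phi_map t}"
  have T: "cvec.subspace (tensor_sub (uea_sub av_minus) (UNIV :: 'v set) :: ('g affvir uea, 'v) tensor set)"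
    by (rule subspace_tensor_sub)
  have K: "cvec.subspace ?K"
    using T by (auto simp: cvec.subspace_def clinear_simps[OF clinear_phi] clinear_simps[OF clinear_eval])
  have "s \<in> phi_map ` ?K"
  proof (rule tensor_sub_image[OF clinear_ident subspace_image[OF clinear_phi K] _ assms])
    fix w and v :: 'v assume "w \<in> top_space l \<rho>"
    then obtain z where z: "z \<in> uea_sub (av_g 0 ` n_minus)" "w = uea_act \<rho> z ubar"
      unfolding top_space_eq by blast
    have "z \<otimes> v \<in> ?K"
      using lowering_av_minus[OF lowering.base[OF z(1)]] by (simp add: tensor_subI eval_tensor phi_n_minus z(1))
    moreover have "w \<otimes> v = phi_map (z \<otimes> v)" by (simp add: phi_n_minus z)
    ultimately show "w \<otimes> v \<in> phi_map ` ?K" by (rule rev_image_eqI)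
  qed
  then show ?thesis by auto
qed

theorem phi_annihilator_iff:
  "phi_map ` tensor_sub (annihilator \<rho> ubar) UNIV = tensor_sub (top_space l \<rho>) UNIV \<longleftrightarrow> lower_image n = UNIV"
proof
  note S = subspace_lower_image[of n]
  assume eq: "phi_map ` tensor_sub (annihilator \<rho> ubar) UNIV = tensor_sub (top_space l \<rho>) UNIV"
  have top: "s \<in> lower_image n" if s: "s \<in> tensor_sub (top_space l \<rho>) UNIV" for s
  proof -
    obtain t where t: "t \<in> tensor_sub (annihilator \<rho> ubar) UNIV" "s = phi_map t" using s eq by blast
    show ?thesis unfolding t(2)
    proof (rule tensor_sub_image[OF clinear_phi S _ t(1)])
      fix P v assume "P \<in> annihilator \<rho> ubar"
      then show "phi_map (P \<otimes> v) \<in> lower_image n"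
        using cvec.subspace_neg[OF S phi_lower_image[of P v]] by (simp add: annihilator_def)
    qed
  qed
  have "w \<otimes> v \<in> lower_image n" for w v
  proof -
    obtain P where P: "P \<in> uea_sub av_minus" "w = uea_act \<rho> P ubar" using generated_av_minus by blast
    show ?thesis
      using cvec.subspace_add[OF S phi_lower_image[OF P(1), of v] top[OF phi_top[OF P(1), of v]]] by (simp add: P(2))
  qed
  then have "s \<in> lower_image n" for s
    by (induction s rule: tensor_induct) (simp_all add: cvec.subspace_add[OF S])
  then show "lower_image n = UNIV" by blast
next
  assume low: "lower_image n = UNIV"
  obtain BV :: "'v set" where BV: "finite BV" "cvec.span BV = UNIV"
    using \<sigma>_irr by (auto simp: fin_dim_irreducible_def)
  show "phi_map ` tensor_sub (annihilator \<rho> ubar) UNIV = tensor_sub (top_space l \<rho>) UNIV"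
  proof (intro equalityI subsetI)
    fix s assume "s \<in> phi_map ` tensor_sub (annihilator \<rho> ubar) UNIV"
    then obtain t where t: "t \<in> tensor_sub (annihilator \<rho> ubar) UNIV" "s = phi_map t" by blast
    show "s \<in> tensor_sub (top_space l \<rho>) UNIV" unfolding t(2)
      by (rule tensor_sub_image[OF clinear_phi subspace_tensor_sub _ t(1)]) (simp add: annihilator_def phi_top)
  next
    fix s assume s: "s \<in> tensor_sub (top_space l \<rho>) (UNIV :: 'v set)"
    obtain t0 where t0: "t0 \<in> tensor_sub (uea_sub av_minus) UNIV" "eval_map t0 = s" "phi_map t0 = s"
      using top_lift[OF s] by blast
    obtain t1 where t1: "t1 \<in> tensor_sub (uea_sub av_minus) UNIV" "eval_map t1 = s" "phi_map t1 = 0"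
      using lower_image_lift[of s] low by blast
    \<comment> \<open>Both elements evaluate to \<open>s\<close>, but only the first has image
      \<open>s\<close> under \<open>\<phi>\<^sub>n\<close>; their difference is therefore a preimage
      of \<open>s\<close> in the kernel of evaluation.\<close>
    have "t0 - t1 \<in> tensor_sub {P \<in> uea_sub av_minus. uea_act \<rho> P ubar = 0} UNIV"
      by (rule tensor_sub_kernel[OF act_lin_left subspace_uea_sub BV cvec.subspace_diff[OF subspace_tensor_sub t0(1) t1(1)]])
        (simp add: clinear_diff[OF clinear_eval] t0 t1)
    then have "t0 - t1 \<in> tensor_sub (annihilator \<rho> ubar) UNIV" by (simp add: annihilator_def)
    moreover have "phi_map (t0 - t1) = s" by (simp add: clinear_diff[OF clinear_phi] t0 t1)
    ultimately show "s \<in> phi_map ` tensor_sub (annihilator \<rho> ubar) UNIV" by blast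
  qed
qed

end

end

theorem theorem4p3:
  fixes lam \<mu> :: "'g::simple_lie_algebra \<Rightarrow> complex"
    and l k c a b :: complex
    and \<rho> :: "'g affvir \<Rightarrow> 'm::complex_vector \<Rightarrow> 'm" and ubar :: 'm
    and \<sigma> :: "'g \<Rightarrow> 'v::complex_vector \<Rightarrow> 'v"
  assumes "lam \<in> dual_of cartan"
    and "irreducible_verma_quotient lam l k c \<rho> ubar"
    and "\<mu> \<in> dominant_integral" and "\<mu> \<noteq> (\<lambda>_. 0)"
    and "fin_dim_irreducible \<mu> \<sigma>"
    and "0 \<le> Re a" and "Re a < 1"
  shows "irreducible_module (tensor_act \<rho> ubar \<sigma> k c a b) \<longleftrightarrow>
    (\<forall>n::int. phi \<rho> ubar \<sigma> a b n ` tensor_sub (annihilator \<rho> ubar) UNIV =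
      tensor_sub (top_space l \<rho>) UNIV)"
proof -
  interpret tensor_module lam l k c \<rho> ubar \<mu> \<sigma> a b
    by unfold_locales (use assms in \<open>auto simp: dominant_integral_def\<close>)
  show ?thesis
    by (simp add: tensor_act_eq irreducible_tau_iff phi_annihilator_iff)
qed

end
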